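(* Let $S$ be a complex manifold, $n\ge 1$ an integer, and let $X\subset S\times\mathbb{C}^n$ be a pseudoconvex family. For each $s\in S$ let $$v(s)=\sup\{\mathrm{Vol}\,E : E\in\mathbb{E}_0,\ E\subset X[s]\}\in(0,\infty].$$ (If $X[s]$ contains a hermitian ellipsoid of maximal volume, $v(s)$ is the volume of that ellipsoid.) Then $-\log v:S\to[-\infty,\infty)$ is a plurisubharmonic function.
   Context: $\mathbb{E}_0$ denotes the set of hermitian ellipsoids in $\mathbb{C}^n$, i.e. the images of the open unit ball of $\mathbb{C}^n$ under invertible complex linear maps $\mathbb{C}^n\to\mathbb{C}^n$ (in particular they are centered at $0$). $\mathrm{Vol}$ is Lebesgue measure on $\mathbb{C}^n$. For an open set $X\subset S\times\mathbb{C}^n$ and $s\in S$, the fiber is $X[s]=\{x\in\mathbb{C}^n:(s,x)\in X\}$. A family of pseudoconvex open sets over $S$ is an open set $X\subset S\times\mathbb{C}^n$ that contains $S\times\{0\}$ and such that each fiber $X[s]$, $s\in S$, is pseudoconvex. It is called a pseudoconvex family if in addition $X$ is a Stein manifold. Convention: $-\log\infty=-\infty$, and a plurisubharmonic function may be identically $-\infty$ (on connected components of its domain). *)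

theory Defs
  imports "HOL-Analysis.Analysis"
begin

section \<open>Holomorphic and plurisubharmonic functions on subsets of \<open>complex ^ 'm\<close>\<close>

text \<open>
  Charts of a manifold take values in coordinate subspaces of \<open>complex ^ 'm\<close>. Since types are
  nonempty, this is what makes manifolds of dimension 0 available; it also lets the dimension
  differ between connected components. The notions of this section are therefore
  used for sets \<open>D\<close> that are relatively open in some coordinate subspace.
\<close>

definition coord_subspace :: "'m set \<Rightarrow> (complex ^ 'm::finite) set" where
  "coord_subspace I = {z. \<forall>i. i \<notin> I \<longrightarrow> z $ i = 0}"

text \<open>
  \<open>has_derivative\<close> already provides a bounded real-linear derivative. If \<open>D\<close> is relatively open in
  a proper coordinate subspace then only the restriction of \<open>f'\<close> to that subspace is determined, and
  that restriction is complex linear iff it has a complex linear extension \<open>f'\<close>.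
\<close>

definition holomorphic_fun_on :: "(complex ^ 'm::finite \<Rightarrow> complex) \<Rightarrow> (complex ^ 'm) set \<Rightarrow> bool" where
  "holomorphic_fun_on f D \<longleftrightarrow>
     (\<forall>z\<in>D. \<exists>f'. (f has_derivative f') (at z within D) \<and> (\<forall>c v. f' (c *s v) = c * f' v))"

definition holomorphic_vec_on ::
    "(complex ^ 'm::finite \<Rightarrow> complex ^ 'k::finite) \<Rightarrow> (complex ^ 'm) set \<Rightarrow> bool" where
  "holomorphic_vec_on f D \<longleftrightarrow> (\<forall>j. holomorphic_fun_on (\<lambda>z. f z $ j) D)"

definition usc_on :: "'a::topological_space set \<Rightarrow> ('a \<Rightarrow> ereal) \<Rightarrow> bool" where
  "usc_on D u \<longleftrightarrow> (\<forall>c. openin (top_of_set D) {x \<in> D. u x < c})"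

text \<open>
  The extended Lebesgue integral, integral of the positive part minus integral of the negative
  part; \<open>e2ennreal\<close> maps negative numbers to \<open>0\<close>. For an upper semicontinuous function with values
  in \<open>[-\<infinity>, \<infinity>)\<close> on a circle the first integral is finite.
\<close>

definition ereal_integral :: "'a measure \<Rightarrow> ('a \<Rightarrow> ereal) \<Rightarrow> ereal" where
  "ereal_integral M f =
     enn2ereal (\<integral>\<^sup>+x. e2ennreal (f x) \<partial>M) - enn2ereal (\<integral>\<^sup>+x. e2ennreal (- f x) \<partial>M)"

definition circle_mean :: "(complex \<Rightarrow> ereal) \<Rightarrow> complex \<Rightarrow> real \<Rightarrow> ereal" where
  "circle_mean u z r =
     ereal (1 / (2 * pi)) *
     ereal_integral (restrict_space lborel {0..2 * pi}) (\<lambda>t. u (z + complex_of_real r * cis t))"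

definition subharmonic_on :: "complex set \<Rightarrow> (complex \<Rightarrow> ereal) \<Rightarrow> bool" where
  "subharmonic_on D u \<longleftrightarrow>
     usc_on D u \<and> (\<forall>z\<in>D. u z < \<infinity>) \<and>
     (\<forall>z r. 0 < r \<and> cball z r \<subseteq> D \<longrightarrow> u z \<le> circle_mean u z r)"

text \<open>
  Complex lines that are not contained in the coordinate subspace carrying \<open>D\<close> meet \<open>D\<close> in at most
  one point and impose no condition.
\<close>

definition plurisubharmonic_on :: "(complex ^ 'm::finite) set \<Rightarrow> (complex ^ 'm \<Rightarrow> ereal) \<Rightarrow> bool" where
  "plurisubharmonic_on D u \<longleftrightarrow>
     usc_on D u \<and> (\<forall>z\<in>D. u z < \<infinity>) \<and>
     (\<forall>z w. subharmonic_on {\<tau>. z + \<tau> *s w \<in> D} (\<lambda>\<tau>. u (z + \<tau> *s w)))"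

text \<open>Existence of a continuous plurisubharmonic exhaustion function.\<close>

definition pseudoconvex :: "(complex ^ 'n::finite) set \<Rightarrow> bool" where
  "pseudoconvex D \<longleftrightarrow>
     open D \<and>
     (\<exists>u :: complex ^ 'n \<Rightarrow> real.
        continuous_on D u \<and> plurisubharmonic_on D (\<lambda>z. ereal (u z)) \<and>
        (\<forall>c. compact {z \<in> D. u z \<le> c}))"

section \<open>Complex manifolds\<close>

text \<open>
  A chart is a pair of its domain and its coordinate map; the values of the map off the domain are
  irrelevant. A manifold is given by its topology and an atlas, not necessarily maximal.
\<close>

type_synonym ('a, 'm) chart = "'a set \<times> ('a \<Rightarrow> complex ^ 'm)"

definition is_chart :: "'a topology \<Rightarrow> ('a, 'm::finite) chart \<Rightarrow> bool" where
  "is_chart T = (\<lambda>(U, \<phi>).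
     openin T U \<and>
     (\<exists>I. openin (top_of_set (coord_subspace I)) (\<phi> ` U)) \<and>
     homeomorphic_map (subtopology T U) (top_of_set (\<phi> ` U)) \<phi>)"

definition complex_manifold :: "'a topology \<Rightarrow> ('a, 'm::finite) chart set \<Rightarrow> bool" where
  "complex_manifold T A \<longleftrightarrow>
     Hausdorff_space T \<and> second_countable T \<and>
     (\<forall>c\<in>A. is_chart T c) \<and> (\<Union>(U, \<phi>)\<in>A. U) = topspace T \<and>
     (\<forall>(U, \<phi>)\<in>A. \<forall>(V, \<psi>)\<in>A. holomorphic_vec_on (\<psi> \<circ> inv_into U \<phi>) (\<phi> ` (U \<inter> V)))"

definition holomorphic_on_manifold :: "('a, 'm::finite) chart set \<Rightarrow> ('a \<Rightarrow> complex) \<Rightarrow> bool" where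
  "holomorphic_on_manifold A f \<longleftrightarrow> (\<forall>(U, \<phi>)\<in>A. holomorphic_fun_on (f \<circ> inv_into U \<phi>) (\<phi> ` U))"

definition plurisubharmonic_on_manifold :: "('a, 'm::finite) chart set \<Rightarrow> ('a \<Rightarrow> ereal) \<Rightarrow> bool" where
  "plurisubharmonic_on_manifold A u \<longleftrightarrow>
     (\<forall>(U, \<phi>)\<in>A. plurisubharmonic_on (\<phi> ` U) (u \<circ> inv_into U \<phi>))"

text \<open>
  The bound is quantified instead of being written as a supremum over \<open>K\<close>, since the real
  supremum of the empty set is unspecified.
\<close>

definition holomorphic_hull :: "'a topology \<Rightarrow> ('a, 'm::finite) chart set \<Rightarrow> 'a set \<Rightarrow> 'a set" where
  "holomorphic_hull T A K =
     {x \<in> topspace T. \<forall>f. holomorphic_on_manifold A f \<longrightarrow>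
        (\<forall>c. (\<forall>y\<in>K. cmod (f y) \<le> c) \<longrightarrow> cmod (f x) \<le> c)}"

definition stein_manifold :: "'a topology \<Rightarrow> ('a, 'm::finite) chart set \<Rightarrow> bool" where
  "stein_manifold T A \<longleftrightarrow>
     complex_manifold T A \<and>
     (\<forall>K. compactin T K \<longrightarrow> compactin T (holomorphic_hull T A K)) \<and>
     (\<forall>x\<in>topspace T. \<forall>y\<in>topspace T. x \<noteq> y \<longrightarrow>
        (\<exists>f. holomorphic_on_manifold A f \<and> f x \<noteq> f y))"

definition vec_append :: "complex ^ 'm::finite \<Rightarrow> complex ^ 'n::finite \<Rightarrow> complex ^ ('m + 'n)" where
  "vec_append z w = (\<chi> k. case k of Inl i \<Rightarrow> z $ i | Inr j \<Rightarrow> w $ j)"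

text \<open>The atlas of the product of a manifold with \<open>complex ^ 'n\<close>.\<close>

definition times_vec_atlas ::
    "('a, 'm::finite) chart set \<Rightarrow> ('a \<times> (complex ^ 'n::finite), 'm + 'n) chart set" where
  "times_vec_atlas A = (\<lambda>(U, \<phi>). (U \<times> UNIV, \<lambda>(s, x). vec_append (\<phi> s) x)) ` A"

definition restrict_atlas :: "('a, 'm::finite) chart set \<Rightarrow> 'a set \<Rightarrow> ('a, 'm) chart set" where
  "restrict_atlas A X = (\<lambda>(U, \<phi>). (U \<inter> X, \<phi>)) ` A"

section \<open>Families of pseudoconvex sets and hermitian ellipsoids\<close>

definition fiber :: "('s \<times> 'x) set \<Rightarrow> 's \<Rightarrow> 'x set" where
  "fiber X s = {x. (s, x) \<in> X}"

definition family_of_pseudoconvex_sets :: "'s topology \<Rightarrow> ('s \<times> (complex ^ 'n::finite)) set \<Rightarrow> bool" where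
  "family_of_pseudoconvex_sets S X \<longleftrightarrow>
     openin (prod_topology S euclidean) X \<and> topspace S \<times> {0} \<subseteq> X \<and>
     (\<forall>s\<in>topspace S. pseudoconvex (fiber X s))"

definition pseudoconvex_family ::
    "'s topology \<Rightarrow> ('s, 'm::finite) chart set \<Rightarrow> ('s \<times> (complex ^ 'n::finite)) set \<Rightarrow> bool" where
  "pseudoconvex_family S A X \<longleftrightarrow>
     family_of_pseudoconvex_sets S X \<and>
     stein_manifold (subtopology (prod_topology S euclidean) X)
       (restrict_atlas (times_vec_atlas A) X)"

definition hermitian_ellipsoids :: "(complex ^ 'n::finite) set set" where
  "hermitian_ellipsoids =
     {f ` ball 0 1 | f :: complex ^ 'n \<Rightarrow> complex ^ 'n. Vector_Spaces.linear (*s) (*s) f \<and> bij f}"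

definition max_ellipsoid_vol :: "('s \<times> (complex ^ 'n::finite)) set \<Rightarrow> 's \<Rightarrow> ennreal" where
  "max_ellipsoid_vol X s = (SUP E\<in>{E \<in> hermitian_ellipsoids. E \<subseteq> fiber X s}. emeasure lborel E)"

text \<open>The convention for the value of \<open>- log\<close> at \<open>\<infinity>\<close> is \<open>- \<infinity>\<close>.\<close>

definition neg_log :: "ennreal \<Rightarrow> ereal" where
  "neg_log a = (if a = \<infinity> then - \<infinity> else if a = 0 then \<infinity> else ereal (- ln (enn2real a)))"

end

theory Submission
  imports Defs "HOL-Complex_Analysis.Complex_Analysis"
begin

unbundle no fps_syntax

text \<open>
  A hermitian ellipsoid is \<open>T B\<close> with \<open>B\<close> the unit ball and \<open>T\<close> an invertible matrix, and its volume is
  \<open>\<bar>det T\<bar>\<^sup>2 Vol B\<close>. So the mean value inequality to be proved says that, over a disc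
  \<open>\<zeta> \<mapsto> a + \<zeta> w\<close> in a chart of the base, ellipsoids \<open>T(\<zeta>) B\<close> in the fibers over the unit circle, chosen
  without any regularity in \<open>\<zeta>\<close>, can be replaced by an ellipsoid \<open>T B\<close> in the fiber over the center for which
  \<open>ln \<bar>det T\<bar>\<close> is almost as large as the mean of \<open>ln \<bar>det T(\<zeta>)\<bar>\<close>.

  The ellipsoid \<open>T B\<close> depends on the positive matrix \<open>P = T T*\<close> only. If \<open>P\<close> is a trigonometric
  polynomial on the circle, it factors there as \<open>P = F F*\<close> with a polynomial matrix \<open>F\<close> whose
  determinant has no zeros in the closed disc (the matrix theorem of Fejer and Riesz). Then
  \<open>ln \<bar>det F\<bar>\<close> is harmonic, and its value at \<open>0\<close> is the mean of its boundary values
  (\<open>log_modulus_mean_value\<close>). Moreover \<open>F(0) B\<close> lies in the fiber over the center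
  (\<open>continuity_principle\<close>): for \<open>\<bar>x\<bar> \<le> 1\<close> the discs \<open>\<zeta> \<mapsto> t F(\<zeta>) x\<close>, \<open>0 \<le> t \<le> 1\<close>, have their boundaries in
  a fixed compact subset \<open>K\<close> of \<open>X\<close>, since \<open>t F(\<zeta>) x = F(\<zeta>) (t x)\<close>. For \<open>t = 0\<close> the disc lies in the
  zero section, hence in \<open>X\<close>; as long as a disc lies in \<open>X\<close>, the maximum principle keeps it in the
  holomorphic hull of \<open>K\<close>, which is compact because \<open>X\<close> is Stein. So the discs cannot leave \<open>X\<close>.

  The boundary data are turned into a trigonometric polynomial as follows. Finitely many matrices
  \<open>T\<^sub>i\<close> are used on disjoint compact subsets of the circle, of almost full measure. With scalar
  polynomials \<open>q\<^sub>i\<close> that have modulus almost \<open>1\<close> on the \<open>i\<close>-th set and almost \<open>0\<close> away from it, put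
  \<open>P = \<delta>\<^sup>2 I + \<Sum>\<^sub>i \<bar>q\<^sub>i\<bar>\<^sup>2 T\<^sub>i T\<^sub>i*\<close> (\<open>ellipsoid_interpolation\<close>). This is a sum of squares of polynomial
  vectors, so the factorization only has to merge one more square \<open>c c*\<close> into a given \<open>F\<^sub>0 F\<^sub>0*\<close>
  (\<open>rank_one_factorization\<close>), and this follows by maximizing \<open>\<bar>det F(0)\<bar>\<close> over all pairs \<open>(F, c)\<close> of
  bounded degree with the same \<open>F F* + c c*\<close>.

  Finally, the matrices may be taken from a countable dense set, so on the circle \<open>- ln v\<close> is the
  decreasing limit of functions with finitely many values, each of which is handled by the
  argument above; monotone convergence concludes (\<open>ellipsoid_circle_mean\<close>).
\<close>

section \<open>Matrix spectral factorization on the unit circle\<close>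

lemma higher_deriv_poly: "(deriv ^^ n) (poly p) = poly ((pderiv ^^ n) (p :: complex poly))"
proof (induction n)
  case (Suc n)
  have "deriv (poly q) = poly (pderiv q)" for q :: "complex poly"
    by (intro ext DERIV_imp_deriv poly_DERIV)
  then show ?case using Suc by simp
qed simp

text \<open>
  The Cauchy estimate. It turns a bound on the circle into the bound on the coefficients
  from which compactness of sets of polynomials follows.
\<close>

lemma coeff_bound_circle:
  fixes p :: "complex poly"
  assumes "\<And>z. cmod z = 1 \<Longrightarrow> cmod (poly p z) \<le> R"
  shows "cmod (coeff p k) \<le> R"
proof -
  have "norm ((deriv ^^ k) (poly p) 0) \<le> fact k * R / 1 ^ k"
    by (rule Cauchy_inequality) (auto intro!: holomorphic_intros continuous_intros assms)
  moreover have "(deriv ^^ k) (poly p) 0 = fact k * coeff p k"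
    by (simp add: higher_deriv_poly poly_0_coeff_0 coeff_higher_pderiv pochhammer_fact[symmetric])
  ultimately show ?thesis by (simp add: norm_mult)
qed

text \<open>
  A family \<open>G\<close> encodes the \<open>n \<times> (n + 1)\<close> matrix \<open>(F, c)\<close> of polynomials, with square part \<open>F\<close> and the
  additional column \<open>c\<close> at the index \<open>None\<close>. Its Gram matrix is \<open>F F* + c c*\<close>.
\<close>

definition gram :: "('n::finite \<Rightarrow> 'n option \<Rightarrow> complex poly) \<Rightarrow> complex \<Rightarrow> 'n \<Rightarrow> 'n \<Rightarrow> complex" where
  "gram G z i i' = (\<Sum>j\<in>UNIV. poly (G i j) z * cnj (poly (G i' j) z))"

definition square_part :: "('n::finite \<Rightarrow> 'n option \<Rightarrow> complex poly) \<Rightarrow> complex \<Rightarrow> complex ^ 'n ^ 'n" where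
  "square_part G z = (\<chi> i j. poly (G i (Some j)) z)"

definition factorizations ::
    "nat \<Rightarrow> (complex \<Rightarrow> 'n::finite \<Rightarrow> 'n \<Rightarrow> complex) \<Rightarrow> ('n \<Rightarrow> 'n option \<Rightarrow> complex poly) set" where
  "factorizations N P = {G. (\<forall>i j. degree (G i j) \<le> N) \<and> (\<forall>z. cmod z = 1 \<longrightarrow> gram G z = P z)}"

lemma continuous_on_det:
  fixes f :: "'a::topological_space \<Rightarrow> 'b::{real_normed_field} ^ 'n::finite ^ 'n"
  assumes "\<And>i j. continuous_on S (\<lambda>x. f x $ i $ j)"
  shows "continuous_on S (\<lambda>x. det (f x))"
  unfolding det_def by (intro continuous_intros assms)

text \<open>
  The diagonal of the Gram matrix bounds all entries on the circle, hence all coefficients, so the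
  factorizations of degree at most \<open>N\<close> form a compact set in the product space of the coefficients.
\<close>

lemma factorizations_attain_max:
  fixes G0 :: "'n::finite \<Rightarrow> 'n option \<Rightarrow> complex poly"
  assumes G0: "G0 \<in> factorizations N P"
  shows "\<exists>G\<in>factorizations N P. \<forall>H\<in>factorizations N P.
           cmod (det (square_part H 0)) \<le> cmod (det (square_part G 0))"
proof -
  have P: "P z = gram G0 z" if "cmod z = 1" for z using G0 that by (auto simp: factorizations_def)
  have "compact ((\<lambda>z. \<Sum>i\<in>UNIV. gram G0 z i i) ` sphere 0 1)"
    unfolding gram_def by (intro compact_continuous_image continuous_intros) auto
  then have "bounded ((\<lambda>z. \<Sum>i\<in>UNIV. gram G0 z i i) ` sphere 0 1)" by (rule compact_imp_bounded)
  then obtain R0 where "\<forall>x\<in>(\<lambda>z. \<Sum>i\<in>UNIV. gram G0 z i i) ` sphere 0 1. cmod x \<le> R0"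
    unfolding bounded_iff by blast
  then have R0: "cmod (\<Sum>i\<in>UNIV. gram G0 z i i) \<le> R0" if "cmod z = 1" for z
    using that by auto
  define R where "R = sqrt R0"
  have bound: "cmod (coeff (G i j) k) \<le> R" if G: "G \<in> factorizations N P" for G i j k
  proof (rule coeff_bound_circle)
    fix z :: complex assume z: "cmod z = 1"
    have eq: "gram G z = gram G0 z" using G P[OF z] z by (auto simp: factorizations_def)
    have "(\<Sum>i\<in>UNIV. gram G z i i) = of_real (\<Sum>i\<in>UNIV. \<Sum>j\<in>UNIV. (cmod (poly (G i j) z))\<^sup>2)"
      by (simp only: gram_def of_real_sum complex_norm_square)
    then have "(\<Sum>i\<in>UNIV. \<Sum>j\<in>UNIV. (cmod (poly (G i j) z))\<^sup>2) \<le> R0"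
      using complex_Re_le_cmod[of "\<Sum>i\<in>UNIV. gram G z i i"] R0[OF z] unfolding eq by simp
    moreover have "(cmod (poly (G i j) z))\<^sup>2 \<le> (\<Sum>j\<in>UNIV. (cmod (poly (G i j) z))\<^sup>2)"
      by (rule member_le_sum) auto
    moreover have "\<dots> \<le> (\<Sum>i\<in>UNIV. \<Sum>j\<in>UNIV. (cmod (poly (G i j) z))\<^sup>2)"
      by (rule member_le_sum[where f = "\<lambda>i. \<Sum>j\<in>UNIV. (cmod (poly (G i j) z))\<^sup>2"]) (auto intro: sum_nonneg)
    ultimately have "(cmod (poly (G i j) z))\<^sup>2 \<le> R0" by linarith
    then show "cmod (poly (G i j) z) \<le> R" unfolding R_def by (rule real_le_rsqrt)
  qed
  define pol :: "('n \<times> 'n option \<times> nat \<Rightarrow> complex) \<Rightarrow> 'n \<Rightarrow> 'n option \<Rightarrow> complex poly"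
    where "pol a i j = (\<Sum>k\<le>N. monom (a (i, j, k)) k)" for a i j
  have poly_pol: "poly (pol a i j) z = (\<Sum>k\<le>N. a (i, j, k) * z ^ k)" for a i j z
    by (simp add: pol_def poly_sum poly_monom)
  have deg: "degree (pol a i j) \<le> N" for a i j
    unfolding pol_def by (intro degree_sum_le) (auto intro: order_trans[OF degree_monom_le])
  define B where "B = PiE UNIV (\<lambda>x :: 'n \<times> 'n option \<times> nat. if snd (snd x) \<le> N then cball (0::complex) R else {0})"
  define E where "E z i i' = {a. gram (pol a) z i i' = P z i i'}" for z i i'
  define C where "C = B \<inter> (\<Inter>z\<in>sphere 0 1. \<Inter>i. \<Inter>i'. E z i i')"
  have cB: "compact B"
  proof -
    have "compactin (product_topology (\<lambda>_. euclidean) UNIV) B"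
      unfolding B_def compactin_PiE by auto
    then show ?thesis by (simp add: euclidean_product_topology)
  qed
  have clE: "closed (E z i i')" for z i i'
    unfolding E_def gram_def poly_pol by (intro closed_Collect_eq continuous_intros continuous_on_product_coordinates)
  have cC: "compact C"
    unfolding C_def by (intro compact_Int_closed cB closed_INT ballI clE)
  have polC: "pol a \<in> factorizations N P" if "a \<in> C" for a
    using that deg by (auto simp: factorizations_def C_def E_def fun_eq_iff)
  define co where "co G = (\<lambda>(i :: 'n, j :: 'n option, k). coeff (G i j :: complex poly) k)" for G
  have pol_co: "pol (co G) = G" if "G \<in> factorizations N P" for G
  proof (intro ext poly_eqI)
    fix i j k
    have d: "degree (G i j) \<le> N" using that by (auto simp: factorizations_def)
    have "coeff (pol (co G) i j) k = (\<Sum>k'\<le>N. if k' = k then coeff (G i j) k' else 0)"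
      unfolding pol_def coeff_sum coeff_monom by (rule sum.cong) (auto simp: co_def)
    also have "\<dots> = coeff (G i j) k" using d by (auto simp: coeff_eq_0)
    finally show "coeff (pol (co G) i j) k = coeff (G i j) k" .
  qed
  have coC: "co G \<in> C" if G: "G \<in> factorizations N P" for G
  proof -
    have d: "degree (G i j) \<le> N" for i j using that by (auto simp: factorizations_def)
    have "co G \<in> B" unfolding B_def
      by (auto simp: co_def bound[OF G] not_le intro!: coeff_eq_0 le_less_trans[OF d])
    moreover have "co G \<in> E z i i'" if "z \<in> sphere 0 1" for z i i'
      using G that by (auto simp: E_def pol_co[OF G] factorizations_def)
    ultimately show ?thesis by (auto simp: C_def)
  qed
  have "C \<noteq> {}" using coC[OF G0] by auto
  \<comment> \<open>The objective is continuous for the product topology, as only finitely many coefficients enter.\<close>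
  moreover have "continuous_on C (\<lambda>a. cmod (det (square_part (pol a) 0)))"
    unfolding square_part_def
    by (intro continuous_on_norm continuous_on_det)
       (simp add: poly_pol, intro continuous_intros continuous_on_subset[OF continuous_on_product_coordinates], auto)
  ultimately obtain a where a: "a \<in> C"
    "\<And>b. b \<in> C \<Longrightarrow> cmod (det (square_part (pol b) 0)) \<le> cmod (det (square_part (pol a) 0))"
    using continuous_attains_sup[OF cC] by metis
  show ?thesis
    using polC[OF a(1)] a(2)[OF coC] pol_co by (metis)
qed

lemma sum_option:
  fixes f :: "'n::finite option \<Rightarrow> 'a::comm_monoid_add"
  shows "(\<Sum>j\<in>UNIV. f j) = f None + (\<Sum>j\<in>UNIV. f (Some j))"
proof -
  have "(\<Sum>j\<in>range Some. f j) = (\<Sum>j\<in>UNIV. f (Some j))"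
    by (simp add: sum.reindex)
  then show ?thesis by (simp add: UNIV_option_conv)
qed

lemma gram_split:
  "gram G z i i' = poly (G i None) z * cnj (poly (G i' None) z) +
     (\<Sum>j\<in>UNIV. poly (G i (Some j)) z * cnj (poly (G i' (Some j)) z))"
  unfolding gram_def by (rule sum_option)

text \<open>
  The power \<open>k\<close> is the common order of vanishing at \<open>0\<close>. Dividing by \<open>z\<^sup>k\<close> does not change
  products \<open>c\<^sub>i c\<^sub>j*\<close> on the unit circle.
\<close>

lemma divide_power_of_variable:
  fixes c :: "'i \<Rightarrow> complex poly"
  assumes "c i0 \<noteq> 0"
  obtains k c' where "\<And>i. c i = [:0, 1:] ^ k * c' i" and "\<exists>i. poly (c' i) 0 \<noteq> 0"
proof -
  define Q where "Q k \<longleftrightarrow> (\<exists>i. \<not> [:0, 1:] ^ Suc k dvd c i)" for k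
  have "Q (order 0 (c i0))"
    using order_2[OF assms, of 0] by (auto simp: Q_def)
  then have Qk: "Q (LEAST k. Q k)" by (rule LeastI)
  define k where "k = (LEAST k. Q k)"
  have "[:0, 1:] ^ k dvd c i" for i
  proof (cases k)
    case (Suc k')
    then have "\<not> Q k'" using not_less_Least[of k' Q] unfolding k_def by auto
    then show ?thesis unfolding Suc Q_def by blast
  qed auto
  then have "\<forall>i. \<exists>d. c i = [:0, 1:] ^ k * d" by (auto simp: dvd_def)
  then obtain c' where c': "\<And>i. c i = [:0, 1:] ^ k * c' i" by metis
  obtain i where i: "\<not> [:0, 1:] ^ Suc k dvd c i" using Qk by (auto simp: Q_def k_def)
  have "poly (c' i) 0 \<noteq> 0"
  proof
    assume "poly (c' i) 0 = 0"
    then have "[:0, 1:] dvd c' i" by (simp add: poly_eq_0_iff_dvd)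
    then have "[:0, 1:] ^ Suc k dvd c i" unfolding c'[of i] power_Suc
      by (metis dvd_refl mult.commute mult_dvd_mono)
    then show False using i by contradiction
  qed
  then show ?thesis using that c' by blast
qed

lemma det_replace_row_identity:
  fixes y :: "'a::field ^ 'n::finite"
  shows "det (\<chi> i. if i = k then y else axis i 1) = y $ k"
proof -
  have "(\<Sum>i\<in>UNIV. y $ i *s row i (mat 1 :: 'a ^ 'n ^ 'n)) = y"
    by (simp add: vec_eq_iff row_def mat_def if_distrib cong: if_cong)
  moreover have "row i (mat 1 :: 'a ^ 'n ^ 'n) = axis i 1" for i
    by (auto simp: vec_eq_iff row_def mat_def axis_def)
  ultimately show ?thesis
    using cramer_lemma_transpose[of k y "mat 1 :: 'a ^ 'n ^ 'n"] by (simp add: det_I cong: if_cong)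
qed

text \<open>
  The rows are changed one after the other. The determinant is affine in each row, and the
  coefficient of \<open>x\<^sub>k\<close> is a determinant with one row \<open>y\<close>; multiples of this row can be
  subtracted from the others, which leaves \<open>y\<^sub>k\<close>.
\<close>

lemma det_identity_plus_rank_one:
  fixes x y :: "'a::field ^ 'n::finite"
  shows "det (\<chi> i. axis i 1 + x $ i *s y) = 1 + (\<Sum>i\<in>UNIV. x $ i * y $ i)"
proof -
  define R where "R S i = axis i 1 + (if i \<in> S then x $ i else 0) *s y" for S and i :: 'n
  have repl: "det (\<chi> i. if i = k then y else R S i) = y $ k" if "k \<notin> S" for k S
  proof -
    have "finite S" by simp
    then show ?thesis using that
    proof (induction S)
      case empty
      show ?case using det_replace_row_identity[of k y] by (simp add: R_def cong: if_cong)
    next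
      case (insert l S)
      let ?A = "(\<chi> i. if i = k then y else R S i)"
      have kl: "k \<noteq> l" using insert by auto
      have "(\<chi> i. if i = k then y else R (insert l S) i) =
          (\<chi> i. if i = l then row l ?A + x $ l *s row k ?A else row i ?A)"
        using kl insert by (auto simp: vec_eq_iff row_def R_def)
      then have "det (\<chi> i. if i = k then y else R (insert l S) i) = det ?A"
        using det_row_operation[of l k ?A "x $ l"] kl by simp
      then show ?case using insert by simp
    qed
  qed
  have "det (\<chi> i. R S i) = 1 + (\<Sum>i\<in>S. x $ i * y $ i)" for S
  proof -
    have "finite S" by simp
    then show ?thesis
    proof (induction S)
      case empty
      have "(\<chi> i. R {} i) = mat 1" by (auto simp: vec_eq_iff R_def axis_def mat_def)
      then show ?case by (simp add: det_I)
    next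
      case (insert k S)
      have "(\<chi> i. R (insert k S) i) = (\<chi> i. if i = k then axis k 1 + x $ k *s y else R S i)"
        by (auto simp: vec_eq_iff R_def)
      also have "det \<dots> = det (\<chi> i. if i = k then axis k 1 else R S i)
          + x $ k * det (\<chi> i. if i = k then y else R S i)"
        using det_row_add[of k "\<lambda>_. axis k 1" "\<lambda>_. x $ k *s y" "R S"]
          det_row_mul[of k "x $ k" "\<lambda>_. y" "R S"] by simp
      also have "(\<chi> i. if i = k then axis k 1 else R S i) = (\<chi> i. R S i)"
        using insert by (auto simp: vec_eq_iff R_def)
      finally show ?case using insert repl[of k S] by simp
    qed
  qed
  from this[of UNIV] show ?thesis by (simp add: R_def)
qed

text \<open>
  After division by a power of \<open>z\<close> a nonzero last column does not vanish at \<open>0\<close>. There it is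
  \<open>F(0) x\<close> with some \<open>x\<^sub>m \<noteq> 0\<close>. A unitary rotation in the plane of this column and the \<open>m\<close>-th one
  preserves the Gram matrix, and the rotation angle can be chosen so that \<open>det F(0)\<close> gets
  multiplied by \<open>sqrt (1 + \<bar>x\<^sub>m\<bar>\<^sup>2) > 1\<close>.
\<close>

lemma maximal_factorization_last_column:
  fixes G :: "'n::finite \<Rightarrow> 'n option \<Rightarrow> complex poly"
  assumes G: "G \<in> factorizations N P" and nz: "det (square_part G 0) \<noteq> 0"
    and max: "\<And>H. H \<in> factorizations N P \<Longrightarrow> cmod (det (square_part H 0)) \<le> cmod (det (square_part G 0))"
  shows "G i None = 0"
proof (rule ccontr)
  assume "G i None \<noteq> 0"
  from divide_power_of_variable[of "\<lambda>i. G i None", OF this]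
  obtain k c' where c': "\<And>i. G i None = [:0, 1:] ^ k * c' i" and c0: "\<exists>i. poly (c' i) 0 \<noteq> 0"
    by metis
  have degG: "degree (G i j) \<le> N" for i j using G by (auto simp: factorizations_def)
  have degc: "degree (c' i) \<le> N" for i
  proof (cases "c' i = 0")
    case False
    then have "degree (G i None) = k + degree (c' i)"
      unfolding c' by (subst degree_mult_eq) (auto simp: degree_power_eq)
    then show ?thesis using degG[of i None] by simp
  qed auto
  define F where "F = square_part G 0"
  define v where "v = (\<chi> i. poly (c' i) 0)"
  have detF: "det F \<noteq> 0" using nz by (simp add: F_def)
  then obtain x where x: "F *v x = v" using cramer[of F _ v] by blast
  have "v \<noteq> 0" using c0 by (auto simp: v_def vec_eq_iff)
  then have "x \<noteq> 0" using x by auto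
  then obtain m where m: "x $ m \<noteq> 0" by (auto simp: vec_eq_iff)
  \<comment> \<open>The rotation with cosine \<open>\<alpha>\<close> and sine \<open>\<beta>\<close> multiplies the determinant by \<open>\<alpha> + \<beta> x\<^sub>m\<close>;
    this choice aligns \<open>(\<alpha>, \<beta>)\<close> with \<open>(1, cnj x\<^sub>m)\<close> and so maximizes the modulus.\<close>
  define r where "r = sqrt (1 + (cmod (x $ m))\<^sup>2)"
  have r1: "r > 1" using m by (simp add: r_def)
  have r2: "r\<^sup>2 = 1 + (cmod (x $ m))\<^sup>2" by (simp add: r_def)
  define \<alpha> :: complex where "\<alpha> = of_real (1 / r)"
  define \<beta> where "\<beta> = cnj (x $ m) / of_real r"
  have xx: "x $ m * cnj (x $ m) = of_real ((cmod (x $ m))\<^sup>2)" by (simp only: complex_norm_square)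
  have ab: "\<alpha> * \<alpha> + \<beta> * cnj \<beta> = 1"
  proof -
    have "\<alpha> * \<alpha> + \<beta> * cnj \<beta> = (1 + x $ m * cnj (x $ m)) / (of_real r * of_real r)"
      using r1 by (simp add: \<alpha>_def \<beta>_def field_simps)
    also have "1 + x $ m * cnj (x $ m) = of_real (r\<^sup>2)" unfolding xx r2 by simp
    finally show ?thesis using r1 by (simp add: power2_eq_square)
  qed
  have cnja: "cnj \<alpha> = \<alpha>" by (simp add: \<alpha>_def)
  define H where "H i j = (case j of None \<Rightarrow> smult (- cnj \<beta>) (G i (Some m)) + smult \<alpha> (c' i)
      | Some j \<Rightarrow> if j = m then smult \<alpha> (G i (Some m)) + smult \<beta> (c' i) else G i (Some j))" for i j
  have "degree (H i j) \<le> N" for i j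
    unfolding H_def by (auto split: option.split intro!: degree_add_le degree_diff_le order_trans[OF degree_smult_le] degG degc)
  moreover have "gram H z i i' = gram G z i i'" if z: "cmod z = 1" for z i i'
  proof -
    have zk: "z ^ k * cnj (z ^ k) = 1"
      using complex_norm_square[of "z ^ k"] z by (simp add: norm_power)
    let ?f = "poly (G i (Some m)) z" and ?f' = "poly (G i' (Some m)) z"
    let ?c = "poly (c' i) z" and ?c' = "poly (c' i') z"
    have N: "poly (G i None) z * cnj (poly (G i' None) z) = ?c * cnj ?c'"
    proof -
      have "poly (G i None) z * cnj (poly (G i' None) z) = (z ^ k * cnj (z ^ k)) * (?c * cnj ?c')"
        unfolding c' by (simp add: poly_power)
      then show ?thesis by (simp only: zk mult_1_left)
    qed
    have rest: "(\<Sum>j\<in>UNIV - {m}. poly (H i (Some j)) z * cnj (poly (H i' (Some j)) z)) =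
        (\<Sum>j\<in>UNIV - {m}. poly (G i (Some j)) z * cnj (poly (G i' (Some j)) z))"
      by (rule sum.cong) (auto simp: H_def)
    have "gram H z i i' = (- cnj \<beta> * ?f + \<alpha> * ?c) * cnj (- cnj \<beta> * ?f' + \<alpha> * ?c')
        + (\<alpha> * ?f + \<beta> * ?c) * cnj (\<alpha> * ?f' + \<beta> * ?c')
        + (\<Sum>j\<in>UNIV - {m}. poly (G i (Some j)) z * cnj (poly (G i' (Some j)) z))"
      unfolding gram_split by (subst sum.remove[of _ m]) (simp_all only: finite UNIV_I rest, simp add: H_def)
    also have "(- cnj \<beta> * ?f + \<alpha> * ?c) * cnj (- cnj \<beta> * ?f' + \<alpha> * ?c')
        + (\<alpha> * ?f + \<beta> * ?c) * cnj (\<alpha> * ?f' + \<beta> * ?c')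
        = (\<alpha> * \<alpha> + \<beta> * cnj \<beta>) * (?f * cnj ?f' + ?c * cnj ?c')"
      by (simp add: cnja algebra_simps)
    also have "\<dots> = ?f * cnj ?f' + ?c * cnj ?c'" by (simp only: ab mult_1_left)
    also have "\<dots> + (\<Sum>j\<in>UNIV - {m}. poly (G i (Some j)) z * cnj (poly (G i' (Some j)) z)) = gram G z i i'"
      unfolding gram_split N by (subst (2) sum.remove[of _ m]) auto
    finally show ?thesis .
  qed
  ultimately have HF: "H \<in> factorizations N P"
    using G by (auto simp: factorizations_def fun_eq_iff)
  have "square_part H 0 = (\<chi> i j. if j = m then (F *v (\<alpha> *s axis m 1 + \<beta> *s x)) $ i else F $ i $ j)"
  proof -
    have "F *v (\<alpha> *s axis m 1 + \<beta> *s x) = \<alpha> *s column m F + \<beta> *s v"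
      by (simp only: matrix_vector_right_distrib vector_scalar_commute x)
         (auto simp: vec_eq_iff column_def matrix_vector_mult_def axis_def if_distrib cong: if_cong)
    then show ?thesis
      by (auto simp: vec_eq_iff square_part_def H_def F_def v_def column_def)
  qed
  then have "det (square_part H 0) = (\<alpha> *s axis m 1 + \<beta> *s x) $ m * det F"
    by (simp only: cramer_lemma)
  also have "(\<alpha> *s axis m 1 + \<beta> *s x) $ m = of_real r"
  proof -
    have "(\<alpha> *s axis m 1 + \<beta> *s x) $ m = (1 + x $ m * cnj (x $ m)) / of_real r"
      using r1 by (simp add: \<alpha>_def \<beta>_def field_simps)
    also have "1 + x $ m * cnj (x $ m) = of_real (r\<^sup>2)" unfolding xx r2 by simp
    finally show ?thesis using r1 by (simp add: power2_eq_square)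
  qed
  finally have "cmod (det (square_part H 0)) = r * cmod (det F)" using r1 by (simp add: norm_mult)
  then have "cmod (det (square_part H 0)) > cmod (det F)" using r1 detF by simp
  then show False using max[OF HF] by (simp add: F_def)
qed

text \<open>
  If \<open>F(z\<^sub>0) u = 0\<close> for a unit vector \<open>u\<close>, the factor \<open>z - z\<^sub>0\<close> of \<open>F u\<close> can be replaced by \<open>1 - cnj z\<^sub>0 z\<close>, which
  has the same modulus on the circle. This divides \<open>F u\<close> by a Blaschke factor and leaves \<open>F\<close> unchanged on the orthogonal
  complement of \<open>u\<close>. The Gram matrix on the circle stays the same, while \<open>det F(0)\<close> is divided
  by \<open>- z\<^sub>0\<close>, and so grows in modulus.
\<close>

lemma maximal_factorization_det_nonzero:
  fixes G :: "'n::finite \<Rightarrow> 'n option \<Rightarrow> complex poly"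
  assumes G: "G \<in> factorizations N P" and nz: "det (square_part G 0) \<noteq> 0"
    and max: "\<And>H. H \<in> factorizations N P \<Longrightarrow> cmod (det (square_part H 0)) \<le> cmod (det (square_part G 0))"
    and z0: "cmod z0 < 1"
  shows "det (square_part G z0) \<noteq> 0"
proof
  assume d0: "det (square_part G z0) = 0"
  then have z0nz: "z0 \<noteq> 0" using nz by auto
  have degG: "degree (G i j) \<le> N" for i j using G by (auto simp: factorizations_def)
  have "\<not> invertible (square_part G z0)" using d0 by (simp add: invertible_det_nz)
  then obtain u0 where u0: "u0 \<noteq> 0" "square_part G z0 *v u0 = 0"
    by (auto simp: invertible_left_inverse matrix_left_invertible_ker)
  define u where "u = complex_of_real (1 / norm u0) *s u0"
  have uz: "square_part G z0 *v u = 0" by (simp add: u_def vec.scale u0)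
  have nu: "(\<Sum>j\<in>UNIV. u $ j * cnj (u $ j)) = 1"
  proof -
    have "(\<Sum>j\<in>UNIV. u $ j * cnj (u $ j)) = of_real (1 / (norm u0)\<^sup>2 * (\<Sum>j\<in>UNIV. (cmod (u0 $ j))\<^sup>2))"
      unfolding sum_distrib_left of_real_sum
      by (rule sum.cong) (simp_all add: u_def power2_eq_square complex_norm_square[simplified power2_eq_square] divide_simps flip: complex_norm_square)
    also have "(\<Sum>j\<in>UNIV. (cmod (u0 $ j))\<^sup>2) = (norm u0)\<^sup>2"
      by (simp add: norm_vec_def L2_set_def sum_nonneg)
    finally show ?thesis using u0 by simp
  qed
  define w where "w i = (\<Sum>j\<in>UNIV. smult (u $ j) (G i (Some j)))" for i
  have poly_w: "poly (w i) z = (\<Sum>j\<in>UNIV. u $ j * poly (G i (Some j)) z)" for i z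
    by (simp add: w_def poly_sum)
  have "poly (w i) z0 = 0" for i
  proof -
    have "poly (w i) z0 = (square_part G z0 *v u) $ i"
      by (simp add: poly_w square_part_def matrix_vector_mult_def mult.commute)
    then show ?thesis by (simp add: uz)
  qed
  then have "\<forall>i. \<exists>q. w i = [:- z0, 1:] * q" by (simp add: poly_eq_0_iff_dvd dvd_def)
  then obtain w' where w': "\<And>i. w i = [:- z0, 1:] * w' i" by metis
  have degw: "degree (w i) \<le> N" for i
    unfolding w_def by (intro degree_sum_le) (auto intro!: order_trans[OF degree_smult_le] degG)
  define b where "b i = [:1, - cnj z0:] * w' i" for i
  have degb: "degree (b i) \<le> N" for i
  proof (cases "w' i = 0")
    case False
    then have "degree (w i) = 1 + degree (w' i)"
      unfolding w' by (subst degree_mult_eq) auto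
    moreover have "degree (b i) \<le> 1 + degree (w' i)"
      unfolding b_def by (rule order_trans[OF degree_mult_le]) auto
    ultimately show ?thesis using degw[of i] by simp
  qed (auto simp: b_def)
  define H where "H i j = (case j of None \<Rightarrow> G i None
      | Some j \<Rightarrow> G i (Some j) + smult (cnj (u $ j)) (b i - w i))" for i j
  have "degree (H i j) \<le> N" for i j
    unfolding H_def by (auto split: option.split intro!: degree_add_le degree_diff_le order_trans[OF degree_smult_le] degG degb degw)
  moreover have "gram H z i i' = gram G z i i'" if z: "cmod z = 1" for z i i'
  proof -
    let ?b = "poly (b i) z" and ?w = "poly (w i) z" and ?b' = "poly (b i') z" and ?w' = "poly (w i') z"
    have zz: "z * cnj z = 1" using complex_norm_square[of z] z by simp
    have bb: "?b * cnj ?b' = ?w * cnj ?w'"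
    proof -
      have "(1 - cnj z0 * z) * cnj (1 - cnj z0 * z) = (z - z0) * cnj (z - z0)"
      proof -
        have "(1 - cnj z0 * z) * cnj (1 - cnj z0 * z) = 1 - z0 * cnj z - cnj z0 * z + z0 * cnj z0 * (z * cnj z)"
          by (simp add: algebra_simps)
        also have "\<dots> = z * cnj z - z0 * cnj z - cnj z0 * z + z0 * cnj z0" by (simp add: zz)
        also have "\<dots> = (z - z0) * cnj (z - z0)" by (simp add: algebra_simps)
        finally show ?thesis .
      qed
      moreover have "?b * cnj ?b' = ((1 - cnj z0 * z) * cnj (1 - cnj z0 * z)) * (poly (w' i) z * cnj (poly (w' i') z))"
        by (simp add: b_def algebra_simps)
      moreover have "?w * cnj ?w' = ((z - z0) * cnj (z - z0)) * (poly (w' i) z * cnj (poly (w' i') z))"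
        unfolding w' by (simp add: algebra_simps)
      ultimately show ?thesis by simp
    qed
    let ?a = "\<lambda>j. poly (G i (Some j)) z" and ?a' = "\<lambda>j. poly (G i' (Some j)) z"
    have "(\<Sum>j\<in>UNIV. poly (H i (Some j)) z * cnj (poly (H i' (Some j)) z)) =
       (\<Sum>j\<in>UNIV. ?a j * cnj (?a' j) + u $ j * ?a j * cnj (?b' - ?w') + cnj (u $ j * ?a' j) * (?b - ?w)
          + u $ j * cnj (u $ j) * ((?b - ?w) * cnj (?b' - ?w')))"
      by (rule sum.cong) (auto simp: H_def algebra_simps)
    also have "\<dots> = (\<Sum>j\<in>UNIV. ?a j * cnj (?a' j)) + ?w * cnj (?b' - ?w') + cnj ?w' * (?b - ?w)
        + (?b - ?w) * cnj (?b' - ?w')"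
      unfolding sum.distrib sum_distrib_right[symmetric] cnj_sum[symmetric] poly_w[symmetric] nu by simp
    also have "\<dots> = (\<Sum>j\<in>UNIV. ?a j * cnj (?a' j))"
      using bb by (simp add: algebra_simps)
    finally show ?thesis unfolding gram_split by (simp add: H_def)
  qed
  ultimately have HF: "H \<in> factorizations N P"
    using G by (auto simp: factorizations_def fun_eq_iff)
  define F where "F = square_part G 0"
  \<comment> \<open>At \<open>0\<close> the inverse Blaschke factor is \<open>- 1 / z\<^sub>0\<close>, so there the new square part is \<open>F (I + t u u*)\<close>.\<close>
  define t where "t = - 1 / z0 - 1"
  have b0: "poly (b i) 0 - poly (w i) 0 = t * poly (w i) 0" for i
    using z0nz by (simp add: b_def w' t_def field_simps)
  have w0: "poly (w i) 0 = (F *v u) $ i" for i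
    by (simp add: poly_w square_part_def F_def matrix_vector_mult_def mult.commute)
  have "square_part H 0 = F ** (\<chi> i. axis i 1 + (t *s u) $ i *s (\<chi> j. cnj (u $ j)))"
  proof -
    have "square_part H 0 $ i $ j = (F ** (\<chi> i. axis i 1 + (t *s u) $ i *s (\<chi> j. cnj (u $ j)))) $ i $ j" for i j
    proof -
      have "(F ** (\<chi> i. axis i 1 + (t *s u) $ i *s (\<chi> j. cnj (u $ j)))) $ i $ j =
          (\<Sum>k\<in>UNIV. F $ i $ k * (if k = j then 1 else 0)) + (\<Sum>k\<in>UNIV. F $ i $ k * u $ k) * (t * cnj (u $ j))"
        unfolding matrix_matrix_mult_def sum_distrib_right sum.distrib[symmetric]
        by (auto simp: axis_def algebra_simps intro!: sum.cong)
      also have "\<dots> = F $ i $ j + (F *v u) $ i * (t * cnj (u $ j))"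
        by (simp add: matrix_vector_mult_def if_distrib cong: if_cong)
      also have "\<dots> = F $ i $ j + cnj (u $ j) * (t * poly (w i) 0)"
        by (simp add: w0)
      also have "\<dots> = square_part H 0 $ i $ j"
        unfolding b0[symmetric] by (simp add: square_part_def F_def H_def)
      finally show ?thesis by simp
    qed
    then show ?thesis by (simp add: vec_eq_iff)
  qed
  then have "det (square_part H 0) = det F * (1 + (\<Sum>i\<in>UNIV. (t *s u) $ i * (\<chi> j. cnj (u $ j)) $ i))"
    by (simp only: det_mul det_identity_plus_rank_one)
  also have "(\<Sum>i\<in>UNIV. (t *s u) $ i * (\<chi> j. cnj (u $ j)) $ i) = t"
    using nu by (simp add: sum_distrib_left[symmetric] mult.assoc)
  finally have "cmod (det (square_part H 0)) = cmod (det F) / cmod z0"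
    by (simp add: t_def norm_mult norm_divide)
  moreover have "cmod (det F) / cmod z0 > cmod (det F)"
    using z0 z0nz nz by (simp add: F_def field_simps)
  ultimately show False using max[OF HF] by (simp add: F_def)
qed

definition ctrans :: "complex ^ 'n ^ 'm \<Rightarrow> complex ^ 'm ^ 'n" where
  "ctrans A = (\<chi> i j. cnj (A $ j $ i))"

definition poly_matrix :: "('n::finite \<Rightarrow> 'n \<Rightarrow> complex poly) \<Rightarrow> complex \<Rightarrow> complex ^ 'n ^ 'n" where
  "poly_matrix F z = (\<chi> i j. poly (F i j) z)"

lemma ctrans_mult_vec: "(ctrans A *v y) $ j = (\<Sum>i\<in>UNIV. cnj (A $ i $ j) * y $ i)"
  by (simp add: ctrans_def matrix_vector_mult_def)

lemma norm_vec_squared: "(norm y)\<^sup>2 = (\<Sum>i\<in>UNIV. (cmod (y $ i))\<^sup>2)"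
  for y :: "complex ^ 'n::finite"
  by (simp add: norm_vec_def L2_set_def sum_nonneg)

text \<open>
  Kernel vectors of \<open>A*\<close> are the complex conjugates of those of the transpose.
\<close>

lemma det_eq_0_iff_ctrans_kernel:
  fixes A :: "complex ^ 'n::finite ^ 'n"
  shows "det A = 0 \<longleftrightarrow> (\<exists>y. y \<noteq> 0 \<and> ctrans A *v y = 0)"
proof -
  have "det A = 0 \<longleftrightarrow> \<not> invertible (transpose A)"
    by (simp add: invertible_det_nz)
  also have "\<dots> \<longleftrightarrow> (\<exists>x. x \<noteq> 0 \<and> transpose A *v x = 0)"
    by (auto simp: invertible_left_inverse matrix_left_invertible_ker)
  also have "\<dots> \<longleftrightarrow> (\<exists>y. y \<noteq> 0 \<and> ctrans A *v y = 0)"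
  proof -
    define cn where "cn x = (\<chi> i. cnj (x $ i))" for x :: "complex ^ 'n"
    have cn: "cn (cn x) = x" "cn x = 0 \<longleftrightarrow> x = 0" for x by (auto simp: cn_def vec_eq_iff)
    have tr: "ctrans A *v cn x = cn (transpose A *v x)" for x
      by (simp add: vec_eq_iff ctrans_def cn_def matrix_vector_mult_def transpose_def)
    show ?thesis
    proof
      assume "\<exists>x. x \<noteq> 0 \<and> transpose A *v x = 0"
      then obtain x where "x \<noteq> 0" "transpose A *v x = 0" by blast
      then show "\<exists>y. y \<noteq> 0 \<and> ctrans A *v y = 0" by (intro exI[of _ "cn x"]) (simp only: tr cn, simp)
    next
      assume "\<exists>y. y \<noteq> 0 \<and> ctrans A *v y = 0"
      then obtain y where y: "y \<noteq> 0" "ctrans A *v y = 0" by blast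
      then have "transpose A *v cn y = 0" using tr[of "cn y"] cn by simp
      then show "\<exists>x. x \<noteq> 0 \<and> transpose A *v x = 0" using y(1) cn by blast
    qed
  qed
  finally show ?thesis .
qed

text \<open>
  Equality of Gram matrices implies equality of the hermitian forms
  \<open>y \<mapsto> \<bar>F* y\<bar>\<^sup>2 + \<bar>c* y\<bar>\<^sup>2\<close>, the form in which factorizations are used from here on.
\<close>

lemma sum_squares_eq_gram:
  fixes G :: "'n::finite \<Rightarrow> 'n option \<Rightarrow> complex poly"
  shows "of_real (\<Sum>j\<in>UNIV. (cmod (\<Sum>i\<in>UNIV. cnj (poly (G i j) z) * y $ i))\<^sup>2) =
     (\<Sum>i\<in>UNIV. \<Sum>i'\<in>UNIV. gram G z i' i * (y $ i * cnj (y $ i')))"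
proof -
  have "of_real (\<Sum>j\<in>UNIV. (cmod (\<Sum>i\<in>UNIV. cnj (poly (G i j) z) * y $ i))\<^sup>2) =
      (\<Sum>j\<in>UNIV. \<Sum>i\<in>UNIV. \<Sum>i'\<in>UNIV. (poly (G i' j) z * cnj (poly (G i j) z)) * (y $ i * cnj (y $ i')))"
    unfolding of_real_sum complex_norm_square cnj_sum sum_product by (simp add: ac_simps)
  also have "\<dots> = (\<Sum>i\<in>UNIV. \<Sum>i'\<in>UNIV. \<Sum>j\<in>UNIV. (poly (G i' j) z * cnj (poly (G i j) z)) * (y $ i * cnj (y $ i')))"
    by (subst sum.swap, rule sum.cong[OF refl], rule sum.swap)
  also have "\<dots> = (\<Sum>i\<in>UNIV. \<Sum>i'\<in>UNIV. gram G z i' i * (y $ i * cnj (y $ i')))"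
    by (simp only: gram_def sum_distrib_right)
  finally show ?thesis .
qed

text \<open>
  Among all factorizations of \<open>F\<^sub>0 F\<^sub>0* + c c*\<close> of bounded degree one with maximal \<open>\<bar>det F(0)\<bar>\<close> has
  vanishing last column and no zeros of \<open>det F\<close> in the open disc, by the two lemmas on maximal
  factorizations. On the circle \<open>det F\<close> has no zeros because \<open>F F* \<ge> F\<^sub>0 F\<^sub>0*\<close> is positive definite.
\<close>

lemma rank_one_factorization:
  fixes F0 :: "'n::finite \<Rightarrow> 'n \<Rightarrow> complex poly" and c :: "'n \<Rightarrow> complex poly"
  assumes F0: "\<And>z. cmod z \<le> 1 \<Longrightarrow> det (poly_matrix F0 z) \<noteq> 0"
  shows "\<exists>F. (\<forall>z. cmod z \<le> 1 \<longrightarrow> det (poly_matrix F z) \<noteq> 0) \<and>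
    (\<forall>z y. cmod z = 1 \<longrightarrow> (norm (ctrans (poly_matrix F z) *v y))\<^sup>2 =
       (norm (ctrans (poly_matrix F0 z) *v y))\<^sup>2 + (cmod (\<Sum>i\<in>UNIV. cnj (poly (c i) z) * y $ i))\<^sup>2)"
proof -
  define G0 where "G0 i j = (case j of None \<Rightarrow> c i | Some j \<Rightarrow> F0 i j)" for i j
  define N where "N = (\<Sum>i\<in>UNIV. \<Sum>j\<in>UNIV. degree (G0 i j))"
  have "degree (G0 i j) \<le> N" for i j
  proof -
    have "degree (G0 i j) \<le> (\<Sum>j\<in>UNIV. degree (G0 i j))" by (rule member_le_sum) auto
    also have "\<dots> \<le> N" unfolding N_def by (rule member_le_sum[where f = "\<lambda>i. \<Sum>j\<in>UNIV. degree (G0 i j)"]) auto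
    finally show ?thesis .
  qed
  then have G0: "G0 \<in> factorizations N (gram G0)" by (auto simp: factorizations_def)
  from factorizations_attain_max[OF this] obtain G where G: "G \<in> factorizations N (gram G0)"
    and max: "\<And>H. H \<in> factorizations N (gram G0) \<Longrightarrow> cmod (det (square_part H 0)) \<le> cmod (det (square_part G 0))"
    by (elim bexE) (simp only: Ball_def)
  have "square_part G0 0 = poly_matrix F0 0" by (simp add: square_part_def poly_matrix_def G0_def)
  then have nz: "det (square_part G 0) \<noteq> 0" using max[OF G0] F0[of 0] by auto
  note col = maximal_factorization_last_column[OF G nz max]
  define F where "F i j = G i (Some j)" for i j
  have sq: "square_part G z = poly_matrix F z" for z by (simp add: square_part_def poly_matrix_def F_def)
  have form: "(norm (ctrans (poly_matrix F z) *v y))\<^sup>2 =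
       (norm (ctrans (poly_matrix F0 z) *v y))\<^sup>2 + (cmod (\<Sum>i\<in>UNIV. cnj (poly (c i) z) * y $ i))\<^sup>2"
    if z: "cmod z = 1" for z y
  proof -
    have "gram G z = gram G0 z" using G z by (auto simp: factorizations_def)
    then have "(\<Sum>j\<in>UNIV. (cmod (\<Sum>i\<in>UNIV. cnj (poly (G i j) z) * y $ i))\<^sup>2) =
        (\<Sum>j\<in>UNIV. (cmod (\<Sum>i\<in>UNIV. cnj (poly (G0 i j) z) * y $ i))\<^sup>2)"
      by (intro of_real_eq_iff[where 'a = complex, THEN iffD1]) (simp only: sum_squares_eq_gram)
    then show ?thesis
      unfolding sum_option by (simp add: col norm_vec_squared ctrans_mult_vec poly_matrix_def F_def G0_def)
  qed
  have "det (poly_matrix F z) \<noteq> 0" if "cmod z \<le> 1" for z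
  proof (cases "cmod z < 1")
    case True
    then show ?thesis using maximal_factorization_det_nonzero[OF G nz max True] by (simp add: sq)
  next
    case False
    then have z: "cmod z = 1" using that by simp
    show ?thesis
    proof
      assume "det (poly_matrix F z) = 0"
      then obtain y where y: "y \<noteq> 0" "ctrans (poly_matrix F z) *v y = 0"
        by (auto simp: det_eq_0_iff_ctrans_kernel)
      then have "(norm (ctrans (poly_matrix F0 z) *v y))\<^sup>2 + (cmod (\<Sum>i\<in>UNIV. cnj (poly (c i) z) * y $ i))\<^sup>2 = 0"
        using form[OF z, of y] by simp
      then have "ctrans (poly_matrix F0 z) *v y = 0" by (simp add: add_nonneg_eq_0_iff)
      then have "det (poly_matrix F0 z) = 0" using y(1) by (auto simp: det_eq_0_iff_ctrans_kernel)
      then show False using F0[OF that] by simp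
    qed
  qed
  then show ?thesis using form by blast
qed

lemma finite_rank_factorization:
  fixes c :: "'j \<Rightarrow> 'n::finite \<Rightarrow> complex poly"
  assumes "finite J" and \<delta>: "\<delta> > 0"
  shows "\<exists>F. (\<forall>z. cmod z \<le> 1 \<longrightarrow> det (poly_matrix F z) \<noteq> 0) \<and>
    (\<forall>z y. cmod z = 1 \<longrightarrow> (norm (ctrans (poly_matrix F z) *v y))\<^sup>2 =
       \<delta>\<^sup>2 * (norm y)\<^sup>2 + (\<Sum>j\<in>J. (cmod (\<Sum>i\<in>UNIV. cnj (poly (c j i) z) * y $ i))\<^sup>2))"
  using assms(1)
proof induction
  case empty
  define F :: "'n \<Rightarrow> 'n \<Rightarrow> complex poly" where "F i j = (if i = j then [:of_real \<delta>:] else 0)" for i j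
  have F: "poly_matrix F z $ i $ j = (if i = j then of_real \<delta> else 0)" for z i j
    by (simp add: poly_matrix_def F_def)
  have "det (poly_matrix F z) \<noteq> 0" for z
    using \<delta> by (subst det_diagonal) (auto simp: F)
  moreover have "(norm (ctrans (poly_matrix F z) *v y))\<^sup>2 = \<delta>\<^sup>2 * (norm y)\<^sup>2" for z y
    by (simp add: norm_vec_squared ctrans_mult_vec F if_distrib if_distribR norm_mult power_mult_distrib sum_distrib_left cong: if_cong)
  ultimately show ?case by auto
next
  case (insert j J)
  then obtain F0 where F0: "\<And>z. cmod z \<le> 1 \<Longrightarrow> det (poly_matrix F0 z) \<noteq> 0"
    "\<And>z y. cmod z = 1 \<Longrightarrow> (norm (ctrans (poly_matrix F0 z) *v y))\<^sup>2 =
       \<delta>\<^sup>2 * (norm y)\<^sup>2 + (\<Sum>j\<in>J. (cmod (\<Sum>i\<in>UNIV. cnj (poly (c j i) z) * y $ i))\<^sup>2)"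
    by blast
  have "\<exists>F. (\<forall>z. cmod z \<le> 1 \<longrightarrow> det (poly_matrix F z) \<noteq> 0) \<and>
    (\<forall>z y. cmod z = 1 \<longrightarrow> (norm (ctrans (poly_matrix F z) *v y))\<^sup>2 =
       (norm (ctrans (poly_matrix F0 z) *v y))\<^sup>2 + (cmod (\<Sum>i\<in>UNIV. cnj (poly (c j i) z) * y $ i))\<^sup>2)"
    by (rule rank_one_factorization) (rule F0(1))
  then obtain F where F:
    "\<And>z. cmod z \<le> 1 \<Longrightarrow> det (poly_matrix F z) \<noteq> 0"
    "\<And>z y. cmod z = 1 \<Longrightarrow> (norm (ctrans (poly_matrix F z) *v y))\<^sup>2 =
       (norm (ctrans (poly_matrix F0 z) *v y))\<^sup>2 + (cmod (\<Sum>i\<in>UNIV. cnj (poly (c j i) z) * y $ i))\<^sup>2"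
    by blast
  show ?case
  proof (intro exI conjI allI impI)
    fix z assume "cmod z \<le> 1"
    then show "det (poly_matrix F z) \<noteq> 0" by (rule F(1))
  next
    fix z y assume z: "cmod z = 1"
    show "(norm (ctrans (poly_matrix F z) *v y))\<^sup>2 = \<delta>\<^sup>2 * (norm y)\<^sup>2
        + (\<Sum>j\<in>insert j J. (cmod (\<Sum>i\<in>UNIV. cnj (poly (c j i) z) * y $ i))\<^sup>2)"
      unfolding F(2)[OF z] F0(2)[OF z] sum.insert[OF insert.hyps(1,2)] by (simp only: ac_simps)
  qed
qed

text \<open>
  The columns of the matrices \<open>q\<^sub>i T\<^sub>i\<close> are merged one by one into \<open>\<delta> I\<close>.
\<close>

lemma weighted_factorization:
  fixes T :: "'i \<Rightarrow> complex ^ 'n::finite ^ 'n" and q :: "'i \<Rightarrow> complex poly"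
  assumes "finite I" and "\<delta> > 0"
  obtains F where "\<And>z. cmod z \<le> 1 \<Longrightarrow> det (poly_matrix F z) \<noteq> 0"
    and "\<And>z y. cmod z = 1 \<Longrightarrow> (norm (ctrans (poly_matrix F z) *v y))\<^sup>2 =
       \<delta>\<^sup>2 * (norm y)\<^sup>2 + (\<Sum>i\<in>I. (cmod (poly (q i) z))\<^sup>2 * (norm (ctrans (T i) *v y))\<^sup>2)"
proof -
  define c where "c = (\<lambda>(i, j) k. smult (T i $ k $ j) (q i))"
  have c: "(\<Sum>k\<in>UNIV. cnj (poly (c (i, j) k) z) * y $ k) = cnj (poly (q i) z) * (ctrans (T i) *v y) $ j" for i j z y
    by (simp add: c_def ctrans_mult_vec sum_distrib_left ac_simps)
  have eq: "(\<Sum>p\<in>I \<times> UNIV. (cmod (\<Sum>k\<in>UNIV. cnj (poly (c p k) z) * y $ k))\<^sup>2) =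
      (\<Sum>i\<in>I. (cmod (poly (q i) z))\<^sup>2 * (norm (ctrans (T i) *v y))\<^sup>2)" for z y
  proof -
    have "(\<Sum>p\<in>I \<times> UNIV. (cmod (\<Sum>k\<in>UNIV. cnj (poly (c p k) z) * y $ k))\<^sup>2) =
      (\<Sum>i\<in>I. \<Sum>j\<in>UNIV. (cmod (\<Sum>k\<in>UNIV. cnj (poly (c (i, j) k) z) * y $ k))\<^sup>2)"
      by (simp add: sum.cartesian_product split_def)
    then show ?thesis
      by (simp add: c norm_vec_squared norm_mult power_mult_distrib sum_distrib_left)
  qed
  have "finite (I \<times> (UNIV :: 'n set))" using assms by simp
  from finite_rank_factorization[OF this assms(2), of c] obtain F where
    F: "\<forall>z. cmod z \<le> 1 \<longrightarrow> det (poly_matrix F z) \<noteq> 0"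
    "\<forall>z y. cmod z = 1 \<longrightarrow> (norm (ctrans (poly_matrix F z) *v y))\<^sup>2 =
       \<delta>\<^sup>2 * (norm y)\<^sup>2 + (\<Sum>p\<in>I \<times> UNIV. (cmod (\<Sum>k\<in>UNIV. cnj (poly (c p k) z) * y $ k))\<^sup>2)"
    by (elim exE conjE)
  show ?thesis by (rule that[of F]) (use F[unfolded eq] in blast)+
qed

section \<open>Volumes of complex linear images\<close>

text \<open>
  Uniqueness of Haar measure. Both sides arise from
  \<open>\<integral>\<integral> 1\<^sub>A(x) 1\<^sub>B(x + y) dy dM(x)\<close>: integrating over \<open>y\<close> first gives the left side; integrating over \<open>x\<close>
  first and translating by \<open>y\<close> gives the right side, because Lebesgue measure is also invariant under reflection.
\<close>

lemma translation_invariant_measure_unique: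
  fixes M :: "'a::euclidean_space measure"
  assumes sets[measurable_cong]: "sets M = sets borel" and "sigma_finite_measure M"
    and inv: "\<And>c. distr M borel ((+) c) = M"
    and A[measurable]: "A \<in> sets borel" and B[measurable]: "B \<in> sets borel"
  shows "emeasure M A * emeasure lborel B = emeasure M B * emeasure lborel A"
proof -
  interpret M: sigma_finite_measure M by fact
  interpret pair_sigma_finite M "lborel :: 'a measure" ..
  have shift: "(\<integral>\<^sup>+y. indicator B (x + y) \<partial>lborel) = emeasure lborel B" for x :: 'a
  proof -
    have "(\<integral>\<^sup>+y. indicator B y \<partial>lborel) = (\<integral>\<^sup>+y. indicator B y \<partial>distr lborel borel ((+) x))"
      by (simp add: lborel_distr_plus)
    also have "\<dots> = (\<integral>\<^sup>+y. indicator B (x + y) \<partial>lborel)"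
      by (subst nn_integral_distr) auto
    finally show ?thesis by simp
  qed
  have reflect: "(\<integral>\<^sup>+y. indicator A (x - y) \<partial>lborel) = emeasure lborel A" for x :: 'a
  proof -
    have "lborel = distr lborel borel (\<lambda>y. x + (- 1) *\<^sub>R y)"
      by (subst lborel_affine[of "- 1" x]) (auto simp: density_1)
    then have "(\<integral>\<^sup>+y. indicator A y \<partial>lborel) = (\<integral>\<^sup>+y. indicator A y \<partial>distr lborel borel (\<lambda>y. x + (- 1) *\<^sub>R y))"
      by simp
    also have "\<dots> = (\<integral>\<^sup>+y. indicator A (x - y) \<partial>lborel)"
      by (subst nn_integral_distr) auto
    finally show ?thesis by simp
  qed
  have "emeasure M A * emeasure lborel B = (\<integral>\<^sup>+x. \<integral>\<^sup>+y. indicator A x * indicator B (x + y) \<partial>lborel \<partial>M)"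
    by (simp add: nn_integral_cmult shift nn_integral_multc)
  also have "\<dots> = (\<integral>\<^sup>+y. \<integral>\<^sup>+x. indicator A x * indicator B (x + y) \<partial>M \<partial>lborel)"
    by (rule Fubini'[symmetric]) measurable
  also have "\<dots> = (\<integral>\<^sup>+y. \<integral>\<^sup>+x. indicator A (x - y) * indicator B x \<partial>M \<partial>lborel)"
  proof (rule nn_integral_cong)
    fix y :: 'a
    have "(\<integral>\<^sup>+x. indicator A x * indicator B (x + y) \<partial>M)
        = (\<integral>\<^sup>+x. indicator A x * indicator B (x + y) \<partial>distr M borel ((+) (- y)))"
      by (simp add: inv)
    also have "\<dots> = (\<integral>\<^sup>+x. indicator A (- y + x) * indicator B (- y + x + y) \<partial>M)"
      by (subst nn_integral_distr) (auto simp: sets)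
    finally show "(\<integral>\<^sup>+x. indicator A x * indicator B (x + y) \<partial>M) = (\<integral>\<^sup>+x. indicator A (x - y) * indicator B x \<partial>M)"
      by simp
  qed
  also have "\<dots> = (\<integral>\<^sup>+x. \<integral>\<^sup>+y. indicator A (x - y) * indicator B x \<partial>lborel \<partial>M)"
    by (rule Fubini') measurable
  also have "\<dots> = emeasure M B * emeasure lborel A"
    by (simp add: nn_integral_cmult reflect nn_integral_multc mult.commute)
  finally show ?thesis .
qed

lemma linear_complex_matrix: "linear (\<lambda>x. A *v x)" for A :: "complex ^ 'n::finite ^ 'm::finite"
  by (rule linearI)
     (simp_all add: matrix_vector_mult_def vec_eq_iff scaleR_sum_right sum.distrib algebra_simps)

lemma bij_complex_matrix:
  fixes A :: "complex ^ 'n::finite ^ 'n"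
  assumes "det A \<noteq> 0"
  shows "bij ((*v) A)"
proof -
  obtain B where "A ** B = mat 1" "B ** A = mat 1"
    using assms by (auto simp: invertible_det_nz[symmetric] invertible_def)
  then have "B *v (A *v x) = x" "A *v (B *v x) = x" for x
    by (simp_all add: matrix_vector_mul_assoc)
  then show ?thesis by (intro o_bij[of "(*v) B"]) (auto simp: fun_eq_iff)
qed

text \<open>
  The measure \<open>S \<mapsto> Vol (f S)\<close> is translation invariant, hence proportional to Lebesgue
  measure.
\<close>

lemma emeasure_linear_image_cross:
  fixes f :: "'a::euclidean_space \<Rightarrow> 'a"
  assumes f: "linear f" "bij f" and S: "S \<in> sets borel" and B: "B \<in> sets borel"
  shows "emeasure lborel (f ` S) * emeasure lborel B = emeasure lborel (f ` B) * emeasure lborel S"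
proof -
  define g where "g = inv f"
  have gf: "g (f x) = x" "f (g x) = x" for x
    using f(2) by (simp_all add: g_def bij_is_inj bij_is_surj surj_f_inv_f)
  have lg: "linear g"
  proof (rule linearI)
    show "g (x + y) = g x + g y" for x y
      using gf(1)[of "g x + g y"] by (simp add: linear_add[OF f(1)] gf(2))
    show "g (r *\<^sub>R x) = r *\<^sub>R g x" for r x
      using gf(1)[of "r *\<^sub>R g x"] by (simp add: linear_scale[OF f(1)] gf(2))
  qed
  have [measurable]: "g \<in> borel_measurable borel"
    using lg by (intro borel_measurable_continuous_onI linear_continuous_on linear_conv_bounded_linear[THEN iffD1])
  define M where "M = distr lborel borel g"
  have vim: "g -` X = f ` X" for X
  proof
    show "g -` X \<subseteq> f ` X" by (metis gf(2) image_iff subsetI vimageD)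
  qed (auto simp: gf)
  have M: "emeasure M X = emeasure lborel (f ` X)" if "X \<in> sets borel" for X
    unfolding M_def using that by (subst emeasure_distr) (auto simp: vim)
  have sf: "sigma_finite_measure M"
  proof
    show "\<exists>A. countable A \<and> A \<subseteq> sets M \<and> \<Union> A = space M \<and> (\<forall>a\<in>A. emeasure M a \<noteq> \<infinity>)"
    proof (intro exI[of _ "range (\<lambda>n::nat. cball 0 (real n))"] conjI ballI)
      show "\<Union> (range (\<lambda>n::nat. cball (0::'a) (real n))) = space M"
        by (auto simp: M_def) (meson real_arch_simple)
    next
      fix X assume "X \<in> range (\<lambda>n::nat. cball (0::'a) (real n))"
      then have X: "compact X" by auto
      then have "compact (f ` X)"
        using f by (intro compact_continuous_image linear_continuous_on linear_conv_bounded_linear[THEN iffD1])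
      then have "emeasure lborel (f ` X) < \<infinity>" by (intro emeasure_bounded_finite compact_imp_bounded)
      then show "emeasure M X \<noteq> \<infinity>"
        using M[of X] X by (auto simp: borel_compact)
    qed (auto simp: M_def)
  qed
  have inv: "distr M borel ((+) c) = M" for c
  proof -
    have "distr M borel ((+) c) = distr lborel borel (\<lambda>x. c + g x)"
      unfolding M_def by (subst distr_distr) (auto simp: comp_def)
    also have "(\<lambda>x. c + g x) = g \<circ> ((+) (f c))"
      by (auto simp: linear_add[OF lg] gf)
    also have "distr lborel borel (g \<circ> ((+) (f c))) = distr (distr lborel borel ((+) (f c))) borel g"
      by (subst distr_distr) auto
    finally show ?thesis by (simp add: lborel_distr_plus M_def)
  qed
  have "sets M = sets borel" by (simp add: M_def)
  from translation_invariant_measure_unique[OF this sf inv S B] show ?thesis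
    using S B by (simp add: M)
qed

definition volume_factor :: "complex ^ 'n::finite ^ 'n \<Rightarrow> real" where
  "volume_factor A = measure lborel ((*v) A ` cball 0 1) / measure lborel (cball (0 :: complex ^ 'n) 1)"

lemma measure_unit_ball_pos:
  "measure lborel (ball (0 :: 'a::euclidean_space) 1) > 0" "measure lborel (cball (0 :: 'a) 1) > 0"
  by (simp_all add: content_ball_pos content_cball_pos)

lemma compact_matrix_image_cball: "compact ((*v) A ` cball 0 1)" for A :: "complex ^ 'n::finite ^ 'm::finite"
  by (intro compact_continuous_image linear_continuous_on linear_conv_bounded_linear[THEN iffD1]
      linear_complex_matrix) auto

lemma borel_matrix_image_cball: "(*v) A ` cball 0 1 \<in> sets borel" for A :: "complex ^ 'n::finite ^ 'm::finite"
  by (rule borel_compact[OF compact_matrix_image_cball])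

lemma emeasure_matrix_image:
  fixes A :: "complex ^ 'n::finite ^ 'n"
  assumes A: "det A \<noteq> 0" and S: "S \<in> sets borel"
  shows "emeasure lborel ((*v) A ` S) = ennreal (volume_factor A) * emeasure lborel S"
proof -
  let ?B = "cball (0 :: complex ^ 'n) 1"
  have cross: "emeasure lborel ((*v) A ` S) * emeasure lborel ?B = emeasure lborel ((*v) A ` ?B) * emeasure lborel S"
    by (rule emeasure_linear_image_cross[OF linear_complex_matrix bij_complex_matrix[OF A] S]) auto
  have eB: "emeasure lborel ?B = ennreal (measure lborel ?B)"
    by (rule emeasure_eq_ennreal_measure) (use emeasure_bounded_finite[of ?B] in auto)
  have "bounded ((*v) A ` ?B)"
    by (intro bounded_linear_image linear_conv_bounded_linear[THEN iffD1] linear_complex_matrix) auto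
  then have "emeasure lborel ((*v) A ` ?B) = ennreal (measure lborel ((*v) A ` ?B))"
    by (intro emeasure_eq_ennreal_measure) (metis emeasure_bounded_finite less_irrefl infinity_ennreal_def)
  also have "\<dots> = ennreal (volume_factor A) * ennreal (measure lborel ?B)"
    using measure_unit_ball_pos(2)[where 'a = "complex ^ 'n"]
    by (simp add: volume_factor_def ennreal_mult[symmetric])
  finally have "ennreal (measure lborel ?B) * emeasure lborel ((*v) A ` S)
      = ennreal (measure lborel ?B) * (ennreal (volume_factor A) * emeasure lborel S)"
    using cross eB by (simp add: ac_simps)
  then show ?thesis
    using measure_unit_ball_pos(2)[where 'a = "complex ^ 'n"]
    by (subst (asm) ennreal_mult_cancel_left) auto
qed

lemma sum_delta_mult:
  fixes f :: "'n::finite \<Rightarrow> 'a::semiring_0"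
  shows "(\<Sum>j\<in>UNIV. (if i = j then c else 0) * f j) = c * f i"
proof -
  have "(\<Sum>j\<in>UNIV. (if i = j then c else 0) * f j) = (\<Sum>j\<in>UNIV. if i = j then c * f j else 0)"
    by (rule sum.cong) auto
  then show ?thesis by simp
qed

text \<open>
  This makes \<open>volume_factor\<close> a homomorphism from the general linear group to the positive reals.
  Together with its values on scalars, that determines it.
\<close>

lemma volume_factor_mult:
  assumes A: "det A \<noteq> 0"
  shows "volume_factor (A ** B) = volume_factor A * volume_factor B"
proof -
  let ?B = "cball (0 :: complex ^ 'n) 1"
  from emeasure_matrix_image[OF A borel_matrix_image_cball[of B]]
  have "emeasure lborel ((*v) (A ** B) ` ?B) = ennreal (volume_factor A) * emeasure lborel ((*v) B ` ?B)"
    by (simp add: image_image matrix_vector_mul_assoc)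
  moreover have "volume_factor A \<ge> 0" by (simp add: volume_factor_def)
  ultimately have "measure lborel ((*v) (A ** B) ` ?B) = volume_factor A * measure lborel ((*v) B ` ?B)"
    by (simp add: measure_def enn2real_mult)
  then show ?thesis by (simp add: volume_factor_def)
qed

lemma volume_factor_one: "volume_factor (mat 1 :: complex ^ 'n::finite ^ 'n) = 1"
  using measure_unit_ball_pos(2)[where 'a = "complex ^ 'n"] by (simp add: volume_factor_def)

lemma volume_factor_pos:
  fixes A :: "complex ^ 'n::finite ^ 'n"
  assumes A: "det A \<noteq> 0"
  shows "volume_factor A > 0"
proof -
  obtain B where "A ** B = mat 1"
    using assms by (auto simp: invertible_det_nz[symmetric] invertible_def)
  then have "volume_factor A * volume_factor B = 1"
    using volume_factor_mult[OF A, of B] volume_factor_one[where 'n = 'n] by simp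
  moreover have "volume_factor A \<ge> 0" by (simp add: volume_factor_def)
  ultimately show ?thesis by (cases "volume_factor A = 0") auto
qed

text \<open>
  The identity matrix with its \<open>k\<close>-th column replaced by \<open>x\<close>. Shears (\<open>x\<^sub>k = 1\<close>) and dilations of
  one coordinate (\<open>x\<close> a multiple of the \<open>k\<close>-th unit vector) are both of this kind.
\<close>

definition column_matrix :: "'n::finite \<Rightarrow> 'a::field ^ 'n \<Rightarrow> 'a ^ 'n ^ 'n" where
  "column_matrix k x = (\<chi> i j. if j = k then x $ i else if i = j then 1 else 0)"

definition swap_matrix :: "'n::finite \<Rightarrow> 'n \<Rightarrow> 'a::field ^ 'n ^ 'n" where
  "swap_matrix k l = (\<chi> i j. if Transposition.transpose k l i = j then 1 else 0)"

lemma column_matrix_mult_vec: "column_matrix k x *v v = v + v $ k *s (x - axis k 1)"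
proof -
  have "(column_matrix k x *v v) $ i = (v + v $ k *s (x - axis k 1)) $ i" for i
  proof -
    have "(column_matrix k x *v v) $ i = (\<Sum>j\<in>UNIV. (if j = k then (x $ i - axis k 1 $ i) * v $ j else 0) + (if j = i then v $ j else 0))"
      unfolding column_matrix_def matrix_vector_mult_def
      by (auto intro!: sum.cong simp: axis_def algebra_simps)
    also have "\<dots> = (v + v $ k *s (x - axis k 1)) $ i"
      unfolding sum.distrib by (simp add: algebra_simps)
    finally show ?thesis .
  qed
  then show ?thesis by (simp add: vec_eq_iff)
qed

lemma swap_matrix_mult_vec: "(swap_matrix k l *v v) $ i = v $ Transposition.transpose k l i"
  by (simp add: swap_matrix_def matrix_vector_mult_def sum_delta_mult)

lemma det_column_matrix: "det (column_matrix k x) = x $ k"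
proof -
  have "column_matrix k x = (\<chi> i j. if j = k then (mat 1 *v x) $ i else (mat 1 :: 'a ^ 'b ^ 'b) $ i $ j)"
    by (simp only: matrix_vector_mul_lid) (simp add: column_matrix_def mat_def vec_eq_iff)
  then show ?thesis by (simp only: cramer_lemma det_I mult_1_right)
qed

lemma swap_matrix_square: "swap_matrix k l ** swap_matrix k l = mat 1"
  by (simp add: matrix_eq vec_eq_iff swap_matrix_mult_vec flip: matrix_vector_mul_assoc)

lemma column_matrix_mult:
  "column_matrix k x ** column_matrix k y = column_matrix k (y + y $ k *s (x - axis k 1))"
  by (simp add: matrix_eq vec_eq_iff column_matrix_mult_vec algebra_simps flip: matrix_vector_mul_assoc)

lemma column_matrix_axis: "column_matrix k (axis k 1) = mat 1"
  by (simp add: matrix_eq column_matrix_mult_vec)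

lemma det_swap_matrix: "det (swap_matrix k l :: complex ^ 'n::finite ^ 'n) \<noteq> 0" "cmod (det (swap_matrix k l :: complex ^ 'n ^ 'n)) = 1"
proof -
  have "det (swap_matrix k l :: complex ^ 'n ^ 'n) * det (swap_matrix k l :: complex ^ 'n ^ 'n) = 1"
    unfolding det_mul[symmetric] swap_matrix_square by (simp add: det_I)
  then show "det (swap_matrix k l :: complex ^ 'n::finite ^ 'n) \<noteq> 0" "cmod (det (swap_matrix k l :: complex ^ 'n ^ 'n)) = 1"
    by (auto simp: square_eq_1_iff)
qed

text \<open>
  Gaussian elimination. Columns outside \<open>K\<close> are unit vectors already. To treat column \<open>k\<close>, a row
  swap within \<open>insert k K\<close> brings a nonzero entry to the diagonal, and a column matrix then turns the
  column into a unit vector.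
\<close>

lemma invertible_matrix_induct:
  fixes A :: "'a::field ^ 'n::finite ^ 'n"
  assumes one: "P (mat 1)" and mult: "\<And>A B. P A \<Longrightarrow> P B \<Longrightarrow> P (A ** B)"
    and swap: "\<And>k l. P (swap_matrix k l)" and col: "\<And>k x. x $ k \<noteq> 0 \<Longrightarrow> P (column_matrix k x)"
    and A: "det A \<noteq> 0"
  shows "P A"
proof -
  have "P A" if "det A \<noteq> 0" "\<And>j. j \<notin> K \<Longrightarrow> column j A = axis j 1" for A :: "'a ^ 'n ^ 'n" and K
  proof -
    have "finite K" by simp
    then show ?thesis using that
    proof (induction K arbitrary: A)
      case empty
      then have "A = mat 1" by (auto simp: vec_eq_iff column_def axis_def mat_def)
      then show ?case using one by simp
    next
      case (insert k K)
      have "\<exists>l\<in>insert k K. A $ l $ k \<noteq> 0"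
      proof (rule ccontr)
        assume "\<not> (\<exists>l\<in>insert k K. A $ l $ k \<noteq> 0)"
        then have z: "\<And>l. l \<in> insert k K \<Longrightarrow> A $ l $ k = 0" by blast
        \<comment> \<open>If all possible pivots vanish, column \<open>k\<close> is a combination of columns that are unit vectors.\<close>
        define u where "u = axis k 1 - column k A"
        have colA: "A $ i $ j = (if i = j then 1 else 0)" if "j \<notin> insert k K" for i j
          using insert.prems(2)[OF that] by (auto simp: vec_eq_iff column_def axis_def)
        have "(A *v column k A) $ i = A $ i $ k" for i
        proof -
          have "(A *v column k A) $ i = (\<Sum>j\<in>UNIV. if i = j then A $ j $ k else 0)"
            unfolding matrix_vector_mult_def column_def vec_lambda_beta
          proof (rule sum.cong)
            fix j
            show "A $ i $ j * A $ j $ k = (if i = j then A $ j $ k else 0)"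
            proof (cases "j \<in> insert k K")
              case True
              then show ?thesis using z[OF True] by simp
            next
              case False
              then show ?thesis using colA[OF False, of i] by simp
            qed
          qed simp
          then show ?thesis by simp
        qed
        then have "A *v u = 0"
          by (simp add: vec_eq_iff u_def matrix_vector_mult_diff_distrib) (simp add: matrix_vector_mult_def axis_def if_distrib cong: if_cong)
        moreover have "u $ k = 1" using z[of k] by (simp add: u_def column_def)
        then have "u \<noteq> 0" by auto
        ultimately have "\<not> invertible A" by (auto simp: invertible_left_inverse matrix_left_invertible_ker)
        then show False using insert.prems(1) by (simp add: invertible_det_nz)
      qed
      then obtain l where l: "l \<in> insert k K" "A $ l $ k \<noteq> 0" by blast
      define Q :: "'a ^ 'n ^ 'n" where "Q = swap_matrix k l"
      have QQ: "Q ** Q = mat 1" by (simp add: Q_def swap_matrix_square)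
      define x where "x = Q *v column k A"
      have xk: "x $ k \<noteq> 0" using l by (simp add: x_def Q_def swap_matrix_mult_vec column_def)
      define x' where "x' = axis k 1 - (1 / x $ k) *s (x - axis k 1)"
      have inv: "column_matrix k x' ** column_matrix k x = mat 1"
      proof -
        have "x + x $ k *s (x' - axis k 1) = axis k 1"
          using xk by (simp add: x'_def vec_eq_iff)
        then show ?thesis by (simp add: column_matrix_mult column_matrix_axis)
      qed
      then have inv': "column_matrix k x ** column_matrix k x' = mat 1"
        by (simp add: matrix_left_right_inverse)
      define B where "B = column_matrix k x' ** (Q ** A)"
      have colmul: "column j (C ** D) = C *v column j D" for C D :: "'a ^ 'n ^ 'n" and j
        by (simp add: vec_eq_iff column_def matrix_matrix_mult_def matrix_vector_mult_def)
      have detc: "det (column_matrix k x') \<noteq> 0" "det Q \<noteq> 0"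
        using arg_cong[OF inv, of det] arg_cong[OF QQ, of det] by (auto simp: det_mul det_I)
      have "P B"
      proof (rule insert.IH)
        show "det B \<noteq> 0" using detc insert.prems(1) by (simp add: B_def det_mul)
      next
        fix j assume j: "j \<notin> K"
        show "column j B = axis j 1"
        proof (cases "j = k")
          case True
          have "column k B = column_matrix k x' *v x" by (simp add: B_def colmul x_def)
          also have "\<dots> = axis k 1" using xk by (simp add: column_matrix_mult_vec x'_def vec_eq_iff)
          finally show ?thesis using True by simp
        next
          case False
          with j insert.prems(2) have c: "column j A = axis j 1" by auto
          have "j \<noteq> l" using j False l by auto
          then have "Q *v axis j 1 = axis j 1"
            using False by (auto simp: vec_eq_iff Q_def swap_matrix_mult_vec axis_def Transposition.transpose_def)
          then have "column j B = column_matrix k x' *v axis j 1" by (simp add: B_def colmul c)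
          also have "\<dots> = axis j 1" using False by (simp add: column_matrix_mult_vec axis_def)
          finally show ?thesis .
        qed
      qed
      then have "P (Q ** (column_matrix k x ** B))"
        using swap col[OF xk] mult by (auto simp: Q_def)
      also have "Q ** (column_matrix k x ** B) = Q ** ((column_matrix k x ** column_matrix k x') ** (Q ** A))"
        by (simp add: B_def matrix_mul_assoc)
      also have "\<dots> = (Q ** Q) ** A" unfolding inv' by (simp add: matrix_mul_assoc)
      also have "\<dots> = A" by (simp add: QQ)
      finally show ?case .
    qed
  qed
  from this[of A UNIV] A show ?thesis by simp
qed

text \<open>
  A shear is conjugate to its square, and a homomorphism into an abelian group does not see
  conjugation; so its value \<open>m\<close> on the shear satisfies \<open>m = m\<^sup>2\<close>.
\<close>

lemma volume_factor_shear:
  fixes x :: "complex ^ 'n::finite"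
  assumes x: "x $ k = 1"
  shows "volume_factor (column_matrix k x) = 1"
proof -
  \<comment> \<open>Conjugation with the halving of one coordinate doubles the shear, that is, it squares it.\<close>
  define D :: "complex ^ 'n ^ 'n" where "D = column_matrix k ((1 / 2) *s axis k 1)"
  have D: "det D \<noteq> 0" by (simp add: D_def det_column_matrix)
  have M: "det (column_matrix k x) \<noteq> 0" by (simp add: det_column_matrix x)
  have eq: "D ** column_matrix k x = (column_matrix k x ** column_matrix k x) ** D"
  proof -
    have "x + x $ k *s ((1 / 2) *s axis k 1 - axis k 1) = (1 / 2) *s axis k 1 +
        ((1 / 2) *s axis k (1::complex)) $ k *s ((x + x $ k *s (x - axis k 1)) - axis k 1)"
      by (simp add: vec_eq_iff x)
    then show ?thesis by (simp only: D_def column_matrix_mult)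
  qed
  have "volume_factor D * volume_factor (column_matrix k x) = volume_factor (D ** column_matrix k x)"
    by (rule volume_factor_mult[OF D, symmetric])
  also have "\<dots> = volume_factor (column_matrix k x ** column_matrix k x) * volume_factor D"
    unfolding eq by (rule volume_factor_mult) (simp add: det_mul M)
  also have "volume_factor (column_matrix k x ** column_matrix k x) =
      volume_factor (column_matrix k x) * volume_factor (column_matrix k x)"
    by (rule volume_factor_mult[OF M])
  finally have "volume_factor D * volume_factor (column_matrix k x) =
      (volume_factor (column_matrix k x) * volume_factor (column_matrix k x)) * volume_factor D" .
  then show ?thesis using volume_factor_pos[OF D] volume_factor_pos[OF M] by simp
qed

lemma volume_factor_swap: "volume_factor (swap_matrix k l :: complex ^ 'n::finite ^ 'n) = 1"
proof -
  have "volume_factor (swap_matrix k l :: complex ^ 'n ^ 'n) * volume_factor (swap_matrix k l :: complex ^ 'n ^ 'n) = 1"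
    using volume_factor_mult[OF det_swap_matrix(1), of k l "swap_matrix k l :: complex ^ 'n ^ 'n"]
    by (simp add: swap_matrix_square volume_factor_one)
  then show ?thesis
    using volume_factor_pos[OF det_swap_matrix(1), of k l] by (auto simp: square_eq_1_iff)
qed

lemma scalar_matrix_mult_vec: "mat c *v x = c *s x" for x :: "'a::semiring_1 ^ 'n::finite"
  by (simp add: vec_eq_iff mat_def matrix_vector_mult_def sum_delta_mult)

lemma real_scalar_matrix_mult_vec: "mat (complex_of_real r) *v x = r *\<^sub>R x" for x :: "complex ^ 'n::finite"
  by (simp add: scalar_matrix_mult_vec vec_eq_iff scaleR_conv_of_real[where 'a = complex])

lemma volume_factor_scalar:
  assumes "c \<noteq> 0"
  shows "volume_factor (mat c :: complex ^ 'n::finite ^ 'n) = cmod c ^ (2 * CARD('n))"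
proof -
  have nc: "norm (a *s x) = cmod a * norm x" for x :: "complex ^ 'n" and a
    by (simp add: norm_vec_def L2_set_def norm_mult power_mult_distrib real_sqrt_mult flip: sum_distrib_left)
  have "(*v) (mat c) ` cball (0 :: complex ^ 'n) 1 = cball 0 (cmod c)"
  proof (intro equalityI subsetI)
    fix y :: "complex ^ 'n" assume y: "y \<in> cball 0 (cmod c)"
    have "y = mat c *v ((1 / c) *s y)" using assms by (simp add: scalar_matrix_mult_vec)
    moreover have "(1 / c) *s y \<in> cball 0 1" using y assms by (simp add: nc norm_divide)
    ultimately show "y \<in> (*v) (mat c) ` cball 0 1" by blast
  qed (use assms in \<open>auto simp: scalar_matrix_mult_vec nc mult_left_le\<close>)
  moreover have "unit_ball_vol (real CARD('n) * 2) \<noteq> 0"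
    by (rule less_imp_neq[OF unit_ball_vol_pos, symmetric]) simp
  ultimately show ?thesis
    by (simp add: volume_factor_def content_cball mult.commute)
qed

text \<open>
  Dilations of different coordinates are conjugate by swaps, hence have the same volume factor. The
  product of all of them is a scalar matrix.
\<close>

lemma volume_factor_dilate_coordinate:
  fixes c :: complex and k :: "'n::finite"
  assumes c: "c \<noteq> 0"
  shows "volume_factor (column_matrix k (c *s axis k 1)) = (cmod c)\<^sup>2"
proof -
  define d where "d k = column_matrix k (c *s axis k 1)" for k :: 'n
  have detd: "det (d l) \<noteq> 0" for l using c by (simp add: d_def det_column_matrix)
  have same: "volume_factor (d l) = volume_factor (d k)" for l
  proof -
    let ?Q = "swap_matrix k l :: complex ^ 'n ^ 'n"
    have "?Q ** d k = d l ** ?Q"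
      by (auto simp: matrix_eq vec_eq_iff column_matrix_mult_vec swap_matrix_mult_vec d_def axis_def Transposition.transpose_def
          simp flip: matrix_vector_mul_assoc)
    then show ?thesis
      using volume_factor_mult[OF det_swap_matrix(1), of k l "d k"] volume_factor_mult[OF detd, of l ?Q]
      by (simp add: volume_factor_swap)
  qed
  define D where "D S = ((\<chi> i j. if i = j then (if i \<in> S then c else 1) else 0) :: complex ^ 'n ^ 'n)" for S
  have vD: "volume_factor (D S) = volume_factor (d k) ^ card S" for S
  proof -
    have "finite S" by simp
    then show ?thesis
    proof induction
      case empty
      have "D {} = mat 1" by (simp add: D_def mat_def vec_eq_iff)
      then show ?case by (simp add: volume_factor_one)
    next
      case (insert l S)
      have DV: "(D S *v v) $ i = (if i \<in> S then c else 1) * v $ i" for S v i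
        by (simp add: D_def matrix_vector_mult_def sum_delta_mult)
      have "D (insert l S) = d l ** D S"
        unfolding matrix_eq matrix_vector_mul_assoc[symmetric] d_def column_matrix_mult_vec vec_eq_iff
      proof (intro allI)
        fix v i
        show "(D (insert l S) *v v) $ i = (D S *v v + (D S *v v) $ l *s (c *s axis l 1 - axis l 1)) $ i"
          using insert.hyps by (cases "i = l") (simp_all add: DV axis_def algebra_simps)
      qed
      then have "volume_factor (D (insert l S)) = volume_factor (d k) * volume_factor (d k) ^ card S"
        using volume_factor_mult[OF detd, of l "D S"] insert.IH same[of l] by (simp only:)
      then show ?case using insert.hyps by simp
    qed
  qed
  have Dc: "D UNIV = mat c" by (simp add: D_def mat_def vec_eq_iff)
  have "volume_factor (d k) ^ CARD('n) = volume_factor (D UNIV)" by (rule vD[symmetric])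
  also have "\<dots> = cmod c ^ (2 * CARD('n))" unfolding Dc by (rule volume_factor_scalar[OF c])
  also have "\<dots> = ((cmod c)\<^sup>2) ^ CARD('n)" by (rule power_mult)
  finally have pw: "volume_factor (d k) ^ CARD('n) = ((cmod c)\<^sup>2) ^ CARD('n)" .
  have "volume_factor (d k) = (cmod c)\<^sup>2"
    by (rule power_eq_imp_eq_base[OF pw]) (use volume_factor_pos[OF detd, of k] in simp_all)
  then show ?thesis by (simp only: d_def)
qed

theorem volume_factor_eq_det:
  fixes A :: "complex ^ 'n::finite ^ 'n"
  assumes "det A \<noteq> 0"
  shows "volume_factor A = (cmod (det A))\<^sup>2"
proof -
  have "det A \<noteq> 0 \<and> volume_factor A = (cmod (det A))\<^sup>2"
  proof (rule invertible_matrix_induct[of _ A])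
    fix k and x :: "complex ^ 'n" assume x: "x $ k \<noteq> 0"
    let ?y = "(1 / x $ k) *s x"
    have y: "?y $ k = 1" using x by simp
    have "x $ k *s axis k 1 + (x $ k *s axis k 1) $ k *s (?y - axis k 1) = x"
      using x by (simp add: vec_eq_iff)
    then have eq: "column_matrix k x = column_matrix k ?y ** column_matrix k (x $ k *s axis k 1)"
      by (simp only: column_matrix_mult)
    have "det (column_matrix k ?y) \<noteq> 0" unfolding det_column_matrix y by simp
    then have "volume_factor (column_matrix k x) = volume_factor (column_matrix k ?y) * volume_factor (column_matrix k (x $ k *s axis k 1))"
      by (subst eq) (rule volume_factor_mult)
    then have "volume_factor (column_matrix k x) = (cmod (x $ k))\<^sup>2"
      unfolding volume_factor_shear[OF y] volume_factor_dilate_coordinate[OF x] by simp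
    then show "det (column_matrix k x) \<noteq> 0 \<and> volume_factor (column_matrix k x) = (cmod (det (column_matrix k x)))\<^sup>2"
      using x by (simp add: det_column_matrix)
  next
    show "det (mat 1 :: complex ^ 'n ^ 'n) \<noteq> 0 \<and> volume_factor (mat 1 :: complex ^ 'n ^ 'n) = (cmod (det (mat 1 :: complex ^ 'n ^ 'n)))\<^sup>2"
      by (simp add: det_I volume_factor_one)
  next
    fix A B :: "complex ^ 'n ^ 'n"
    assume "det A \<noteq> 0 \<and> volume_factor A = (cmod (det A))\<^sup>2" "det B \<noteq> 0 \<and> volume_factor B = (cmod (det B))\<^sup>2"
    then show "det (A ** B) \<noteq> 0 \<and> volume_factor (A ** B) = (cmod (det (A ** B)))\<^sup>2"
      by (simp add: det_mul volume_factor_mult norm_mult power_mult_distrib)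
  next
    fix k l :: 'n
    show "det (swap_matrix k l :: complex ^ 'n ^ 'n) \<noteq> 0 \<and>
      volume_factor (swap_matrix k l :: complex ^ 'n ^ 'n) = (cmod (det (swap_matrix k l :: complex ^ 'n ^ 'n)))\<^sup>2"
      by (simp add: det_swap_matrix volume_factor_swap)
  qed fact
  then show ?thesis by simp
qed

section \<open>Ellipsoids and conjugate transposes\<close>

lemma ctrans_mult: "ctrans (A ** B) = ctrans B ** ctrans A"
  by (simp add: ctrans_def matrix_matrix_mult_def vec_eq_iff mult.commute)

text \<open>
  The conjugate transpose is the adjoint for the real inner product as well, because that is the
  real part of the hermitian one.
\<close>

lemma inner_ctrans:
  fixes A :: "complex ^ 'n::finite ^ 'm::finite"
  shows "inner (A *v x) y = inner x (ctrans A *v y)"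
proof -
  have inner: "inner u v = Re (\<Sum>i\<in>UNIV. u $ i * cnj (v $ i))" for u v :: "complex ^ 'k::finite"
    by (simp add: inner_vec_def inner_complex_def)
  have "(\<Sum>i\<in>UNIV. (A *v x) $ i * cnj (y $ i)) = (\<Sum>i\<in>UNIV. \<Sum>j\<in>UNIV. A $ i $ j * x $ j * cnj (y $ i))"
    by (simp add: matrix_vector_mult_def sum_distrib_right)
  also have "\<dots> = (\<Sum>j\<in>UNIV. \<Sum>i\<in>UNIV. A $ i $ j * x $ j * cnj (y $ i))" by (rule sum.swap)
  also have "\<dots> = (\<Sum>j\<in>UNIV. x $ j * cnj ((ctrans A *v y) $ j))"
    by (simp add: ctrans_mult_vec sum_distrib_left ac_simps)
  finally show ?thesis by (simp only: inner)
qed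

text \<open>
  The hypothesis says \<open>F F* \<le> T T*\<close>. Then \<open>C = T\<^sup>-\<^sup>1 F\<close> has a contraction as adjoint, so \<open>C\<close> is a
  contraction, and \<open>F = T C\<close>.
\<close>

lemma ball_image_mono:
  fixes F T :: "complex ^ 'n::finite ^ 'n"
  assumes le: "\<And>y. norm (ctrans F *v y) \<le> norm (ctrans T *v y)" and T: "det T \<noteq> 0"
  shows "(*v) F ` cball 0 1 \<subseteq> (*v) T ` cball 0 1"
proof -
  obtain B where TB: "T ** B = mat 1" and BT: "B ** T = mat 1"
    using T by (auto simp: invertible_det_nz[symmetric] invertible_def)
  define C where "C = B ** F"
  have F: "F *v x = T *v (C *v x)" for x
    by (simp add: C_def matrix_vector_mul_assoc matrix_mul_assoc TB)
  have ct1: "ctrans (mat 1 :: complex ^ 'n ^ 'n) = mat 1"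
    by (simp add: ctrans_def mat_def vec_eq_iff)
  have C: "norm (C *v x) \<le> norm x" for x
  proof -
    have "norm (ctrans C *v w) \<le> norm w" for w
    proof -
      have "norm (ctrans C *v w) = norm (ctrans F *v (ctrans B *v w))"
        by (simp add: C_def ctrans_mult matrix_vector_mul_assoc)
      also have "\<dots> \<le> norm (ctrans T *v (ctrans B *v w))" by (rule le)
      also have "ctrans T *v (ctrans B *v w) = w"
        by (simp add: matrix_vector_mul_assoc ctrans_mult[symmetric] BT ct1)
      finally show ?thesis .
    qed
    then have "(norm (C *v x))\<^sup>2 \<le> norm x * norm (C *v x)"
      using inner_ctrans[of C x "C *v x"] norm_cauchy_schwarz[of x "ctrans C *v (C *v x)"]
      by (metis (no_types) mult_left_mono norm_ge_zero order_trans power2_norm_eq_inner)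
    then show ?thesis by (cases "norm (C *v x) = 0") (auto simp: power2_eq_square)
  qed
  show ?thesis
  proof
    fix y assume "y \<in> (*v) F ` cball 0 1"
    then obtain x where x: "y = F *v x" "norm x \<le> 1" by auto
    then show "y \<in> (*v) T ` cball 0 1" using C[of x] F[of x] by (intro image_eqI[of _ _ "C *v x"]) auto
  qed
qed

lemma emeasure_ellipsoid:
  fixes A :: "complex ^ 'n::finite ^ 'n"
  assumes "det A \<noteq> 0"
  shows "emeasure lborel ((*v) A ` ball 0 1) = ennreal ((cmod (det A))\<^sup>2 * measure lborel (ball (0 :: complex ^ 'n) 1))"
proof -
  have "emeasure lborel (ball (0 :: complex ^ 'n) 1) = ennreal (measure lborel (ball (0 :: complex ^ 'n) 1))"
    by (rule emeasure_eq_ennreal_measure) (use emeasure_bounded_finite[of "ball (0 :: complex ^ 'n) 1"] in auto)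
  then show ?thesis
    using emeasure_matrix_image[OF assms, of "ball 0 1"] volume_factor_eq_det[OF assms]
    by (simp add: ennreal_mult)
qed

text \<open>
  The inequality \<open>T T* \<le> F F*\<close> of hermitian matrices gives an inclusion of ellipsoids, hence an
  inequality of volumes.
\<close>

lemma det_mono:
  fixes F T :: "complex ^ 'n::finite ^ 'n"
  assumes le: "\<And>y. norm (ctrans T *v y) \<le> norm (ctrans F *v y)" and T: "det T \<noteq> 0" and F: "det F \<noteq> 0"
  shows "cmod (det T) \<le> cmod (det F)"
proof -
  have le_vol: "emeasure lborel ((*v) T ` cball 0 1) \<le> emeasure lborel ((*v) F ` cball 0 1)"
    by (rule emeasure_mono[OF ball_image_mono[OF le F]]) (simp add: borel_matrix_image_cball)
  have "measure lborel ((*v) T ` cball 0 1) \<le> measure lborel ((*v) F ` cball 0 1)"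
    using le_vol emeasure_bounded_finite[OF compact_imp_bounded[OF compact_matrix_image_cball[of F]]]
    unfolding measure_def by (intro enn2real_mono) simp_all
  then have "volume_factor T \<le> volume_factor F" by (simp add: volume_factor_def divide_right_mono)
  then show ?thesis by (simp add: volume_factor_eq_det T F power2_le_iff_abs_le)
qed

text \<open>
  On a slightly larger disc \<open>g = exp h\<close> for a holomorphic \<open>h\<close>, and \<open>ln \<bar>g\<bar> = Re h\<close> has the mean value property.
\<close>

lemma log_modulus_mean_value:
  fixes g :: "complex \<Rightarrow> complex"
  assumes hol: "g holomorphic_on UNIV" and nz: "\<And>z. cmod z \<le> 1 \<Longrightarrow> g z \<noteq> 0"
  shows "((\<lambda>t. ln (cmod (g (cis t)))) has_integral 2 * pi * ln (cmod (g 0))) {0..2 * pi}"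
proof -
  have "continuous_on UNIV g" using hol by (rule holomorphic_on_imp_continuous_on)
  then have "open (g -` (- {0}))" by (intro open_vimage) auto
  moreover have "cball 0 1 \<subseteq> g -` (- {0})" using nz by auto
  ultimately obtain e where e: "e > 0" "(\<Union>x\<in>cball 0 1. ball x e) \<subseteq> g -` (- {0})"
    using compact_subset_open_imp_ball_epsilon_subset[OF compact_cball] by metis
  have nz': "g z \<noteq> 0" if z: "z \<in> ball 0 (1 + e)" for z
  proof (cases "cmod z \<le> 1")
    case False
    define y where "y = z /\<^sub>R cmod z"
    have z0: "cmod z > 0" using False by linarith
    then have "y \<in> cball 0 1" by (simp add: y_def)
    moreover have "dist y z < e"
    proof -
      have yz: "y - z = (1 / cmod z - 1) *\<^sub>R z" by (simp add: y_def algebra_simps inverse_eq_divide)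
      have "dist y z = cmod z - 1" unfolding dist_norm yz norm_scaleR using False z0
        by (simp add: abs_if field_simps)
      then show ?thesis using z by simp
    qed
    ultimately show ?thesis using e(2) by fastforce
  qed (use nz in auto)
  obtain h where h: "h holomorphic_on ball 0 (1 + e)" "\<And>z. z \<in> ball 0 (1 + e) \<Longrightarrow> exp (h z) = g z"
    by (rule holomorphic_logarithm_exists[of "ball 0 (1 + e)" g 0])
       (use e(1) nz' holomorphic_on_subset[OF hol] in auto)
  have Reh: "Re (h z) = ln (cmod (g z))" if "cmod z \<le> 1" for z
    using h(2)[of z] that e(1) by (metis add.commute add_strict_increasing ln_exp mem_ball_0 norm_exp_eq_Re)
  have "h holomorphic_on cball 0 1" using h(1) e(1) by (rule_tac holomorphic_on_subset) auto
  then have "((\<lambda>u. h u / (u - 0)) has_contour_integral (2 * of_real pi * \<i> * h 0)) (circlepath 0 1)"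
    by (rule Cauchy_integral_circlepath_simple) simp
  then have "((\<lambda>t. h (0 + of_real 1 * cis t) / (0 + of_real 1 * cis t - 0) * of_real 1 * \<i> * cis t) has_integral 2 * of_real pi * \<i> * h 0) {0..2 * pi}"
    unfolding circlepath_def by (subst (asm) has_contour_integral_part_circlepath_iff) auto
  then have "((\<lambda>t. h (cis t) * \<i>) has_integral 2 * of_real pi * \<i> * h 0) {0..2 * pi}"
    by (rule has_integral_eq[rotated]) (auto simp: field_simps)
  then have "(Im \<circ> (\<lambda>t. h (cis t) * \<i>) has_integral Im (2 * of_real pi * \<i> * h 0)) {0..2 * pi}"
    by (rule has_integral_linear) (rule bounded_linear_Im)
  then have "((\<lambda>t. Re (h (cis t))) has_integral 2 * pi * Re (h 0)) {0..2 * pi}"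
    by (simp add: comp_def)
  then show ?thesis by (simp add: Reh)
qed

section \<open>Polynomials with prescribed modulus on the circle\<close>

text \<open>
  On the circle \<open>z cnj z = 1\<close>, so the highest common power of \<open>z\<close> and \<open>cnj z\<close> cancels in each
  monomial; what remains is a power of \<open>z\<close> or of its conjugate, which does not matter for the
  real part. This makes the real parts of polynomials an algebra of functions on the circle.
\<close>

lemma Re_poly_mult_cnj_on_circle:
  "\<exists>r. \<forall>z. cmod z = 1 \<longrightarrow> Re (poly p z * cnj (poly q z)) = Re (poly r z)"
proof (induction p q rule: poly_induct2)
  case 0
  show ?case by (rule exI[of _ 0]) auto
next
  case (pCons a p b q)
  then obtain r where r: "\<And>z. cmod z = 1 \<Longrightarrow> Re (poly p z * cnj (poly q z)) = Re (poly r z)" by blast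
  show ?case
  proof (intro exI allI impI)
    fix z :: complex assume z: "cmod z = 1"
    have zz: "z * cnj z = 1" using complex_norm_square[of z] z by simp
    have "poly (pCons a p) z * cnj (poly (pCons b q) z) = a * cnj (poly (pCons b q) z) + cnj b * z * poly p z
        + z * cnj z * (poly p z * cnj (poly q z))"
      by (simp add: algebra_simps)
    then have "Re (poly (pCons a p) z * cnj (poly (pCons b q) z)) =
        Re (a * cnj (poly (pCons b q) z)) + Re (cnj b * z * poly p z) + Re (poly r z)"
      by (simp only: zz mult_1_left r[OF z] plus_complex.simps)
    also have "a * cnj (poly (pCons b q) z) = cnj (cnj a * poly (pCons b q) z)"
      by (simp only: complex_cnj_mult complex_cnj_cnj)
    also have "Re \<dots> = Re (cnj a * poly (pCons b q) z)" by (simp only: cnj.simps)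
    finally show "Re (poly (pCons a p) z * cnj (poly (pCons b q) z)) =
        Re (poly (smult (cnj a) (pCons b q) + pCons 0 (smult (cnj b) p) + r) z)"
      by (simp only: poly_add poly_smult poly_pCons plus_complex.simps) (simp add: algebra_simps)
  qed
qed

text \<open>
  The Stone-Weierstrass theorem for the algebra of real parts of polynomials.
\<close>

lemma circle_real_part_approximation:
  fixes f :: "complex \<Rightarrow> real"
  assumes f: "continuous_on (sphere 0 1) f" and e: "e > 0"
  obtains p where "\<And>z. cmod z = 1 \<Longrightarrow> \<bar>f z - Re (poly p z)\<bar> < e"
proof -
  define R where "R = {f. \<exists>p. \<forall>z. cmod z = 1 \<longrightarrow> f z = Re (poly p z)}"
  have RI: "f \<in> R" if "\<And>z. cmod z = 1 \<Longrightarrow> f z = Re (poly p z)" for f p using that by (auto simp: R_def)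
  interpret function_ring_on R "sphere 0 1"
  proof
    show "compact (sphere (0::complex) 1)" by simp
  next
    fix f assume "f \<in> R"
    then obtain p where p: "\<And>z. cmod z = 1 \<Longrightarrow> f z = Re (poly p z)" by (auto simp: R_def)
    have "continuous_on (sphere 0 1) (\<lambda>z. Re (poly p z))" by (intro continuous_intros)
    then show "continuous_on (sphere 0 1) f" by (rule continuous_on_eq) (simp add: p)
  next
    fix f g assume "f \<in> R" "g \<in> R"
    then obtain p q where p: "\<And>z. cmod z = 1 \<Longrightarrow> f z = Re (poly p z)"
      and q: "\<And>z. cmod z = 1 \<Longrightarrow> g z = Re (poly q z)" by (auto simp: R_def)
    show "(\<lambda>x. f x + g x) \<in> R" by (rule RI[of _ "p + q"]) (simp add: p q)
    obtain r where r: "\<And>z. cmod z = 1 \<Longrightarrow> Re (poly p z * cnj (poly q z)) = Re (poly r z)"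
      using Re_poly_mult_cnj_on_circle[of p q] by blast
    show "(\<lambda>x. f x * g x) \<in> R"
    proof (rule RI)
      fix z :: complex assume z: "cmod z = 1"
      have "Re (poly p z) * Re (poly q z) = (Re (poly p z * poly q z) + Re (poly p z * cnj (poly q z))) / 2"
        by simp
      also have "\<dots> = Re (poly (smult (1/2) (p * q + r)) z)" using r[OF z] by simp
      finally show "f z * g z = Re (poly (smult (1/2) (p * q + r)) z)" by (simp add: p[OF z] q[OF z])
    qed
  next
    show "(\<lambda>_. c) \<in> R" for c by (rule RI[of _ "[:of_real c:]"]) simp
  next
    fix x y :: complex assume "x \<noteq> y"
    have "Re \<in> R" by (rule RI[of _ "[:0, 1:]"]) simp
    moreover have "Im \<in> R" by (rule RI[of _ "[:0, - \<i>:]"]) simp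
    ultimately show "\<exists>f\<in>R. f x \<noteq> f y" using \<open>x \<noteq> y\<close> complex_eq_iff by blast
  qed
  obtain F where F: "F \<in> UNIV \<rightarrow> R" "LIM n sequentially. F n :> uniformly_on (sphere 0 1) f"
    using Stone_Weierstrass[OF f] by blast
  have "\<forall>\<^sub>F n in sequentially. \<forall>x\<in>sphere 0 1. dist (F n x) (f x) < e"
    using F(2) e by (auto simp: uniform_limit_iff)
  then obtain n where n: "\<forall>x\<in>sphere 0 1. dist (F n x) (f x) < e"
    unfolding eventually_sequentially by blast
  have "F n \<in> R" using F(1) by auto
  then obtain p where p: "\<And>z. cmod z = 1 \<Longrightarrow> F n z = Re (poly p z)" by (auto simp: R_def)
  show ?thesis
  proof (rule that[of p])
    fix z :: complex assume z: "cmod z = 1"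
    then show "\<bar>f z - Re (poly p z)\<bar> < e"
      using n[rule_format, of z] p[OF z] by (simp add: dist_real_def abs_minus_commute)
  qed
qed

lemma polynomial_exp_approximation:
  fixes p :: "complex poly"
  assumes e: "e > 0"
  obtains q where "\<And>z. cmod z = 1 \<Longrightarrow> cmod (poly q z - exp (poly p z)) < e"
proof -
  have "compact (poly p ` sphere 0 1)" by (intro compact_continuous_image continuous_intros) auto
  then have "bounded (poly p ` sphere 0 1)" by (rule compact_imp_bounded)
  then obtain R where R: "\<forall>x\<in>poly p ` sphere 0 1. cmod x \<le> R"
    unfolding bounded_iff by blast
  have "cmod (poly p 1) \<le> R" using R by simp
  then have R0: "R \<ge> 0" using norm_ge_zero[of "poly p 1"] by linarith
  have "(\<lambda>n. R ^ n / fact n) \<longlonglongrightarrow> 0"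
    using summable_LIMSEQ_zero[OF summable_exp[of R]] by (simp add: field_simps)
  then have "(\<lambda>n. exp R * R * (R ^ n / fact n)) \<longlonglongrightarrow> exp R * R * 0"
    by (intro tendsto_intros)
  then have "\<forall>\<^sub>F n in sequentially. exp R * R * (R ^ n / fact n) < e"
    using e by (intro order_tendstoD) auto
  then obtain n where n: "exp R * R * (R ^ n / fact n) < e" unfolding eventually_sequentially by blast
  define q where "q = (\<Sum>k\<le>n. smult (1 / fact k) (p ^ k))"
  have "cmod (poly q z - exp (poly p z)) < e" if z: "cmod z = 1" for z
  proof -
    let ?w = "poly p z"
    have w: "cmod ?w \<le> R" using R z by auto
    have q: "poly q z = (\<Sum>k\<le>n. ?w ^ k / fact k)" by (simp add: q_def poly_sum poly_power)
    have "cmod (exp ?w - (\<Sum>k\<le>n. ?w ^ k / fact k)) \<le> exp \<bar>Re ?w\<bar> * cmod ?w ^ Suc n / fact n"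
      by (rule Taylor_exp)
    also have "\<dots> \<le> exp R * R ^ Suc n / fact n"
    proof (rule divide_right_mono, rule mult_mono)
      show "exp \<bar>Re ?w\<bar> \<le> exp R" using w abs_Re_le_cmod[of ?w] by simp
      show "cmod ?w ^ Suc n \<le> R ^ Suc n" by (rule power_mono[OF w]) simp
    qed auto
    also have "\<dots> = exp R * R * (R ^ n / fact n)" by simp
    finally have "cmod (exp ?w - (\<Sum>k\<le>n. ?w ^ k / fact k)) < e" using n by simp
    then show ?thesis by (simp add: q norm_minus_commute)
  qed
  then show ?thesis by (rule that)
qed

text \<open>
  If \<open>Re p\<close> approximates \<open>ln w\<close>, then \<open>\<bar>exp p\<bar> = exp (Re p)\<close> approximates \<open>w\<close>, and \<open>exp p\<close> is
  uniformly approximated by a Taylor polynomial of \<open>exp\<close> in \<open>p\<close>.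
\<close>

lemma polynomial_with_prescribed_modulus:
  fixes w :: "complex \<Rightarrow> real"
  assumes w: "continuous_on (sphere 0 1) w" and pos: "\<And>z. cmod z = 1 \<Longrightarrow> w z > 0" and e: "e > 0"
  obtains q where "\<And>z. cmod z = 1 \<Longrightarrow> \<bar>cmod (poly q z) - w z\<bar> < e"
proof -
  have "continuous_on (sphere 0 1) (\<lambda>z. ln (w z))"
  proof (intro continuous_intros w ballI)
    show "w z \<noteq> 0" if "z \<in> sphere 0 1" for z using pos[of z] that by simp
  qed
  have "compact (w ` sphere 0 1)" by (intro compact_continuous_image w) auto
  then have "bounded (w ` sphere 0 1)" by (rule compact_imp_bounded)
  then obtain W where W: "\<forall>x\<in>w ` sphere 0 1. norm x \<le> W"
    unfolding bounded_iff by blast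
  define d where "d = ln (1 + e / (2 * (\<bar>W\<bar> + 1)))"
  have d: "d > 0" "exp d = 1 + e / (2 * (\<bar>W\<bar> + 1))" using e by (simp_all add: d_def add_pos_pos)
  obtain p where p: "\<And>z. cmod z = 1 \<Longrightarrow> \<bar>ln (w z) - Re (poly p z)\<bar> < d"
    using circle_real_part_approximation[OF \<open>continuous_on (sphere 0 1) (\<lambda>z. ln (w z))\<close> d(1)] by blast
  have e2: "e / 2 > 0" using e by simp
  obtain q where q: "\<And>z. cmod z = 1 \<Longrightarrow> cmod (poly q z - exp (poly p z)) < e / 2"
    using polynomial_exp_approximation[OF e2, of p] by blast
  have "\<bar>cmod (poly q z) - w z\<bar> < e" if z: "cmod z = 1" for z
  proof -
    have "z \<in> sphere 0 1" using z by simp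
    then have "\<bar>w z\<bar> \<le> W" using W by fastforce
    then have wz: "w z > 0" "w z \<le> W" using pos[OF z] by auto
    let ?a = "Re (poly p z) - ln (w z)"
    have a: "\<bar>exp ?a - 1\<bar> \<le> exp d - 1"
    proof (cases "?a \<ge> 0")
      case True
      then show ?thesis using p[OF z] by simp
    next
      case False
      have "exp d * exp ?a \<ge> 1" using p[OF z] by (simp add: exp_add[symmetric])
      moreover have "0 \<le> (exp d - 1) * (1 - exp ?a)" using False d(1) by (intro mult_nonneg_nonneg) auto
      ultimately show ?thesis using False by (simp add: algebra_simps)
    qed
    have "cmod (exp (poly p z)) - w z = w z * (exp ?a - 1)"
      using wz by (simp add: exp_diff algebra_simps)
    then have "\<bar>cmod (exp (poly p z)) - w z\<bar> = w z * \<bar>exp ?a - 1\<bar>" using wz by (simp add: abs_mult)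
    also have "\<dots> \<le> (\<bar>W\<bar> + 1) * (exp d - 1)" using wz a by (intro mult_mono) auto
    also have "\<dots> = e / 2" by (simp add: d(2) field_simps)
    finally have "\<bar>cmod (exp (poly p z)) - w z\<bar> \<le> e / 2" .
    moreover have "\<bar>cmod (poly q z) - cmod (exp (poly p z))\<bar> < e / 2"
      using q[OF z] norm_triangle_ineq3[of "poly q z" "exp (poly p z)"] by linarith
    ultimately show ?thesis by linarith
  qed
  then show ?thesis by (rule that)
qed

text \<open>
  A cut-off function for \<open>C\<close> with positive values, so that it can serve as the modulus of a zero-free
  function. The empty set is a separate case, since its distance function \<open>infdist\<close> is \<open>0\<close>.
\<close>

lemma compact_neighbourhood_weight:
  fixes C :: "complex set"
  assumes "compact C" "r > 0" "0 < \<kappa>" "\<kappa> < 1"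
  obtains w :: "complex \<Rightarrow> real" where "continuous_on UNIV w" and "\<And>z. \<kappa> \<le> w z \<and> w z \<le> 1"
    and "\<And>z. z \<in> C \<Longrightarrow> w z = 1" and "\<And>z. (\<And>c. c \<in> C \<Longrightarrow> dist z c \<ge> r) \<Longrightarrow> w z = \<kappa>"
proof (cases "C = {}")
  case True
  show ?thesis by (rule that[of "\<lambda>_. \<kappa>"]) (use assms True in auto)
next
  case False
  define w where "w z = max \<kappa> (1 - infdist z C / r)" for z
  have cl: "closed C" using assms(1) by (rule compact_imp_closed)
  show ?thesis
  proof (rule that[of w])
    show "continuous_on UNIV w" unfolding w_def by (intro continuous_intros) (use assms in auto)
    show "\<kappa> \<le> w z \<and> w z \<le> 1" for z using assms infdist_nonneg[of z C] by (auto simp: w_def)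
    show "w z = 1" if "z \<in> C" for z using assms that by (simp add: w_def)
  next
    fix z assume z: "\<And>c. c \<in> C \<Longrightarrow> dist z c \<ge> r"
    have "infdist z C \<ge> r" unfolding infdist_notempty[OF False] by (rule cINF_greatest[OF False]) (rule z)
    then have "1 - infdist z C / r \<le> 0" using assms by (simp add: field_simps)
    then have "1 - infdist z C / r \<le> \<kappa>" using assms(3) by linarith
    then show "w z = \<kappa>" unfolding w_def by (rule max_absorb1)
  qed
qed

section \<open>Interpolation of ellipsoids over the circle\<close>

lemma matrix_norm_bounds:
  fixes A :: "complex ^ 'n::finite ^ 'n"
  assumes "det A \<noteq> 0"
  obtains M \<tau> where "M > 0" "\<tau> > 0" "\<And>y. norm (ctrans A *v y) \<le> M * norm y" "\<And>y. \<tau> * norm y \<le> norm (ctrans A *v y)"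
proof -
  obtain M where M: "M > 0" "\<And>y. norm (ctrans A *v y) \<le> M * norm y"
    using linear_bounded_pos[OF linear_complex_matrix[of "ctrans A"]] by blast
  obtain B where "A ** B = mat 1"
    using assms by (auto simp: invertible_det_nz[symmetric] invertible_def)
  then have "ctrans B ** ctrans A = mat 1"
    by (simp add: ctrans_mult[symmetric]) (simp add: ctrans_def mat_def vec_eq_iff)
  then have inv: "ctrans B *v (ctrans A *v y) = y" for y by (simp add: matrix_vector_mul_assoc)
  obtain N where N: "N > 0" "\<And>y. norm (ctrans B *v y) \<le> N * norm y"
    using linear_bounded_pos[OF linear_complex_matrix[of "ctrans B"]] by blast
  have "1 / N * norm y \<le> norm (ctrans A *v y)" for y
    using N(2)[of "ctrans A *v y"] N(1) by (simp add: inv field_simps)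
  then show ?thesis using that[of M "1 / N"] M N(1) by simp
qed

lemma uniform_matrix_norm_bounds:
  fixes T :: "'i \<Rightarrow> complex ^ 'n::finite ^ 'n"
  assumes "finite I" "\<And>i. i \<in> I \<Longrightarrow> det (T i) \<noteq> 0"
  obtains M \<tau> where "M > 0" "\<tau> > 0" "\<And>i y. i \<in> I \<Longrightarrow> norm (ctrans (T i) *v y) \<le> M * norm y"
    "\<And>i y. i \<in> I \<Longrightarrow> \<tau> * norm y \<le> norm (ctrans (T i) *v y)"
proof -
  have "\<exists>M>0. \<exists>\<tau>>0. \<forall>i\<in>I. \<forall>y. norm (ctrans (T i) *v y) \<le> M * norm y \<and> \<tau> * norm y \<le> norm (ctrans (T i) *v y)"
    using assms
  proof (induction I)
    case empty
    show ?case by (rule exI[of _ "1::real"], rule conjI, simp, rule exI[of _ "1::real"], simp)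
  next
    case (insert i I)
    have "\<exists>M>0. \<exists>\<tau>>0. \<forall>i\<in>I. \<forall>y. norm (ctrans (T i) *v y) \<le> M * norm y \<and> \<tau> * norm y \<le> norm (ctrans (T i) *v y)"
      by (rule insert.IH) (use insert.prems in auto)
    then obtain M \<tau> where M: "M > 0" "\<tau> > 0" "\<And>i y. i \<in> I \<Longrightarrow> norm (ctrans (T i) *v y) \<le> M * norm y"
      "\<And>i y. i \<in> I \<Longrightarrow> \<tau> * norm y \<le> norm (ctrans (T i) *v y)"
      by blast
    obtain N \<sigma> where N: "N > 0" "\<sigma> > 0" "\<And>y. norm (ctrans (T i) *v y) \<le> N * norm y" "\<And>y. \<sigma> * norm y \<le> norm (ctrans (T i) *v y)"
      using matrix_norm_bounds[of "T i"] insert.prems by blast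
    have up: "M * norm y \<le> max M N * norm y" "N * norm y \<le> max M N * norm y"
      and lo: "min \<tau> \<sigma> * norm y \<le> \<tau> * norm y" "min \<tau> \<sigma> * norm y \<le> \<sigma> * norm y" for y :: "complex ^ 'n"
      by (auto intro: mult_right_mono)
    have "norm (ctrans (T j) *v y) \<le> max M N * norm y \<and> min \<tau> \<sigma> * norm y \<le> norm (ctrans (T j) *v y)"
      if "j \<in> insert i I" for j y
      using that N(3,4)[of y] M(3,4)[of j y] up[of y] lo[of y] by (cases "j = i") auto
    moreover have "max M N > 0" "min \<tau> \<sigma> > 0" using M N by auto
    ultimately show ?case by blast
  qed
  then show ?thesis using that by blast
qed

lemma separation_radius:
  fixes C :: "'i \<Rightarrow> complex set" and U :: "'i \<Rightarrow> complex set"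
  assumes "finite I" and C: "\<And>i. i \<in> I \<Longrightarrow> compact (C i)" and U: "\<And>i. i \<in> I \<Longrightarrow> openin (top_of_set (sphere 0 1)) (U i)"
    and CU: "\<And>i. i \<in> I \<Longrightarrow> C i \<subseteq> U i" and disj: "\<And>i j. i \<in> I \<Longrightarrow> j \<in> I \<Longrightarrow> i \<noteq> j \<Longrightarrow> C i \<inter> C j = {}"
  obtains r where "r > 0" "\<And>i z c. i \<in> I \<Longrightarrow> cmod z = 1 \<Longrightarrow> c \<in> C i \<Longrightarrow> dist z c < r \<Longrightarrow> z \<in> U i"
    "\<And>i j c c'. i \<in> I \<Longrightarrow> j \<in> I \<Longrightarrow> i \<noteq> j \<Longrightarrow> c \<in> C i \<Longrightarrow> c' \<in> C j \<Longrightarrow> 2 * r \<le> dist c c'"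
proof -
  have "\<exists>d>0. \<forall>c\<in>C i. \<forall>z\<in>(sphere 0 1 - U i) \<union> (\<Union>j\<in>I - {i}. C j). d \<le> dist c z" if i: "i \<in> I" for i
  proof (rule separate_compact_closed)
    show "compact (C i)" by (rule C[OF i])
    have "closed (sphere 0 1 - U i)"
      using U[OF i] closedin_closed_trans[of "sphere 0 1" "sphere 0 1 - U i"]
      by (simp add: closedin_def openin_imp_subset double_diff)
    moreover have "closed (\<Union>j\<in>I - {i}. C j)"
      using assms(1) by (intro closed_UN) (auto intro: compact_imp_closed C)
    ultimately show "closed ((sphere 0 1 - U i) \<union> (\<Union>j\<in>I - {i}. C j))" by (rule closed_Un)
    show "C i \<inter> ((sphere 0 1 - U i) \<union> (\<Union>j\<in>I - {i}. C j)) = {}"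
      using CU[OF i] disj[OF i] by auto
  qed
  then obtain d where d: "\<And>i. i \<in> I \<Longrightarrow> d i > 0"
    "\<And>i c z. i \<in> I \<Longrightarrow> c \<in> C i \<Longrightarrow> z \<in> (sphere 0 1 - U i) \<union> (\<Union>j\<in>I - {i}. C j) \<Longrightarrow> d i \<le> dist c z"
    by metis
  define r where "r = Min (insert 1 (d ` I)) / 2"
  have r0: "r > 0" using assms(1) d(1) by (auto simp: r_def)
  have r: "2 * r \<le> d i" if "i \<in> I" for i using assms(1) that by (auto simp: r_def intro: Min_le)
  show ?thesis
  proof (rule that[OF r0])
    fix i z c assume a: "i \<in> I" "cmod z = 1" "c \<in> C i" "dist z c < r"
    show "z \<in> U i"
    proof (rule ccontr)
      assume "z \<notin> U i"
      then have "d i \<le> dist c z" using a by (intro d(2)) auto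
      then show False using a(4) r[OF a(1)] r0 by (simp add: dist_commute)
    qed
  next
    fix i j c c' assume a: "i \<in> I" "j \<in> I" "i \<noteq> j" "c \<in> C i" "c' \<in> C j"
    then have "d i \<le> dist c c'" by (intro d(2)) auto
    then show "2 * r \<le> dist c c'" using r[OF a(1)] by linarith
  qed
qed

lemma cis_inj_on_period: "inj_on cis {0<..<2 * pi}"
proof (rule inj_onI)
  fix s t assume st: "s \<in> {0<..<2 * pi}" "t \<in> {0<..<2 * pi}" "cis s = cis t"
  have arg: "Arg2pi (cis u) = u" if "u \<in> {0<..<2 * pi}" for u
  proof (rule Arg2pi_unique[of 1])
    show "of_real 1 * exp (\<i> * of_real u) = cis u" by (simp only: of_real_1 mult_1_left cis_conv_exp)
  qed (use that in simp_all)
  have "s = Arg2pi (cis s)" by (rule arg[OF st(1), symmetric])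
  also have "\<dots> = Arg2pi (cis t)" by (simp only: st(3))
  also have "\<dots> = t" by (rule arg[OF st(2)])
  finally show "s = t" .
qed

lemma ctrans_mat_mult:
  "ctrans (mat (complex_of_real c) ** A) *v y = c *\<^sub>R (ctrans A *v y)"
proof -
  have "(mat (complex_of_real c) ** A) $ i $ j = of_real c * A $ i $ j" for i j
    by (simp add: matrix_matrix_mult_def mat_def sum_delta_mult)
  then have "(ctrans (mat (complex_of_real c) ** A) *v y) $ j = (c *\<^sub>R (ctrans A *v y)) $ j" for j
    by (simp add: ctrans_mult_vec scaleR_sum_right scaleR_conv_of_real[where 'a = complex] sum_distrib_left mult.assoc)
  then show ?thesis by (simp add: vec_eq_iff)
qed

lemma det_mat: "det (mat c :: 'a::comm_ring_1 ^ 'n::finite ^ 'n) = c ^ CARD('n)"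
  by (subst det_diagonal) (auto simp: mat_def)

text \<open>
  The modulus is aimed at \<open>1 - 2 \<eta>\<close> on \<open>C\<close>. The margin \<open>\<eta>\<close> absorbs the error \<open>\<kappa>\<close> of the approximation, and a further
  \<open>\<eta>\<close> remains for the other summands in the interpolation of ellipsoids.
\<close>

lemma peak_polynomial:
  assumes C: "compact C" and r: "r > 0" and \<eta>: "0 < \<eta>" "\<eta> < 1 / 3" and \<kappa>: "0 < \<kappa>" "\<kappa> \<le> \<eta>"
  obtains q :: "complex poly" where "\<And>z. cmod z = 1 \<Longrightarrow> cmod (poly q z) \<le> 1 - \<eta>"
    and "\<And>z. cmod z = 1 \<Longrightarrow> z \<in> C \<Longrightarrow> 1 - 3 * \<eta> \<le> cmod (poly q z)"
    and "\<And>z. cmod z = 1 \<Longrightarrow> (\<And>c. c \<in> C \<Longrightarrow> r \<le> dist z c) \<Longrightarrow> cmod (poly q z) \<le> 2 * \<kappa>"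
proof -
  have "\<kappa> < 1" using \<kappa> \<eta> by linarith
  from compact_neighbourhood_weight[OF C r \<kappa>(1) this] obtain w :: "complex \<Rightarrow> real" where
    w: "continuous_on UNIV w" "\<And>z. \<kappa> \<le> w z \<and> w z \<le> 1" "\<And>z. z \<in> C \<Longrightarrow> w z = 1"
      "\<And>z. (\<And>c. c \<in> C \<Longrightarrow> dist z c \<ge> r) \<Longrightarrow> w z = \<kappa>"
    by blast
  define w' where "w' z = (1 - 2 * \<eta>) * w z" for z
  have cont: "continuous_on (sphere 0 1) w'"
    unfolding w'_def by (intro continuous_intros continuous_on_subset[OF w(1)]) auto
  have pos: "w' z > 0" for z
  proof -
    have "w z > 0" using w(2)[of z] \<kappa> by linarith
    then show ?thesis using \<eta> by (simp add: w'_def)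
  qed
  obtain q where q: "\<And>z. cmod z = 1 \<Longrightarrow> \<bar>cmod (poly q z) - w' z\<bar> < \<kappa>"
    using polynomial_with_prescribed_modulus[OF cont pos \<kappa>(1)] by blast
  show ?thesis
  proof (rule that[of q])
    fix z :: complex assume z: "cmod z = 1"
    have "(1 - 2 * \<eta>) * w z \<le> (1 - 2 * \<eta>) * 1" using w(2)[of z] \<eta> by (intro mult_left_mono) auto
    then have "w' z \<le> 1 - 2 * \<eta>" by (simp add: w'_def)
    then show "cmod (poly q z) \<le> 1 - \<eta>" using q[OF z] \<kappa> by linarith
    show "1 - 3 * \<eta> \<le> cmod (poly q z)" if "z \<in> C"
      using q[OF z] w(3)[OF that] \<kappa> unfolding w'_def by (simp add: abs_less_iff)
    show "cmod (poly q z) \<le> 2 * \<kappa>" if far: "\<And>c. c \<in> C \<Longrightarrow> r \<le> dist z c"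
    proof -
      have "w z = \<kappa>" by (rule w(4)) (rule far)
      then have "w' z = \<kappa> - 2 * (\<eta> * \<kappa>)" unfolding w'_def by (simp add: algebra_simps)
      moreover have "0 \<le> \<eta> * \<kappa>" using \<eta> \<kappa> by simp
      ultimately show ?thesis using q[OF z] by linarith
    qed
  qed
qed

text \<open>
  The predicate \<open>valid z T\<close> stands for: the closed ellipsoid \<open>T (cball 0 1)\<close> lies in the fiber over \<open>z\<close>.
  The matrix \<open>F\<close> comes from the factorization \<open>F F* = \<delta>\<^sup>2 I + \<Sum>\<^sub>i \<bar>q\<^sub>i\<bar>\<^sup>2 T\<^sub>i T\<^sub>i*\<close> on the circle. Near \<open>C\<^sub>i\<close> the
  sum is at most \<open>T\<^sub>i T\<^sub>i*\<close>, and \<open>T\<^sub>i\<close> is still valid there; away from all \<open>C\<^sub>i\<close> it is at most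
  \<open>\<epsilon>\<^sup>2 I\<close>. So \<open>F\<close> is valid on the whole circle. The lower bounds on \<open>det F\<close> hold since \<open>F F*\<close>
  is at least each single summand. It is essential that \<open>\<delta>\<close> does not depend on the sets \<open>C\<^sub>i\<close>: they
  are chosen later so as to miss only a set of small measure compared with \<open>ln \<delta>\<close>.
\<close>

lemma ellipsoid_interpolation:
  fixes valid :: "complex \<Rightarrow> complex ^ 'n::finite ^ 'n \<Rightarrow> bool" and T :: "'i \<Rightarrow> complex ^ 'n ^ 'n"
  assumes mono: "\<And>z T T'. valid z T \<Longrightarrow> (*v) T' ` cball 0 1 \<subseteq> (*v) T ` cball 0 1 \<Longrightarrow> valid z T'"
    and op: "\<And>T. openin (top_of_set (sphere 0 1)) {z \<in> sphere 0 1. valid z T}"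
    and base: "\<epsilon> > 0" "\<And>z. cmod z = 1 \<Longrightarrow> valid z (mat (complex_of_real \<epsilon>))"
    and fin: "finite I" and det: "\<And>i. i \<in> I \<Longrightarrow> det (T i) \<noteq> 0"
    and \<eta>: "0 < \<eta>" "\<eta> < 1 / 3"
  obtains \<delta> where "0 < \<delta>" "\<delta> < 1" "\<And>C :: 'i \<Rightarrow> complex set. (\<And>i. i \<in> I \<Longrightarrow> compact (C i)) \<Longrightarrow>
    (\<And>i j. i \<in> I \<Longrightarrow> j \<in> I \<Longrightarrow> i \<noteq> j \<Longrightarrow> C i \<inter> C j = {}) \<Longrightarrow>
    (\<And>i z. i \<in> I \<Longrightarrow> z \<in> C i \<Longrightarrow> cmod z = 1 \<and> valid z (T i)) \<Longrightarrow>
    \<exists>F. (\<forall>z. cmod z \<le> 1 \<longrightarrow> det (poly_matrix F z) \<noteq> 0) \<and>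
        (\<forall>z. cmod z = 1 \<longrightarrow> valid z (poly_matrix F z) \<and> \<delta> ^ CARD('n) \<le> cmod (det (poly_matrix F z))) \<and>
        (\<forall>i\<in>I. \<forall>z\<in>C i. (1 - 3 * \<eta>) ^ CARD('n) * cmod (det (T i)) \<le> cmod (det (poly_matrix F z)))"
proof -
  from uniform_matrix_norm_bounds[of I T, OF fin det] obtain M \<tau> where M: "M > 0" and \<tau>: "\<tau> > 0"
    and TM: "\<And>i y. i \<in> I \<Longrightarrow> norm (ctrans (T i) *v y) \<le> M * norm y"
    and T\<tau>: "\<And>i y. i \<in> I \<Longrightarrow> \<tau> * norm y \<le> norm (ctrans (T i) *v y)"
    by blast
  \<comment> \<open>The budget \<open>m \<bar>y\<bar>\<^sup>2\<close> for \<open>\<delta>\<^sup>2 \<bar>y\<bar>\<^sup>2\<close> plus the tails: small against \<open>\<eta> \<bar>T\<^sub>i* y\<bar>\<^sup>2\<close> and \<open>\<epsilon>\<^sup>2 \<bar>y\<bar>\<^sup>2\<close>.\<close>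
  define m where "m = min (\<eta> * \<tau>\<^sup>2) (\<epsilon>\<^sup>2)"
  have m: "m > 0" "m \<le> \<eta> * \<tau>\<^sup>2" "m \<le> \<epsilon>\<^sup>2" using \<eta> \<tau> base(1) by (auto simp: m_def)
  define \<delta> where "\<delta> = min (1 / 2) (sqrt (m / 2))"
  have \<delta>: "0 < \<delta>" "\<delta> < 1" using m by (auto simp: \<delta>_def)
  have "\<delta>\<^sup>2 \<le> (sqrt (m / 2))\<^sup>2" using \<delta> by (intro power_mono) (auto simp: \<delta>_def)
  then have \<delta>2: "\<delta>\<^sup>2 \<le> m / 2" using m by simp
  define k where "k = real (card I)"
  \<comment> \<open>With \<open>\<bar>q\<^sub>i\<bar> \<le> 2 \<kappa>\<close> the tails \<open>\<Sum> \<bar>q\<^sub>i\<bar>\<^sup>2 \<bar>T\<^sub>i* y\<bar>\<^sup>2\<close> are at most half of the budget.\<close>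
  define \<kappa> where "\<kappa> = min \<eta> (sqrt (m / (8 * (k + 1) * M\<^sup>2)))"
  have k0: "k \<ge> 0" by (simp add: k_def)
  have \<kappa>: "0 < \<kappa>" "\<kappa> \<le> \<eta>" using m \<eta> M k0 by (auto simp: \<kappa>_def)
  have "\<kappa>\<^sup>2 \<le> (sqrt (m / (8 * (k + 1) * M\<^sup>2)))\<^sup>2" using \<kappa> by (intro power_mono) (auto simp: \<kappa>_def)
  also have "\<dots> = m / (8 * (k + 1) * M\<^sup>2)" using m M k0 by simp
  finally have "\<kappa>\<^sup>2 \<le> m / (8 * (k + 1) * M\<^sup>2)" .
  moreover have "8 * (k + 1) * M\<^sup>2 > 0" using M k0 by simp
  ultimately have "\<kappa>\<^sup>2 * (8 * (k + 1) * M\<^sup>2) \<le> m" by (simp only: pos_le_divide_eq)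
  then have \<kappa>2: "4 * \<kappa>\<^sup>2 * M\<^sup>2 * (k + 1) \<le> m / 2" by (simp add: algebra_simps)
  show ?thesis
  proof (rule that[OF \<delta>])
    fix C :: "'i \<Rightarrow> complex set"
    assume C: "\<And>i. i \<in> I \<Longrightarrow> compact (C i)"
      and disj: "\<And>i j. i \<in> I \<Longrightarrow> j \<in> I \<Longrightarrow> i \<noteq> j \<Longrightarrow> C i \<inter> C j = {}"
      and CT: "\<And>i z. i \<in> I \<Longrightarrow> z \<in> C i \<Longrightarrow> cmod z = 1 \<and> valid z (T i)"
    obtain r where r: "r > 0"
      and near: "\<And>i z c. i \<in> I \<Longrightarrow> cmod z = 1 \<Longrightarrow> c \<in> C i \<Longrightarrow> dist z c < r \<Longrightarrow> z \<in> {z \<in> sphere 0 1. valid z (T i)}"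
      and sep: "\<And>i j c c'. i \<in> I \<Longrightarrow> j \<in> I \<Longrightarrow> i \<noteq> j \<Longrightarrow> c \<in> C i \<Longrightarrow> c' \<in> C j \<Longrightarrow> 2 * r \<le> dist c c'"
    proof (rule separation_radius[of I C "\<lambda>i. {z \<in> sphere 0 1. valid z (T i)}"])
      show "C i \<subseteq> {z \<in> sphere 0 1. valid z (T i)}" if "i \<in> I" for i using CT[OF that] by auto
    qed (use fin C op disj in auto)
    have "\<exists>q. (\<forall>z. cmod z = 1 \<longrightarrow> cmod (poly q z) \<le> 1 - \<eta>) \<and>
        (\<forall>z. cmod z = 1 \<longrightarrow> z \<in> C i \<longrightarrow> 1 - 3 * \<eta> \<le> cmod (poly q z)) \<and>
        (\<forall>z. cmod z = 1 \<longrightarrow> (\<forall>c\<in>C i. r \<le> dist z c) \<longrightarrow> cmod (poly q z) \<le> 2 * \<kappa>)" if "i \<in> I" for i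
      by (rule peak_polynomial[OF C[OF that] r \<eta> \<kappa>]) blast
    then have "\<exists>q. \<forall>i\<in>I. (\<forall>z. cmod z = 1 \<longrightarrow> cmod (poly (q i) z) \<le> 1 - \<eta>) \<and>
        (\<forall>z. cmod z = 1 \<longrightarrow> z \<in> C i \<longrightarrow> 1 - 3 * \<eta> \<le> cmod (poly (q i) z)) \<and>
        (\<forall>z. cmod z = 1 \<longrightarrow> (\<forall>c\<in>C i. r \<le> dist z c) \<longrightarrow> cmod (poly (q i) z) \<le> 2 * \<kappa>)"
      by (intro bchoice ballI)
    then obtain q where q1: "\<And>i z. i \<in> I \<Longrightarrow> cmod z = 1 \<Longrightarrow> cmod (poly (q i) z) \<le> 1 - \<eta>"
      and q2: "\<And>i z. i \<in> I \<Longrightarrow> cmod z = 1 \<Longrightarrow> z \<in> C i \<Longrightarrow> 1 - 3 * \<eta> \<le> cmod (poly (q i) z)"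
      and q3: "\<And>i z. i \<in> I \<Longrightarrow> cmod z = 1 \<Longrightarrow> \<forall>c\<in>C i. r \<le> dist z c \<Longrightarrow> cmod (poly (q i) z) \<le> 2 * \<kappa>"
      by blast
    obtain F where F: "\<And>z. cmod z \<le> 1 \<Longrightarrow> det (poly_matrix F z) \<noteq> 0"
      and FF: "\<And>z y. cmod z = 1 \<Longrightarrow> (norm (ctrans (poly_matrix F z) *v y))\<^sup>2 =
       \<delta>\<^sup>2 * (norm y)\<^sup>2 + (\<Sum>i\<in>I. (cmod (poly (q i) z))\<^sup>2 * (norm (ctrans (T i) *v y))\<^sup>2)"
      using weighted_factorization[OF fin \<delta>(1), of q T] by blast
    have small: "\<delta>\<^sup>2 * (norm y)\<^sup>2 + (\<Sum>i\<in>J. (cmod (poly (q i) z))\<^sup>2 * (norm (ctrans (T i) *v y))\<^sup>2) \<le> m * (norm y)\<^sup>2"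
      if J: "J \<subseteq> I" "\<And>i. i \<in> J \<Longrightarrow> cmod (poly (q i) z) \<le> 2 * \<kappa>" for J z y
    proof -
      have "(\<Sum>i\<in>J. (cmod (poly (q i) z))\<^sup>2 * (norm (ctrans (T i) *v y))\<^sup>2) \<le> (\<Sum>i\<in>J. (2 * \<kappa>)\<^sup>2 * (M * norm y)\<^sup>2)"
        by (intro sum_mono mult_mono power_mono J(2) TM) (use J(1) in auto)
      also have "\<dots> = real (card J) * (4 * \<kappa>\<^sup>2 * M\<^sup>2 * (norm y)\<^sup>2)" by (simp add: power_mult_distrib)
      also have "\<dots> \<le> (k + 1) * (4 * \<kappa>\<^sup>2 * M\<^sup>2 * (norm y)\<^sup>2)"
        using card_mono[OF fin J(1)] by (intro mult_right_mono) (auto simp: k_def)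
      also have "\<dots> = (4 * \<kappa>\<^sup>2 * M\<^sup>2 * (k + 1)) * (norm y)\<^sup>2" by simp
      also have "\<dots> \<le> m / 2 * (norm y)\<^sup>2" by (rule mult_right_mono[OF \<kappa>2]) simp
      finally have "(\<Sum>i\<in>J. (cmod (poly (q i) z))\<^sup>2 * (norm (ctrans (T i) *v y))\<^sup>2) \<le> m / 2 * (norm y)\<^sup>2" .
      moreover have "\<delta>\<^sup>2 * (norm y)\<^sup>2 \<le> m / 2 * (norm y)\<^sup>2" by (rule mult_right_mono[OF \<delta>2]) simp
      ultimately show ?thesis by simp
    qed
    have norm_mat: "norm (ctrans (mat (complex_of_real c)) *v y) = \<bar>c\<bar> * norm y" for c and y :: "complex ^ 'n"
    proof -
      have "ctrans (mat 1 :: complex ^ 'n ^ 'n) = mat 1" by (simp add: ctrans_def mat_def vec_eq_iff)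
      then show ?thesis using ctrans_mat_mult[of c "mat 1" y] by simp
    qed
    have val: "valid z (poly_matrix F z)" if z: "cmod z = 1" for z
    proof (cases "\<exists>i\<in>I. \<exists>c\<in>C i. dist z c < r")
      case True
      then obtain i c where i: "i \<in> I" "c \<in> C i" "dist z c < r" by blast
      have vi: "valid z (T i)" using near[OF i(1) z i(2,3)] by simp
      have far: "cmod (poly (q j) z) \<le> 2 * \<kappa>" if j: "j \<in> I - {i}" for j
      proof (rule q3)
        show "\<forall>c'\<in>C j. r \<le> dist z c'"
        proof
          fix c' assume c': "c' \<in> C j"
          have "2 * r \<le> dist c c'" using sep[of i j c c'] i c' j by auto
          moreover have "dist c c' \<le> dist z c + dist z c'" by (rule dist_triangle3)
          ultimately show "r \<le> dist z c'" using i(3) by linarith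
        qed
      qed (use z j in auto)
      show ?thesis
      proof (rule mono[OF vi], rule ball_image_mono[OF _ det[OF i(1)]])
        fix y
        let ?t = "norm (ctrans (T i) *v y)"
        have "(norm (ctrans (poly_matrix F z) *v y))\<^sup>2 = (cmod (poly (q i) z))\<^sup>2 * ?t\<^sup>2 +
            (\<delta>\<^sup>2 * (norm y)\<^sup>2 + (\<Sum>j\<in>I - {i}. (cmod (poly (q j) z))\<^sup>2 * (norm (ctrans (T j) *v y))\<^sup>2))"
          unfolding FF[OF z] by (subst sum.remove[OF fin i(1)]) simp
        also have "\<dots> \<le> (1 - \<eta>)\<^sup>2 * ?t\<^sup>2 + m * (norm y)\<^sup>2"
        proof (rule add_mono)
          show "(cmod (poly (q i) z))\<^sup>2 * ?t\<^sup>2 \<le> (1 - \<eta>)\<^sup>2 * ?t\<^sup>2"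
            by (intro mult_right_mono power_mono q1[OF i(1) z]) auto
          show "\<delta>\<^sup>2 * (norm y)\<^sup>2 + (\<Sum>j\<in>I - {i}. (cmod (poly (q j) z))\<^sup>2 * (norm (ctrans (T j) *v y))\<^sup>2) \<le> m * (norm y)\<^sup>2"
            by (rule small) (use far in auto)
        qed
        also have "m * (norm y)\<^sup>2 \<le> \<eta> * ?t\<^sup>2"
        proof -
          have "m * (norm y)\<^sup>2 \<le> (\<eta> * \<tau>\<^sup>2) * (norm y)\<^sup>2" by (rule mult_right_mono[OF m(2)]) simp
          also have "\<dots> = \<eta> * (\<tau> * norm y)\<^sup>2" by (simp add: power_mult_distrib)
          also have "\<dots> \<le> \<eta> * ?t\<^sup>2" using \<eta> \<tau> by (intro mult_left_mono power_mono T\<tau>[OF i(1)]) auto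
          finally show ?thesis .
        qed
        also have "(1 - \<eta>)\<^sup>2 * ?t\<^sup>2 + \<eta> * ?t\<^sup>2 \<le> 1 * ?t\<^sup>2"
        proof -
          have "\<eta> * \<eta> \<le> \<eta> * 1" using \<eta> by (intro mult_left_mono) auto
          then have "(1 - \<eta>)\<^sup>2 + \<eta> \<le> 1" by (simp add: power2_eq_square algebra_simps)
          from mult_right_mono[OF this, of "?t\<^sup>2"] show ?thesis by (simp add: distrib_right)
        qed
        finally have "(norm (ctrans (poly_matrix F z) *v y))\<^sup>2 \<le> ?t\<^sup>2" by simp
        then show "norm (ctrans (poly_matrix F z) *v y) \<le> ?t" by (rule power2_le_imp_le) simp
      qed
    next
      case False
      have d0: "det (mat (complex_of_real \<epsilon>) :: complex ^ 'n ^ 'n) \<noteq> 0" using base(1) by (simp add: det_mat)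
      show ?thesis
      proof (rule mono[OF base(2)[OF z]], rule ball_image_mono[OF _ d0])
        fix y
        have "(norm (ctrans (poly_matrix F z) *v y))\<^sup>2 \<le> m * (norm y)\<^sup>2"
          unfolding FF[OF z] by (rule small) (use False z in \<open>auto intro!: q3 simp: not_less\<close>)
        also have "\<dots> \<le> \<epsilon>\<^sup>2 * (norm y)\<^sup>2" by (rule mult_right_mono[OF m(3)]) simp
        also have "\<dots> = (\<bar>\<epsilon>\<bar> * norm y)\<^sup>2" by (simp add: power_mult_distrib)
        finally have "norm (ctrans (poly_matrix F z) *v y) \<le> \<bar>\<epsilon>\<bar> * norm y" by (rule power2_le_imp_le) simp
        then show "norm (ctrans (poly_matrix F z) *v y) \<le> norm (ctrans (mat (complex_of_real \<epsilon>)) *v y)"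
          by (simp only: norm_mat)
      qed
    qed
    have low: "\<delta> ^ CARD('n) \<le> cmod (det (poly_matrix F z))" if z: "cmod z = 1" for z
    proof -
      have "cmod (det (mat (complex_of_real \<delta>) :: complex ^ 'n ^ 'n)) \<le> cmod (det (poly_matrix F z))"
      proof (rule det_mono)
        fix y
        have "(\<bar>\<delta>\<bar> * norm y)\<^sup>2 \<le> (norm (ctrans (poly_matrix F z) *v y))\<^sup>2"
          unfolding FF[OF z] by (simp add: power_mult_distrib sum_nonneg)
        then have "\<bar>\<delta>\<bar> * norm y \<le> norm (ctrans (poly_matrix F z) *v y)" by (rule power2_le_imp_le) simp
        then show "norm (ctrans (mat (complex_of_real \<delta>)) *v y) \<le> norm (ctrans (poly_matrix F z) *v y)"
          by (simp only: norm_mat)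
      qed (use F z \<delta> in \<open>auto simp: det_mat\<close>)
      then show ?thesis using \<delta> by (simp add: det_mat norm_power)
    qed
    have lowC: "(1 - 3 * \<eta>) ^ CARD('n) * cmod (det (T i)) \<le> cmod (det (poly_matrix F z))"
      if i: "i \<in> I" and zC: "z \<in> C i" for i z
    proof -
      have z: "cmod z = 1" using CT[OF i zC] by simp
      have c0: "1 - 3 * \<eta> > 0" using \<eta> by simp
      let ?A = "mat (complex_of_real (1 - 3 * \<eta>)) ** T i"
      have "cmod (det ?A) \<le> cmod (det (poly_matrix F z))"
      proof (rule det_mono)
        fix y
        have "((1 - 3 * \<eta>) * norm (ctrans (T i) *v y))\<^sup>2 = (1 - 3 * \<eta>)\<^sup>2 * (norm (ctrans (T i) *v y))\<^sup>2"
          by (rule power_mult_distrib)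
        also have "\<dots> \<le> (cmod (poly (q i) z))\<^sup>2 * (norm (ctrans (T i) *v y))\<^sup>2"
          using c0 by (intro mult_right_mono power_mono q2[OF i z zC]) auto
        also have "\<dots> \<le> (\<Sum>i\<in>I. (cmod (poly (q i) z))\<^sup>2 * (norm (ctrans (T i) *v y))\<^sup>2)"
          using i by (intro member_le_sum[OF _ _ fin]) auto
        also have "\<dots> \<le> (norm (ctrans (poly_matrix F z) *v y))\<^sup>2" unfolding FF[OF z] by simp
        finally have "(1 - 3 * \<eta>) * norm (ctrans (T i) *v y) \<le> norm (ctrans (poly_matrix F z) *v y)"
          by (rule power2_le_imp_le) simp
        then show "norm (ctrans ?A *v y) \<le> norm (ctrans (poly_matrix F z) *v y)"
          unfolding ctrans_mat_mult norm_scaleR using c0 by simp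
      next
        show "det ?A \<noteq> 0" unfolding det_mul det_mat using c0 det[OF i] by (simp del: of_real_diff)
      qed (use F z in auto)
      moreover have "cmod (det ?A) = (1 - 3 * \<eta>) ^ CARD('n) * cmod (det (T i))"
        unfolding det_mul det_mat norm_mult norm_power norm_of_real using c0 by simp
      ultimately show ?thesis by simp
    qed
    show "\<exists>F. (\<forall>z. cmod z \<le> 1 \<longrightarrow> det (poly_matrix F z) \<noteq> 0) \<and>
        (\<forall>z. cmod z = 1 \<longrightarrow> valid z (poly_matrix F z) \<and> \<delta> ^ CARD('n) \<le> cmod (det (poly_matrix F z))) \<and>
        (\<forall>i\<in>I. \<forall>z\<in>C i. (1 - 3 * \<eta>) ^ CARD('n) * cmod (det (T i)) \<le> cmod (det (poly_matrix F z)))"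
      using F val low lowC by (intro exI[of _ F]) simp
  qed
qed

lemma poly_matrix_det_holomorphic: "(\<lambda>z. det (poly_matrix F z)) holomorphic_on S"
  unfolding det_def poly_matrix_def vec_lambda_beta by (intro holomorphic_intros)

text \<open>
  The compact sets for the interpolation are taken inside the sets \<open>A\<^sub>i\<close>. On them
  \<open>ln \<bar>det F\<bar>\<close> is at least \<open>ln \<bar>det T\<^sub>i\<bar>\<close> up to a small error, and on the rest of the circle, which has
  small measure, it is at least \<open>n ln \<delta>\<close>.
  Integrate and use the mean value property.
\<close>

lemma ellipsoid_step_mean:
  fixes valid :: "complex \<Rightarrow> complex ^ 'n::finite ^ 'n \<Rightarrow> bool" and T :: "'i \<Rightarrow> complex ^ 'n ^ 'n"
  assumes mono: "\<And>z T T'. valid z T \<Longrightarrow> (*v) T' ` cball 0 1 \<subseteq> (*v) T ` cball 0 1 \<Longrightarrow> valid z T'"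
    and op: "\<And>T. openin (top_of_set (sphere 0 1)) {z \<in> sphere 0 1. valid z T}"
    and base: "\<epsilon> > 0" "\<And>z. cmod z = 1 \<Longrightarrow> valid z (mat (complex_of_real \<epsilon>))"
    and fin: "finite I" and det: "\<And>i. i \<in> I \<Longrightarrow> det (T i) \<noteq> 0"
    and A: "\<And>i. i \<in> I \<Longrightarrow> A i \<in> sets lebesgue" and disj: "disjoint_family_on A I"
    and cover: "(\<Union>i\<in>I. A i) = {0<..<2 * pi}"
    and valid: "\<And>i t. i \<in> I \<Longrightarrow> t \<in> A i \<Longrightarrow> valid (cis t) (T i)"
    and e: "e > 0"
  obtains F where "\<And>z. cmod z \<le> 1 \<Longrightarrow> det (poly_matrix F z) \<noteq> 0"
    and "\<And>z. cmod z = 1 \<Longrightarrow> valid z (poly_matrix F z)"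
    and "(\<Sum>i\<in>I. measure lebesgue (A i) * ln (cmod (det (T i)))) - e \<le> 2 * pi * ln (cmod (det (poly_matrix F 0)))"
proof -
  define n where "n = real CARD('n)"
  have n: "n > 0" by (simp add: n_def)
  \<comment> \<open>With \<open>x = 1 - 3 \<eta>\<close>, the loss \<open>n ln (1 - 3 \<eta>)\<close> on the compact sets contributes at most \<open>e / 2\<close>.\<close>
  define x where "x = exp (- (e / (4 * pi * n)))"
  have x: "0 < x" "x < 1" using e n by (simp_all add: x_def)
  define \<eta> where "\<eta> = (1 - x) / 3"
  have \<eta>: "0 < \<eta>" "\<eta> < 1 / 3" using x by (simp_all add: \<eta>_def)
  have "1 - 3 * \<eta> = x" by (simp add: \<eta>_def field_simps)
  then have "ln (1 - 3 * \<eta>) = - (e / (4 * pi * n))" by (simp add: x_def)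
  then have \<eta>e: "n * ln (1 - 3 * \<eta>) = - (e / (4 * pi))" using n by (simp add: field_simps)
  obtain \<delta> where \<delta>: "0 < \<delta>" "\<delta> < 1" and interp: "\<And>C :: 'i \<Rightarrow> complex set. (\<And>i. i \<in> I \<Longrightarrow> compact (C i)) \<Longrightarrow>
    (\<And>i j. i \<in> I \<Longrightarrow> j \<in> I \<Longrightarrow> i \<noteq> j \<Longrightarrow> C i \<inter> C j = {}) \<Longrightarrow>
    (\<And>i z. i \<in> I \<Longrightarrow> z \<in> C i \<Longrightarrow> cmod z = 1 \<and> valid z (T i)) \<Longrightarrow>
    \<exists>F. (\<forall>z. cmod z \<le> 1 \<longrightarrow> det (poly_matrix F z) \<noteq> 0) \<and>
        (\<forall>z. cmod z = 1 \<longrightarrow> valid z (poly_matrix F z) \<and> \<delta> ^ CARD('n) \<le> cmod (det (poly_matrix F z))) \<and>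
        (\<forall>i\<in>I. \<forall>z\<in>C i. (1 - 3 * \<eta>) ^ CARD('n) * cmod (det (T i)) \<le> cmod (det (poly_matrix F z)))"
    by (rule ellipsoid_interpolation[of valid \<epsilon> I T \<eta>, OF mono op base fin det \<eta>]) blast+
  define L where "L i = ln (cmod (det (T i)))" for i
  define d where "d = n * ln \<delta>"
  have d0: "d < 0" using n \<delta> by (simp add: d_def mult_pos_neg)
  define X where "X = (\<Sum>i\<in>I. \<bar>L i\<bar> - d)"
  have X0: "X \<ge> 0" unfolding X_def by (rule sum_nonneg) (use d0 in \<open>simp add: add_nonneg_nonneg\<close>)
  \<comment> \<open>Missing a set of measure \<open>\<theta>\<close> in each \<open>A\<^sub>i\<close> costs at most \<open>\<theta> X \<le> e / 2\<close>.\<close>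
  define \<theta> where "\<theta> = e / 2 / (1 + X)"
  have \<theta>: "\<theta> > 0" using e X0 by (simp add: \<theta>_def)
  have \<theta>X: "\<theta> * X \<le> e / 2" using e X0 by (simp add: \<theta>_def field_simps)
  have "\<exists>K. closed K \<and> K \<subseteq> A i \<and> A i - K \<in> lmeasurable \<and> emeasure lebesgue (A i - K) < ennreal \<theta>" if "i \<in> I" for i
    by (rule sets_lebesgue_inner_closed[OF A[OF that] \<theta>]) blast
  then obtain K where K: "\<And>i. i \<in> I \<Longrightarrow> closed (K i)" "\<And>i. i \<in> I \<Longrightarrow> K i \<subseteq> A i"
    "\<And>i. i \<in> I \<Longrightarrow> A i - K i \<in> lmeasurable" "\<And>i. i \<in> I \<Longrightarrow> emeasure lebesgue (A i - K i) < ennreal \<theta>"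
    by metis
  have AS: "A i \<subseteq> {0<..<2 * pi}" if "i \<in> I" for i using cover that by blast
  have KS: "K i \<subseteq> {0<..<2 * pi}" if "i \<in> I" for i using AS[OF that] K(2)[OF that] by blast
  have bS: "bounded {0<..<2 * pi}"
    by (rule bounded_subset[OF bounded_closed_interval[of 0 "2 * pi"]]) auto
  have Kc: "compact (K i)" if "i \<in> I" for i
    unfolding compact_eq_bounded_closed using K(1)[OF that] bounded_subset[OF bS KS[OF that]] by simp
  have Kl: "K i \<in> lmeasurable" if "i \<in> I" for i by (rule lmeasurable_compact[OF Kc[OF that]])
  have AL: "A i \<in> lmeasurable" if "i \<in> I" for i
    using bounded_subset[OF bS AS[OF that]] A[OF that] by (rule bounded_set_imp_lmeasurable)
  have meas: "measure lebesgue (K i) \<le> measure lebesgue (A i)" "measure lebesgue (A i) - measure lebesgue (K i) \<le> \<theta>" if i: "i \<in> I" for i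
  proof -
    have "measure lebesgue (A i - K i) = measure lebesgue (A i) - measure lebesgue (K i)"
      by (rule measurable_measure_Diff) (use AL[OF i] Kl[OF i] K(2)[OF i] in auto)
    moreover have "measure lebesgue (A i - K i) < \<theta>"
      using K(4)[OF i] K(3)[OF i] \<theta> by (simp add: emeasure_eq_measure2 ennreal_less_iff)
    moreover have "measure lebesgue (A i - K i) \<ge> 0" by simp
    ultimately show "measure lebesgue (K i) \<le> measure lebesgue (A i)" "measure lebesgue (A i) - measure lebesgue (K i) \<le> \<theta>"
      by linarith+
  qed
  have Kdisj: "K i \<inter> K j = {}" if "i \<in> I" "j \<in> I" "i \<noteq> j" for i j
    using disj that K(2)[of i] K(2)[of j] unfolding disjoint_family_on_def by blast
  have "\<exists>F. (\<forall>z. cmod z \<le> 1 \<longrightarrow> det (poly_matrix F z) \<noteq> 0) \<and>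
        (\<forall>z. cmod z = 1 \<longrightarrow> valid z (poly_matrix F z) \<and> \<delta> ^ CARD('n) \<le> cmod (det (poly_matrix F z))) \<and>
        (\<forall>i\<in>I. \<forall>z\<in>cis ` K i. (1 - 3 * \<eta>) ^ CARD('n) * cmod (det (T i)) \<le> cmod (det (poly_matrix F z)))"
  proof (rule interp)
    fix i assume i: "i \<in> I"
    show "compact (cis ` K i)" using Kc[OF i] by (intro compact_continuous_image continuous_intros) auto
    show "cmod z = 1 \<and> valid z (T i)" if "z \<in> cis ` K i" for z
      using that K(2)[OF i] valid[OF i] by auto
    show "cis ` K i \<inter> cis ` K j = {}" if j: "j \<in> I" "i \<noteq> j" for j
      using Kdisj[OF i j] KS[OF i] KS[OF j(1)] inj_on_image_Int[OF cis_inj_on_period, of "K i" "K j"] by simp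
  qed
  then obtain F where F: "\<And>z. cmod z \<le> 1 \<Longrightarrow> det (poly_matrix F z) \<noteq> 0"
    and Fv: "\<And>z. cmod z = 1 \<Longrightarrow> valid z (poly_matrix F z)"
    and Fd: "\<And>z. cmod z = 1 \<Longrightarrow> \<delta> ^ CARD('n) \<le> cmod (det (poly_matrix F z))"
    and FK: "\<And>i t. i \<in> I \<Longrightarrow> t \<in> K i \<Longrightarrow> (1 - 3 * \<eta>) ^ CARD('n) * cmod (det (T i)) \<le> cmod (det (poly_matrix F (cis t)))"
    by blast
  define f where "f t = ln (cmod (det (poly_matrix F (cis t))))" for t
  have f_int: "(f has_integral 2 * pi * ln (cmod (det (poly_matrix F 0)))) {0..2 * pi}"
    unfolding f_def by (rule log_modulus_mean_value[OF poly_matrix_det_holomorphic]) (rule F)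
  have fd: "d \<le> f t" for t
  proof -
    have "ln (\<delta> ^ CARD('n)) \<le> f t"
      unfolding f_def by (rule ln_mono) (use \<delta> Fd[of "cis t"] F[of "cis t"] in auto)
    then show ?thesis using \<delta> by (simp add: d_def n_def ln_realpow)
  qed
  have fK: "L i + n * ln (1 - 3 * \<eta>) \<le> f t" if i: "i \<in> I" "t \<in> K i" for i t
  proof -
    have p: "(1 - 3 * \<eta>) ^ CARD('n) > 0" "cmod (det (T i)) > 0" using \<eta> det[OF i(1)] by auto
    have "ln ((1 - 3 * \<eta>) ^ CARD('n) * cmod (det (T i))) \<le> f t"
      unfolding f_def by (rule ln_mono) (use p FK[OF i] F[of "cis t"] in auto)
    also have "ln ((1 - 3 * \<eta>) ^ CARD('n) * cmod (det (T i))) = n * ln (1 - 3 * \<eta>) + L i"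
      using p \<eta> det[OF i(1)] by (simp add: ln_mult ln_realpow n_def L_def)
    finally show ?thesis by simp
  qed
  define c where "c i = L i + n * ln (1 - 3 * \<eta>) - d" for i
  define g where "g t = d + (\<Sum>i\<in>I. c i * indicator (K i) t)" for t
  have g_int: "(g has_integral (2 * pi * d + (\<Sum>i\<in>I. c i * measure lebesgue (K i)))) {0..2 * pi}"
    unfolding g_def
  proof (intro has_integral_add has_integral_sum fin has_integral_mult_right)
    show "((\<lambda>t. d) has_integral 2 * pi * d) {0..2 * pi}"
      using has_integral_const_real[of d 0 "2 * pi"] by simp
    fix i assume i: "i \<in> I"
    have "(indicat_real (K i) has_integral measure lebesgue (K i)) UNIV"
      using Kl[OF i] by (simp add: has_integral_measure_lborel lmeasurable_iff_has_integral)
    then have "((\<lambda>t. if t \<in> {0..2 * pi} then indicat_real (K i) t else 0) has_integral measure lebesgue (K i)) UNIV"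
      by (rule has_integral_eq[rotated]) (use KS[OF i] in \<open>auto simp: indicator_def\<close>)
    then show "(indicat_real (K i) has_integral measure lebesgue (K i)) {0..2 * pi}"
      by (simp only: has_integral_restrict_UNIV)
  qed
  have gf: "g t \<le> f t" for t
  proof (cases "\<exists>i\<in>I. t \<in> K i")
    case True
    then obtain i where i: "i \<in> I" "t \<in> K i" by blast
    have "(\<Sum>j\<in>I. c j * indicator (K j) t) = (\<Sum>j\<in>I. if j = i then c i else 0)"
      using Kdisj[OF i(1)] i by (intro sum.cong) (auto simp: indicator_def)
    then have "g t = d + c i" using i fin by (simp add: g_def)
    then show ?thesis using fK[OF i] by (simp add: c_def)
  next
    case False
    then have "g t = d" by (simp add: g_def)
    then show ?thesis using fd by simp
  qed
  have main: "2 * pi * d + (\<Sum>i\<in>I. c i * measure lebesgue (K i)) \<le> 2 * pi * ln (cmod (det (poly_matrix F 0)))"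
    by (rule has_integral_le[OF g_int f_int gf])
  have tot: "(\<Sum>i\<in>I. measure lebesgue (A i)) = 2 * pi"
  proof -
    have "measure lebesgue (\<Union>i\<in>I. A i) = (\<Sum>i\<in>I. measure lebesgue (A i))"
      by (rule measure_finite_Union[OF fin _ disj]) (use A fmeasurableD2[OF AL] in auto)
    then show ?thesis by (simp add: cover)
  qed
  have totK: "(\<Sum>i\<in>I. measure lebesgue (K i)) \<le> 2 * pi"
    unfolding tot[symmetric] by (rule sum_mono) (rule meas(1))
  have "(\<Sum>i\<in>I. measure lebesgue (A i) * L i) - e \<le> 2 * pi * d + (\<Sum>i\<in>I. c i * measure lebesgue (K i))"
  proof -
    have "2 * pi * d + (\<Sum>i\<in>I. c i * measure lebesgue (K i)) =
        (\<Sum>i\<in>I. measure lebesgue (A i) * d + c i * measure lebesgue (K i))"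
      unfolding tot[symmetric] by (simp add: sum.distrib sum_distrib_right)
    also have "\<dots> = (\<Sum>i\<in>I. measure lebesgue (A i) * L i - (measure lebesgue (A i) - measure lebesgue (K i)) * (L i - d)
        + n * ln (1 - 3 * \<eta>) * measure lebesgue (K i))"
      by (rule sum.cong) (auto simp: c_def algebra_simps)
    also have "\<dots> = (\<Sum>i\<in>I. measure lebesgue (A i) * L i) - (\<Sum>i\<in>I. (measure lebesgue (A i) - measure lebesgue (K i)) * (L i - d))
        + n * ln (1 - 3 * \<eta>) * (\<Sum>i\<in>I. measure lebesgue (K i))"
      by (simp only: sum.distrib sum_subtractf sum_distrib_left)
    finally have eq: "2 * pi * d + (\<Sum>i\<in>I. c i * measure lebesgue (K i)) =
      (\<Sum>i\<in>I. measure lebesgue (A i) * L i) - (\<Sum>i\<in>I. (measure lebesgue (A i) - measure lebesgue (K i)) * (L i - d))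
        + n * ln (1 - 3 * \<eta>) * (\<Sum>i\<in>I. measure lebesgue (K i))" .
    have "(\<Sum>i\<in>I. (measure lebesgue (A i) - measure lebesgue (K i)) * (L i - d)) \<le> (\<Sum>i\<in>I. \<theta> * (\<bar>L i\<bar> - d))"
    proof (rule sum_mono)
      fix i assume i: "i \<in> I"
      have "(measure lebesgue (A i) - measure lebesgue (K i)) * (L i - d) \<le> (measure lebesgue (A i) - measure lebesgue (K i)) * (\<bar>L i\<bar> - d)"
        using meas(1)[OF i] by (intro mult_left_mono) auto
      also have "\<dots> \<le> \<theta> * (\<bar>L i\<bar> - d)" using meas(2)[OF i] d0 by (intro mult_right_mono) auto
      finally show "(measure lebesgue (A i) - measure lebesgue (K i)) * (L i - d) \<le> \<theta> * (\<bar>L i\<bar> - d)" .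
    qed
    also have "\<dots> = \<theta> * X" by (simp add: X_def sum_distrib_left)
    finally have 1: "(\<Sum>i\<in>I. (measure lebesgue (A i) - measure lebesgue (K i)) * (L i - d)) \<le> e / 2" using \<theta>X by linarith
    have "e / (4 * pi) * (\<Sum>i\<in>I. measure lebesgue (K i)) \<le> e / (4 * pi) * (2 * pi)"
      using e by (intro mult_left_mono totK) auto
    then have 2: "n * ln (1 - 3 * \<eta>) * (\<Sum>i\<in>I. measure lebesgue (K i)) \<ge> - (e / 2)"
      unfolding \<eta>e by simp
    show ?thesis unfolding eq using 1 2 by linarith
  qed
  then have "(\<Sum>i\<in>I. measure lebesgue (A i) * ln (cmod (det (T i)))) - e \<le> 2 * pi * ln (cmod (det (poly_matrix F 0)))"
    using main by (simp add: L_def)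
  then show ?thesis using that F Fv by blast
qed

section \<open>Passage to the circle mean\<close>

text \<open>
  For real \<open>x\<close> this is \<open>(M - x) + x\<^sup>+ = M + x\<^sup>-\<close>. It replaces the two parts of the
  extended integral by the integral of one nonnegative function.
\<close>

lemma e2ennreal_balance:
  assumes "x \<le> ereal M" "0 \<le> M"
  shows "e2ennreal (ereal M - x) + e2ennreal x = ennreal M + e2ennreal (- x)"
proof (cases x)
  case (real r)
  then have r: "r \<le> M" using assms by simp
  show ?thesis
  proof (cases "r \<ge> 0")
    case True
    then have "e2ennreal (- x) = 0" using real by (simp add: e2ennreal_neg ennreal_neg)
    then show ?thesis using real r True assms by (simp add: ennreal_plus[symmetric] del: ennreal_plus)
  next
    case False
    then have "ennreal (M - r) = ennreal M + ennreal (- r)" using assms by (simp add: ennreal_plus[symmetric] del: ennreal_plus)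
    then show ?thesis using real False by (simp add: ennreal_neg)
  qed
next
  case MInf
  then show ?thesis by (simp add: e2ennreal_neg)
qed (use assms in auto)

lemma nn_integral_circle_interval:
  fixes f :: "real \<Rightarrow> ennreal"
  shows "(\<integral>\<^sup>+t. f t \<partial>restrict_space lborel {0..2 * pi}) = (\<integral>\<^sup>+t. f t * indicator {0<..<2 * pi} t \<partial>lborel)"
proof -
  have "(\<integral>\<^sup>+t. f t \<partial>restrict_space lborel {0..2 * pi}) = (\<integral>\<^sup>+t. f t * indicator {0..2 * pi} t \<partial>lborel)"
    by (rule nn_integral_restrict_space) simp
  also have "\<dots> = (\<integral>\<^sup>+t. f t * indicator {0<..<2 * pi} t \<partial>lborel)"
  proof (rule nn_integral_cong_AE)
    have "AE t in lborel. t \<noteq> 0" "AE t in lborel. t \<noteq> 2 * pi" by (auto intro: AE_lborel_singleton)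
    then show "AE t in lborel. f t * indicator {0..2 * pi} t = f t * indicator {0<..<2 * pi} t"
      by eventually_elim (auto simp: indicator_def)
  qed
  finally show ?thesis .
qed

text \<open>
  Monotone convergence for the nonnegative functions \<open>M - g\<^sub>k\<close>, which increase to \<open>M - u\<close>.
\<close>

lemma ereal_lower_limit_circle_mean:
  fixes u :: "complex \<Rightarrow> ereal" and g :: "nat \<Rightarrow> real \<Rightarrow> real"
  assumes g[measurable]: "\<And>k. g k \<in> borel_measurable borel"
    and dec: "\<And>k t. t \<in> {0<..<2 * pi} \<Longrightarrow> g (Suc k) t \<le> g k t"
    and lim: "\<And>t. t \<in> {0<..<2 * pi} \<Longrightarrow> u (cis t) = (INF k. ereal (g k t))"
    and M: "0 \<le> M" "\<And>k t. t \<in> {0<..<2 * pi} \<Longrightarrow> g k t \<le> M"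
    and bound: "\<And>k. (\<integral>\<^sup>+t. ennreal (M - g k t) * indicator {0<..<2 * pi} t \<partial>lborel) \<le> ennreal (2 * pi * (M - x))"
    and x: "x \<le> M"
  shows "ereal x \<le> circle_mean u 0 1"
proof -
  let ?S = "{0<..<2 * pi} :: real set"
  define U where "U t = (INF k. ereal (g k t))" for t
  have U[measurable]: "U \<in> borel_measurable borel" unfolding U_def by measurable
  define a where "a = (\<integral>\<^sup>+t. e2ennreal (U t) * indicator ?S t \<partial>lborel)"
  define b where "b = (\<integral>\<^sup>+t. e2ennreal (- U t) * indicator ?S t \<partial>lborel)"
  define c where "c = (\<integral>\<^sup>+t. e2ennreal (ereal M - U t) * indicator ?S t \<partial>lborel)"
  have UM: "U t \<le> ereal M" if "t \<in> ?S" for t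
    unfolding U_def by (rule INF_lower2[of 0]) (use M(2)[OF that] in auto)
  have sup: "(SUP k. ennreal (M - g k t) * indicator ?S t) = e2ennreal (ereal M - U t) * indicator ?S t" for t
  proof (cases "t \<in> ?S")
    case True
    have "(SUP k. ennreal (M - g k t)) = e2ennreal (ereal M - U t)"
    proof (rule antisym)
      show "(SUP k. ennreal (M - g k t)) \<le> e2ennreal (ereal M - U t)"
      proof (rule SUP_least)
        fix k
        have "U t \<le> ereal (g k t)" unfolding U_def by (rule INF_lower) simp
        then have "ereal (M - g k t) \<le> ereal M - U t"
          using ereal_minus_mono[of "ereal M" "ereal M" "U t" "ereal (g k t)"] by simp
        then have "e2ennreal (ereal (M - g k t)) \<le> e2ennreal (ereal M - U t)" by (rule e2ennreal_mono)
        then show "ennreal (M - g k t) \<le> e2ennreal (ereal M - U t)" by simp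
      qed
    next
      show "e2ennreal (ereal M - U t) \<le> (SUP k. ennreal (M - g k t))"
      proof (rule dense_le)
        fix y assume y: "y < e2ennreal (ereal M - U t)"
        then obtain r where r: "y = ennreal r" "r \<ge> 0"
          by (cases y) auto
        have "ereal r < ereal M - U t"
        proof (rule ccontr)
          assume "\<not> ?thesis"
          then have "e2ennreal (ereal M - U t) \<le> e2ennreal (ereal r)" by (intro e2ennreal_mono) simp
          then show False using y r by simp
        qed
        then have "U t < ereal (M - r)" by (cases "U t") auto
        then obtain k where "g k t < M - r" unfolding U_def by (auto simp: INF_less_iff)
        then have "y \<le> ennreal (M - g k t)" unfolding r(1) by (intro ennreal_leI) simp
        then show "y \<le> (SUP k. ennreal (M - g k t))" by (rule SUP_upper2[rotated]) simp
      qed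
    qed
    then show ?thesis using True by simp
  qed simp
  have "c = (\<integral>\<^sup>+t. (SUP k. ennreal (M - g k t) * indicator ?S t) \<partial>lborel)"
    unfolding c_def sup ..
  also have "\<dots> = (SUP k. \<integral>\<^sup>+t. ennreal (M - g k t) * indicator ?S t \<partial>lborel)"
  proof (rule nn_integral_monotone_convergence_SUP)
    show "incseq (\<lambda>k t. ennreal (M - g k t) * indicator ?S t)"
      by (rule incseq_SucI) (auto simp: le_fun_def indicator_def dec intro!: ennreal_leI)
  qed measurable
  also have "\<dots> \<le> ennreal (2 * pi * (M - x))" by (rule SUP_least) (rule bound)
  finally have c: "c \<le> ennreal (2 * pi * (M - x))" .
  have "a \<le> (\<integral>\<^sup>+t. ennreal M * indicator ?S t \<partial>lborel)"
    unfolding a_def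
  proof (rule nn_integral_mono)
    fix t
    show "e2ennreal (U t) * indicator ?S t \<le> ennreal M * indicator ?S t"
      using e2ennreal_mono[OF UM[of t]] by (auto simp: indicator_def)
  qed
  also have mass: "(\<integral>\<^sup>+t. ennreal M * indicator ?S t \<partial>lborel) = ennreal (2 * pi * M)"
    using M(1) by (simp add: nn_integral_cmult_indicator ennreal_mult[symmetric] mult.commute)
  finally have a: "a \<le> ennreal (2 * pi * M)" .
  have "c + a = (\<integral>\<^sup>+t. e2ennreal (ereal M - U t) * indicator ?S t + e2ennreal (U t) * indicator ?S t \<partial>lborel)"
    unfolding c_def a_def by (subst nn_integral_add) auto
  also have "\<dots> = (\<integral>\<^sup>+t. ennreal M * indicator ?S t + e2ennreal (- U t) * indicator ?S t \<partial>lborel)"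
    by (rule nn_integral_cong) (auto simp: indicator_def e2ennreal_balance[OF UM M(1)])
  also have "\<dots> = ennreal (2 * pi * M) + b"
    unfolding b_def by (subst nn_integral_add) (auto simp: mass)
  finally have bal: "c + a = ennreal (2 * pi * M) + b" .
  have "c < \<infinity>" "a < \<infinity>" using a c by (auto intro: le_less_trans)
  then have "c + a < \<infinity>" by simp
  then have "b < \<infinity>" unfolding bal by simp
  obtain cr where cr: "c = ennreal cr" "cr \<ge> 0" using \<open>c < \<infinity>\<close> by (cases c) auto
  obtain ar where ar: "a = ennreal ar" "ar \<ge> 0" using \<open>a < \<infinity>\<close> by (cases a) auto
  obtain br where br: "b = ennreal br" "br \<ge> 0" using \<open>b < \<infinity>\<close> by (cases b) auto
  have "cr + ar = 2 * pi * M + br"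
    using bal cr ar br M(1) by (simp add: ennreal_plus[symmetric] del: ennreal_plus)
  moreover have "cr \<le> 2 * pi * (M - x)" using c cr x by (simp add: ennreal_le_iff)
  ultimately have "2 * pi * x \<le> ar - br" by (simp add: algebra_simps)
  then have "x \<le> 1 / (2 * pi) * (ar - br)" by (simp add: field_simps)
  have Uu: "e2ennreal (u (cis t)) * indicator ?S t = e2ennreal (U t) * indicator ?S t"
    "e2ennreal (- u (cis t)) * indicator ?S t = e2ennreal (- U t) * indicator ?S t" for t
    using lim[of t] by (auto simp: indicator_def U_def)
  have "circle_mean u 0 1 = ereal (1 / (2 * pi)) * (enn2ereal a - enn2ereal b)"
    unfolding circle_mean_def ereal_integral_def nn_integral_circle_interval
    by (simp add: Uu a_def b_def)
  also have "\<dots> = ereal (1 / (2 * pi) * (ar - br))" using ar br by simp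
  finally show ?thesis using \<open>x \<le> 1 / (2 * pi) * (ar - br)\<close> by simp
qed

text \<open>
  On the circle \<open>u\<close> is an infimum over matrices \<open>T\<close>, and by openness of validity a countable dense set of
  matrices \<open>\<tau>\<^sub>0, \<tau>\<^sub>1, \<dots>\<close> is enough. Taking the minimum over the first \<open>k + 1\<close> of them gives functions \<open>g\<^sub>k\<close> that take
  finitely many values and decrease to \<open>u\<close>. For each of them the step function estimate provides
  a matrix polynomial \<open>F\<close> that is valid on the circle, hence, by the hypothesis \<open>cp\<close>, at the
  center.
\<close>

theorem ellipsoid_circle_mean:
  fixes valid :: "complex \<Rightarrow> complex ^ 'n::finite ^ 'n \<Rightarrow> bool" and u :: "complex \<Rightarrow> ereal" and b :: real
  assumes mono: "\<And>z T T'. valid z T \<Longrightarrow> (*v) T' ` cball 0 1 \<subseteq> (*v) T ` cball 0 1 \<Longrightarrow> valid z T'"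
    and op: "\<And>T. openin (top_of_set (sphere 0 1)) {z \<in> sphere 0 1. valid z T}"
    and op2: "\<And>z. cmod z = 1 \<Longrightarrow> open {T. valid z T}"
    and base: "\<epsilon> > 0" "\<And>z. cmod z = 1 \<Longrightarrow> valid z (mat (complex_of_real \<epsilon>))"
    and cp: "\<And>F. (\<And>z. cmod z = 1 \<Longrightarrow> valid z (poly_matrix F z)) \<Longrightarrow> valid 0 (poly_matrix F 0)"
    and U1: "\<And>z T. cmod z \<le> 1 \<Longrightarrow> det T \<noteq> 0 \<Longrightarrow> valid z T \<Longrightarrow> u z \<le> ereal (- 2 * ln (cmod (det T)) - b)"
    and U2: "\<And>z a. cmod z = 1 \<Longrightarrow> u z < ereal a \<Longrightarrow> \<exists>T. det T \<noteq> 0 \<and> valid z T \<and> - 2 * ln (cmod (det T)) - b < a"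
  shows "u 0 \<le> circle_mean u 0 1"
proof (cases "u 0 = - \<infinity>")
  case False
  let ?S = "{0<..<2 * pi} :: real set"
  obtain D :: "(complex ^ 'n ^ 'n) set" where D: "countable D" "\<And>W. open W \<Longrightarrow> W \<noteq> {} \<Longrightarrow> \<exists>T\<in>D. T \<in> W"
    using countable_dense_exists by blast
  define D' where "D' = insert (mat (complex_of_real \<epsilon>)) {T \<in> D. det T \<noteq> 0}"
  have D': "countable D'" "D' \<noteq> {}" "\<And>T. T \<in> D' \<Longrightarrow> det T \<noteq> 0"
    using D(1) base(1) by (auto simp: D'_def det_mat)
  define \<tau> where "\<tau> i = (case i of 0 \<Rightarrow> mat (complex_of_real \<epsilon>) | Suc j \<Rightarrow> from_nat_into D' j)" for i
  have det\<tau>: "det (\<tau> i) \<noteq> 0" for i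
    using D' base(1) from_nat_into[OF D'(2)] by (auto simp: \<tau>_def det_mat split: nat.split)
  have \<tau>D: "\<exists>i. T = \<tau> i" if "T \<in> D" "det T \<noteq> 0" for T
  proof -
    have "T \<in> D'" using that by (simp add: D'_def)
    then obtain j where "from_nat_into D' j = T" using from_nat_into_surj[OF D'(1)] by blast
    then have "T = \<tau> (Suc j)" by (simp add: \<tau>_def)
    then show ?thesis by blast
  qed
  define L where "L i = - 2 * ln (cmod (det (\<tau> i))) - b" for i
  define V where "V i = {t \<in> ?S. valid (cis t) (\<tau> i)}" for i
  have V0: "V 0 = ?S" using base(2) by (auto simp: V_def \<tau>_def)
  have Vb: "V i \<in> sets borel" for i
  proof -
    obtain O' where O': "open O'" "{z \<in> sphere 0 1. valid z (\<tau> i)} = sphere 0 1 \<inter> O'"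
      using op[of "\<tau> i"] by (auto simp: openin_open)
    have "V i = ?S \<inter> cis -` O'"
    proof -
      have "valid (cis t) (\<tau> i) \<longleftrightarrow> cis t \<in> O'" for t
      proof -
        have "cis t \<in> {z \<in> sphere 0 1. valid z (\<tau> i)} \<longleftrightarrow> cis t \<in> sphere 0 1 \<inter> O'" unfolding O'(2) ..
        then show ?thesis by simp
      qed
      then show ?thesis by (auto simp: V_def)
    qed
    moreover have "open (cis -` O')" by (intro open_vimage O'(1) continuous_intros)
    ultimately show ?thesis by simp
  qed
  have dense: "\<exists>i. t \<in> V i \<and> L i < a" if t: "t \<in> ?S" and ua: "u (cis t) < ereal a" for t a
  proof -
    let ?W = "{T. valid (cis t) T} \<inter> {T. exp (- (a + b) / 2) < cmod (det T)}"
    have ln_iff: "- 2 * ln (cmod (det T)) - b < a \<longleftrightarrow> exp (- (a + b) / 2) < cmod (det T)" if "det T \<noteq> 0" for T :: "complex ^ 'n ^ 'n"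
    proof -
      have aux: "- 2 * l - b < a \<longleftrightarrow> - (a + b) / 2 < l" for l :: real by (auto simp: field_simps)
      have "- 2 * ln (cmod (det T)) - b < a \<longleftrightarrow> - (a + b) / 2 < ln (cmod (det T))" by (rule aux)
      also have "\<dots> \<longleftrightarrow> exp (- (a + b) / 2) < cmod (det T)"
        using that by (metis exp_less_cancel_iff exp_ln zero_less_norm_iff)
      finally show ?thesis .
    qed
    have "open ?W"
      by (intro open_Int op2 open_Collect_less continuous_intros continuous_on_det) auto
    moreover obtain T where "det T \<noteq> 0" "valid (cis t) T" "- 2 * ln (cmod (det T)) - b < a"
      using U2[of "cis t" a] ua by auto
    then have "T \<in> ?W" using ln_iff[of T] by simp
    ultimately obtain T' where T': "T' \<in> D" "T' \<in> ?W" using D(2)[of ?W] by blast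
    have dT': "det T' \<noteq> 0" using T'(2) exp_gt_zero[of "- (a + b) / 2"] by (auto simp del: exp_gt_zero)
    then obtain i where i: "T' = \<tau> i" using \<tau>D T'(1) by blast
    have "t \<in> V i" using T'(2) t i by (simp add: V_def)
    moreover have "L i < a" using ln_iff[OF dT'] T'(2) i by (simp add: L_def)
    ultimately show ?thesis by blast
  qed
  \<comment> \<open>On \<open>A k i\<close> the minimum of the \<open>L j\<close> over the valid \<open>j \<le> k\<close> is attained at \<open>i\<close>;
    the smallest such index is chosen, which makes these sets disjoint.\<close>
  define A where "A k i = V i \<inter> (\<Inter>j\<in>{..k}. if L i < L j \<or> L i = L j \<and> i \<le> j then UNIV else - V j)" for k i :: nat
  have Ab: "A k i \<in> sets borel" for k i
    unfolding A_def by (intro sets.Int Vb sets.finite_INT) (auto intro: Vb borel_comp)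
  have Adisj: "A k i \<inter> A k j = {}" if "i \<le> k" "j \<le> k" "i \<noteq> j" for k i j
  proof (rule ccontr)
    assume "A k i \<inter> A k j \<noteq> {}"
    then obtain t where t: "t \<in> A k i" "t \<in> A k j" by blast
    then have Vt: "t \<in> V i" "t \<in> V j" by (auto simp: A_def)
    have "L i < L j \<or> L i = L j \<and> i \<le> j"
      using t(1) Vt(2) that(2) unfolding A_def by (auto split: if_splits)
    moreover have "L j < L i \<or> L j = L i \<and> j \<le> i"
      using t(2) Vt(1) that(1) unfolding A_def by (auto split: if_splits)
    ultimately show False using that(3) by auto
  qed
  have Aex: "\<exists>i\<le>k. t \<in> A k i" if t: "t \<in> ?S" for k t
  proof -
    define J where "J = {i. i \<le> k \<and> t \<in> V i}"
    have J: "finite J" "0 \<in> J" using t V0 by (auto simp: J_def)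
    define m where "m = Min (L ` J)"
    have "m \<in> L ` J" unfolding m_def by (rule Min_in) (use J in auto)
    then have J': "finite {i \<in> J. L i = m}" "{i \<in> J. L i = m} \<noteq> {}" using J(1) by auto
    define i where "i = Min {i \<in> J. L i = m}"
    have i: "i \<in> J" "L i = m" using Min_in[OF J'] by (auto simp: i_def)
    have "L i < L j \<or> L i = L j \<and> i \<le> j" if j: "j \<in> J" for j
    proof -
      have "m \<le> L j" unfolding m_def by (rule Min_le) (use J j in auto)
      moreover have "i \<le> j" if "L j = m" unfolding i_def by (rule Min_le) (use J'(1) j that in auto)
      ultimately show ?thesis using i(2) by force
    qed
    then have "t \<in> A k i" using i(1) unfolding A_def J_def by auto
    then show ?thesis using i(1) by (auto simp: J_def)
  qed
  have Asub: "A k i \<subseteq> ?S" for k i by (auto simp: A_def V_def)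
  have un: "(\<Union>i\<in>{..k}. A k i) = ?S" for k
  proof
    show "(\<Union>i\<in>{..k}. A k i) \<subseteq> ?S" using Asub by blast
    show "?S \<subseteq> (\<Union>i\<in>{..k}. A k i)"
    proof
      fix t assume "t \<in> ?S"
      then obtain i where "i \<le> k" "t \<in> A k i" using Aex by blast
      then show "t \<in> (\<Union>i\<in>{..k}. A k i)" by (intro UN_I[of i]) simp_all
    qed
  qed
  have Amin: "L i \<le> L j" if "t \<in> A k i" "j \<le> k" "t \<in> V j" for t k i j
    using that unfolding A_def by (auto split: if_splits)
  define g where "g k t = (\<Sum>i\<le>k. L i * indicator (A k i) t)" for k t
  have gA: "g k t = L i" if "t \<in> A k i" "i \<le> k" for k t i
  proof -
    have "g k t = (\<Sum>j\<le>k. if j = i then L i else 0)"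
      unfolding g_def using Adisj[of i k] that by (intro sum.cong) (auto simp: indicator_def)
    then show ?thesis using that(2) by simp
  qed
  have gV: "g k t \<le> L j" if "t \<in> ?S" "j \<le> k" "t \<in> V j" for k t j
    using Aex[OF that(1), of k] gA Amin that by metis
  have g_eq: "\<exists>i\<le>k. t \<in> V i \<and> g k t = L i" if t: "t \<in> ?S" for k t
  proof -
    obtain i where "i \<le> k" "t \<in> A k i" using Aex[OF t] by blast
    then show ?thesis using gA[of t k i] by (auto simp: A_def)
  qed
  \<comment> \<open>As \<open>\<tau> 0\<close> is valid on the whole circle, \<open>L 0\<close> bounds all \<open>g k\<close> from above.\<close>
  define M where "M = max 0 (max (L 0) (real_of_ereal (u 0)))"
  have M: "0 \<le> M" "L 0 \<le> M" "real_of_ereal (u 0) \<le> M" by (auto simp: M_def)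
  have gM: "g k t \<le> M" if "t \<in> ?S" for k t
    using gV[OF that, of 0 k] M(2) V0 that by simp
  have mean: "u 0 \<le> ereal (((\<Sum>i\<le>k. measure lebesgue (A k i) * L i) + 2 * e) / (2 * pi))" if e: "e > 0" for k e
  proof -
    have tot: "(\<Sum>i\<le>k. measure lebesgue (A k i)) = 2 * pi"
    proof -
      have fin: "emeasure lebesgue (A k i) \<noteq> \<infinity>" for i
      proof -
        have "emeasure lebesgue (A k i) \<le> emeasure lebesgue ?S" by (rule emeasure_mono[OF Asub]) simp
        then show ?thesis by (auto simp: top_unique)
      qed
      have "measure lebesgue (\<Union>i\<le>k. A k i) = (\<Sum>i\<le>k. measure lebesgue (A k i))"
        by (rule measure_finite_Union) (use Ab Adisj fin in \<open>auto simp: disjoint_family_on_def\<close>)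
      then show ?thesis unfolding un by simp
    qed
    obtain F where F: "\<And>z. cmod z \<le> 1 \<Longrightarrow> det (poly_matrix F z) \<noteq> 0"
      and Fv: "\<And>z. cmod z = 1 \<Longrightarrow> valid z (poly_matrix F z)"
      and Fm: "(\<Sum>i\<in>{..k}. measure lebesgue (A k i) * ln (cmod (det (\<tau> i)))) - e \<le> 2 * pi * ln (cmod (det (poly_matrix F 0)))"
    proof (rule ellipsoid_step_mean[of valid \<epsilon> "{..k}" \<tau> "A k" e, OF mono op base])
      show "(\<Union>i\<in>{..k}. A k i) = ?S" by (rule un)
      show "disjoint_family_on (A k) {..k}" using Adisj by (auto simp: disjoint_family_on_def)
      show "valid (cis t) (\<tau> i)" if "t \<in> A k i" for i t using that by (auto simp: A_def V_def)
    qed (use det\<tau> Ab e in auto)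
    have "u 0 \<le> ereal (- 2 * ln (cmod (det (poly_matrix F 0))) - b)"
      by (rule U1[OF _ _ cp]) (use F Fv in auto)
    also have "- 2 * ln (cmod (det (poly_matrix F 0))) - b \<le>
        ((\<Sum>i\<le>k. measure lebesgue (A k i) * L i) + 2 * e) / (2 * pi)"
    proof -
      have "(\<Sum>i\<le>k. measure lebesgue (A k i) * L i) =
          - 2 * (\<Sum>i\<le>k. measure lebesgue (A k i) * ln (cmod (det (\<tau> i)))) - b * (\<Sum>i\<le>k. measure lebesgue (A k i))"
        unfolding sum_distrib_left sum_subtractf[symmetric] by (rule sum.cong) (auto simp: L_def algebra_simps)
      then have "(\<Sum>i\<le>k. measure lebesgue (A k i) * L i) =
          - 2 * (\<Sum>i\<le>k. measure lebesgue (A k i) * ln (cmod (det (\<tau> i)))) - b * (2 * pi)" unfolding tot .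
      then have "(- 2 * ln (cmod (det (poly_matrix F 0))) - b) * (2 * pi) \<le> (\<Sum>i\<le>k. measure lebesgue (A k i) * L i) + 2 * e"
        using Fm by (simp add: algebra_simps)
      then show ?thesis by (simp add: pos_le_divide_eq)
    qed
    finally show ?thesis by simp
  qed
  have "u 0 \<noteq> \<infinity>" using mean[of 1 0] by auto
  then obtain x where x: "u 0 = ereal x" using False by (cases "u 0") auto
  have xM: "x \<le> M" using M(3) x by simp
  have "ereal x \<le> circle_mean u 0 1"
  proof (rule ereal_lower_limit_circle_mean[of g])
    show "g k \<in> borel_measurable borel" for k
      unfolding g_def using Ab by (intro borel_measurable_sum borel_measurable_times borel_measurable_indicator) auto
    show "g (Suc k) t \<le> g k t" if t: "t \<in> ?S" for k t
    proof -
      obtain i where "i \<le> k" "t \<in> V i" "g k t = L i" using g_eq[OF t] by blast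
      then show ?thesis using gV[OF t, of i "Suc k"] by simp
    qed
    show "u (cis t) = (INF k. ereal (g k t))" if t: "t \<in> ?S" for t
    proof (rule antisym)
      show "u (cis t) \<le> (INF k. ereal (g k t))"
      proof (rule INF_greatest)
        fix k
        obtain i where i: "t \<in> V i" "g k t = L i" using g_eq[OF t] by blast
        have "u (cis t) \<le> ereal (- 2 * ln (cmod (det (\<tau> i))) - b)"
          by (rule U1) (use i(1) det\<tau> in \<open>auto simp: V_def\<close>)
        then show "u (cis t) \<le> ereal (g k t)" by (simp add: i(2) L_def)
      qed
      show "(INF k. ereal (g k t)) \<le> u (cis t)"
      proof (rule dense_ge)
        fix y assume "u (cis t) < y"
        then obtain a where a: "u (cis t) < ereal a" "ereal a < y" using ereal_dense2 by blast
        obtain i where i: "t \<in> V i" "L i < a" using dense[OF t a(1)] by blast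
        have "(INF k. ereal (g k t)) \<le> ereal (g i t)" by (rule INF_lower) simp
        also have "\<dots> \<le> ereal a" using gV[OF t, of i i] i by simp
        finally show "(INF k. ereal (g k t)) \<le> y" using a(2) by simp
      qed
    qed
    show "(\<integral>\<^sup>+t. ennreal (M - g k t) * indicator ?S t \<partial>lborel) \<le> ennreal (2 * pi * (M - x))" for k
    proof -
      define mu where "mu i = measure lebesgue (A k i)" for i
      note sub = Asub[of k]
      have emu: "emeasure lborel (A k i) = ennreal (mu i)" for i
      proof -
        have "emeasure lborel (A k i) \<le> emeasure lborel ?S" by (rule emeasure_mono[OF sub]) simp
        then have "emeasure lborel (A k i) \<noteq> \<infinity>" by (auto simp: top_unique)
        then show ?thesis using Ab[of k i] by (simp add: mu_def emeasure_eq_ennreal_measure)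
      qed
      have tot: "(\<Sum>i\<le>k. mu i) = 2 * pi"
      proof -
        have "measure lborel (\<Union>i\<le>k. A k i) = (\<Sum>i\<le>k. measure lborel (A k i))"
          by (rule measure_finite_Union) (use Ab Adisj emu in \<open>auto simp: disjoint_family_on_def\<close>)
        then show ?thesis unfolding un using Ab by (simp add: mu_def)
      qed
      have nonneg: "0 \<le> mu i * (M - L i)" if "i \<le> k" for i
      proof (cases "A k i = {}")
        case False
        then obtain t where t: "t \<in> A k i" by blast
        then have "L i \<le> L 0" using Amin[OF t, of 0] V0 sub[of i] by auto
        then show ?thesis using M(2) by (simp add: mu_def)
      qed (simp add: mu_def)
      have "(\<integral>\<^sup>+t. ennreal (M - g k t) * indicator ?S t \<partial>lborel) =
          (\<integral>\<^sup>+t. (\<Sum>i\<le>k. ennreal (M - L i) * indicator (A k i) t) \<partial>lborel)"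
      proof (rule nn_integral_cong)
        fix t
        show "ennreal (M - g k t) * indicator ?S t = (\<Sum>i\<le>k. ennreal (M - L i) * indicator (A k i) t)"
        proof (cases "t \<in> ?S")
          case True
          obtain i where i: "i \<le> k" "t \<in> A k i" using Aex[OF True] by blast
          have "(\<Sum>j\<le>k. ennreal (M - L j) * indicator (A k j) t) = (\<Sum>j\<le>k. if j = i then ennreal (M - L i) else 0)"
            using Adisj[of i k] i by (intro sum.cong) (auto simp: indicator_def)
          then show ?thesis using True i gA[OF i(2,1)] by simp
        next
          case False
          then have "t \<notin> A k i" for i using sub by blast
          then show ?thesis using False by simp
        qed
      qed
      also have "\<dots> = (\<Sum>i\<le>k. ennreal (M - L i) * emeasure lborel (A k i))"
        using Ab by (subst nn_integral_sum) (auto simp: nn_integral_cmult_indicator)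
      also have "\<dots> = (\<Sum>i\<le>k. ennreal (mu i * (M - L i)))"
        unfolding emu by (rule sum.cong) (auto simp: mult.commute ennreal_mult'' mu_def)
      also have "\<dots> = ennreal (\<Sum>i\<le>k. mu i * (M - L i))" by (rule sum_ennreal) (use nonneg in auto)
      also have "(\<Sum>i\<le>k. mu i * (M - L i)) = 2 * pi * M - (\<Sum>i\<le>k. mu i * L i)"
        unfolding tot[symmetric] by (simp add: sum_distrib_right right_diff_distrib sum_subtractf)
      also have "ennreal (2 * pi * M - (\<Sum>i\<le>k. mu i * L i)) \<le> ennreal (2 * pi * (M - x))"
      proof (rule ennreal_leI)
        have "2 * pi * x \<le> (\<Sum>i\<le>k. mu i * L i)"
        proof (rule field_le_epsilon)
          fix e :: real assume e: "e > 0"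
          have "x \<le> ((\<Sum>i\<le>k. mu i * L i) + e) / (2 * pi)"
            using mean[of "e / 2" k] e x by (simp add: mu_def)
          then show "2 * pi * x \<le> (\<Sum>i\<le>k. mu i * L i) + e" by (simp add: pos_le_divide_eq mult.commute)
        qed
        then show "2 * pi * M - (\<Sum>i\<le>k. mu i * L i) \<le> 2 * pi * (M - x)" by (simp add: algebra_simps)
      qed
      finally show ?thesis .
    qed
  qed (use M gM xM in auto)
  then show ?thesis by (simp add: x)
qed simp

section \<open>The continuity principle\<close>

text \<open>
  Projection along a compact space is a closed map.
\<close>

lemma openin_tube:
  assumes Y: "openin (prod_topology T K) Y" and K: "compact_space K"
  shows "openin T {s \<in> topspace T. \<forall>k\<in>topspace K. (s, k) \<in> Y}"
proof -
  have "closed_map (prod_topology T K) T fst" using K by (rule closed_map_fst)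
  moreover have "closedin (prod_topology T K) (topspace (prod_topology T K) - Y)"
    using Y by (rule closedin_diff[OF closedin_topspace])
  ultimately have "closedin T (fst ` (topspace (prod_topology T K) - Y))" by (simp add: closed_map_def)
  then have "openin T (topspace T - fst ` (topspace (prod_topology T K) - Y))" by (simp add: openin_diff)
  also have "topspace T - fst ` (topspace (prod_topology T K) - Y) = {s \<in> topspace T. \<forall>k\<in>topspace K. (s, k) \<in> Y}"
    by (force simp: image_iff)
  finally show ?thesis .
qed

lemma chart_properties:
  assumes "is_chart S (U, \<phi>)"
  shows "U \<subseteq> topspace S" "inj_on \<phi> U" "continuous_map (top_of_set (\<phi> ` U)) S (inv_into U \<phi>)"
    "homeomorphic_map (subtopology S U) (top_of_set (\<phi> ` U)) \<phi>" "openin S U"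
proof -
  show U: "openin S U" and hom: "homeomorphic_map (subtopology S U) (top_of_set (\<phi> ` U)) \<phi>"
    using assms by (auto simp: is_chart_def)
  show sub: "U \<subseteq> topspace S" using U by (rule openin_subset)
  have tU: "topspace (subtopology S U) = U" using sub by auto
  show inj: "inj_on \<phi> U" using homeomorphic_imp_injective_map[OF hom] tU by simp
  obtain g where g: "homeomorphic_maps (subtopology S U) (top_of_set (\<phi> ` U)) \<phi> g"
    using hom by (auto simp: homeomorphic_map_maps)
  then have "continuous_map (top_of_set (\<phi> ` U)) (subtopology S U) g" by (simp add: homeomorphic_maps_def)
  then have "continuous_map (top_of_set (\<phi> ` U)) S g" by (simp add: continuous_map_in_subtopology)
  moreover have "g y = inv_into U \<phi> y" if y: "y \<in> topspace (top_of_set (\<phi> ` U))" for y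
  proof -
    obtain s where s: "s \<in> U" "y = \<phi> s" using y by auto
    then have "g y = s" using g tU by (auto simp: homeomorphic_maps_def)
    then show ?thesis using s inj by simp
  qed
  ultimately show "continuous_map (top_of_set (\<phi> ` U)) S (inv_into U \<phi>)" by (rule continuous_map_eq)
qed

lemma has_derivative_poly_vector:
  fixes Q :: "'k::finite \<Rightarrow> complex poly"
  shows "((\<lambda>\<zeta>. \<chi> k. poly (Q k) \<zeta>) has_derivative (\<lambda>v. v *s (\<chi> k. poly (pderiv (Q k)) z))) (at z within S)"
proof (rule has_derivative_componentwise_within[THEN iffD2], rule ballI)
  fix b :: "complex ^ 'k" assume "b \<in> Basis"
  then obtain k c where b: "b = axis k c" by (auto simp: Basis_vec_def)
  have "(poly (Q k) has_derivative (\<lambda>v. poly (pderiv (Q k)) z * v)) (at z within S)"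
    using poly_DERIV[of "Q k" z] by (simp add: has_field_derivative_def has_derivative_at_withinI)
  then have "((\<lambda>\<zeta>. inner (poly (Q k) \<zeta>) c) has_derivative (\<lambda>v. inner (poly (pderiv (Q k)) z * v) c)) (at z within S)"
    by (rule has_derivative_inner_left)
  then show "((\<lambda>\<zeta>. inner (\<chi> k. poly (Q k) \<zeta>) b) has_derivative (\<lambda>v. inner (v *s (\<chi> k. poly (pderiv (Q k)) z)) b)) (at z within S)"
    unfolding b by (simp add: inner_axis mult.commute)
qed

text \<open>
  The derivative of \<open>g\<close> is taken within \<open>D\<close>, which may be a piece of a proper coordinate subspace;
  since the curve stays in \<open>D\<close>, the chain rule within sets applies.
\<close>

lemma holomorphic_fun_on_compose_poly_vector:
  fixes Q :: "'k::finite \<Rightarrow> complex poly"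
  assumes g: "holomorphic_fun_on g D" and D: "\<And>z. z \<in> B \<Longrightarrow> (\<chi> k. poly (Q k) z) \<in> D"
  shows "(\<lambda>z. g (\<chi> k. poly (Q k) z)) holomorphic_on B"
  unfolding holomorphic_on_def
proof
  fix z assume z: "z \<in> B"
  let ?\<gamma> = "\<lambda>z. \<chi> k. poly (Q k) z"
  let ?d = "\<chi> k. poly (pderiv (Q k)) z"
  obtain f' where f': "(g has_derivative f') (at (?\<gamma> z) within D)" "\<And>c v. f' (c *s v) = c * f' v"
    using g D[OF z] unfolding holomorphic_fun_on_def by blast
  have "(g has_derivative f') (at (?\<gamma> z) within ?\<gamma> ` B)"
    by (rule has_derivative_subset[OF f'(1)]) (use D in auto)
  then have "((g \<circ> ?\<gamma>) has_derivative (f' \<circ> (\<lambda>v. v *s ?d))) (at z within B)"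
    by (rule diff_chain_within[OF has_derivative_poly_vector])
  moreover have "f' \<circ> (\<lambda>v. v *s ?d) = (*) (f' ?d)" by (auto simp: f'(2))
  ultimately have "((\<lambda>z. g (?\<gamma> z)) has_field_derivative f' ?d) (at z within B)"
    by (simp add: has_field_derivative_def comp_def)
  then show "(\<lambda>z. g (?\<gamma> z)) field_differentiable (at z within B)" by (auto simp: field_differentiable_def)
qed

text \<open>
  In the product chart the disc is a polynomial curve, so along it a holomorphic function on \<open>X\<close>
  becomes a holomorphic function of one variable.
\<close>

lemma maximum_modulus_on_disc:
  fixes \<phi> :: "'s \<Rightarrow> complex ^ 'm::finite" and q :: "'n::finite \<Rightarrow> complex poly"
  assumes f: "holomorphic_on_manifold (restrict_atlas (times_vec_atlas A) X) f"
    and chart: "(U, \<phi>) \<in> A" and inj: "inj_on \<phi> U"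
    and disc: "\<And>\<zeta>. cmod \<zeta> \<le> 1 \<Longrightarrow> a + \<zeta> *s w \<in> \<phi> ` U"
    and inX: "\<And>\<zeta>. cmod \<zeta> \<le> 1 \<Longrightarrow> (inv_into U \<phi> (a + \<zeta> *s w), \<chi> j. poly (q j) \<zeta>) \<in> X"
    and bd: "\<And>\<zeta>. cmod \<zeta> = 1 \<Longrightarrow> cmod (f (inv_into U \<phi> (a + \<zeta> *s w), \<chi> j. poly (q j) \<zeta>)) \<le> c"
    and z: "cmod \<zeta> \<le> 1"
  shows "cmod (f (inv_into U \<phi> (a + \<zeta> *s w), \<chi> j. poly (q j) \<zeta>)) \<le> c"
proof -
  define p where "p \<zeta> = (inv_into U \<phi> (a + \<zeta> *s w), \<chi> j. poly (q j) \<zeta>)" for \<zeta>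
  define V where "V = (U \<times> UNIV) \<inter> X"
  define \<Phi> where "\<Phi> = (\<lambda>(s, x). vec_append (\<phi> s) (x :: complex ^ 'n))"
  have "(V, \<Phi>) \<in> restrict_atlas (times_vec_atlas A) X"
    unfolding restrict_atlas_def times_vec_atlas_def V_def \<Phi>_def using chart by force
  then have hol: "holomorphic_fun_on (f \<circ> inv_into V \<Phi>) (\<Phi> ` V)"
    using f unfolding holomorphic_on_manifold_def by blast
  have va: "vec_append x y = vec_append x' y' \<longleftrightarrow> x = x' \<and> y = y'" for x x' :: "complex ^ 'm" and y y' :: "complex ^ 'n"
  proof
    assume eq: "vec_append x y = vec_append x' y'"
    have "x $ i = x' $ i" for i using arg_cong[OF eq, of "\<lambda>v. v $ Inl i"] by (simp add: vec_append_def)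
    moreover have "y $ i = y' $ i" for i using arg_cong[OF eq, of "\<lambda>v. v $ Inr i"] by (simp add: vec_append_def)
    ultimately show "x = x' \<and> y = y'" by (simp add: vec_eq_iff)
  qed simp
  have injV: "inj_on \<Phi> V"
  proof (rule inj_onI)
    fix y y' assume y: "y \<in> V" "y' \<in> V" "\<Phi> y = \<Phi> y'"
    obtain s x s' x' where e: "y = (s, x)" "y' = (s', x')" by (cases y, cases y') blast
    have "\<phi> s = \<phi> s'" "x = x'" using y(3) unfolding e \<Phi>_def by (simp_all only: case_prod_conv va)
    moreover have "s \<in> U" "s' \<in> U" using y(1,2) unfolding e V_def by blast+
    ultimately show "y = y'" unfolding e using inj_onD[OF inj] by blast
  qed
  define Q where "Q k = (case k of Inl i \<Rightarrow> [:a $ i, w $ i:] | Inr j \<Rightarrow> q j)" for k :: "'m + 'n"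
  have pV: "p \<zeta> \<in> V" and \<Phi>p: "\<Phi> (p \<zeta>) = (\<chi> k. poly (Q k) \<zeta>)" if "cmod \<zeta> \<le> 1" for \<zeta>
  proof -
    show "p \<zeta> \<in> V" using inX[OF that] disc[OF that] by (auto simp: p_def V_def inv_into_into)
    have "\<phi> (inv_into U \<phi> (a + \<zeta> *s w)) = a + \<zeta> *s w" by (rule f_inv_into_f[OF disc[OF that]])
    then show "\<Phi> (p \<zeta>) = (\<chi> k. poly (Q k) \<zeta>)"
      by (simp add: p_def \<Phi>_def vec_append_def vec_eq_iff Q_def split: sum.split)
  qed
  have "(\<lambda>z. (f \<circ> inv_into V \<Phi>) (\<chi> k. poly (Q k) z)) holomorphic_on cball 0 1"
  proof (rule holomorphic_fun_on_compose_poly_vector[OF hol])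
    fix z :: complex assume "z \<in> cball 0 1"
    then have "cmod z \<le> 1" by simp
    then show "(\<chi> k. poly (Q k) z) \<in> \<Phi> ` V" using pV[of z] \<Phi>p[of z] by (metis imageI)
  qed
  then have h: "(\<lambda>z. f (p z)) holomorphic_on cball 0 1"
    by (rule holomorphic_transform) (use pV \<Phi>p injV in \<open>simp flip: \<Phi>p\<close>)
  have "cmod (f (p \<zeta>)) \<le> c"
  proof (rule maximum_modulus_frontier[of "\<lambda>z. f (p z)" "cball 0 1"])
    show "(\<lambda>z. f (p z)) holomorphic_on interior (cball 0 1)"
      by (rule holomorphic_on_subset[OF h]) (rule interior_subset)
    show "continuous_on (closure (cball 0 1)) (\<lambda>z. f (p z))"
      using holomorphic_on_imp_continuous_on[OF h] by simp
    show "cmod (f (p z)) \<le> c" if "z \<in> frontier (cball 0 1)" for z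
      using that bd[of z] by (simp add: p_def)
  qed (use z in auto)
  then show ?thesis by (simp add: p_def)
qed

lemma continuous_disc:
  assumes chart: "is_chart S (U, \<phi>)" and disc: "\<And>\<zeta>. \<zeta> \<in> B \<Longrightarrow> a + \<zeta> *s w \<in> \<phi> ` U"
  shows "continuous_map (top_of_set B) S (\<lambda>\<zeta>. inv_into U \<phi> (a + \<zeta> *s w))"
proof -
  have "continuous_map (top_of_set B) (top_of_set (\<phi> ` U)) (\<lambda>\<zeta>. a + \<zeta> *s w)"
    unfolding continuous_map_in_subtopology
  proof
    have "continuous_on B (\<lambda>\<zeta>. \<chi> i. a $ i + \<zeta> * w $ i)"
      by (intro continuous_on_vec_lambda continuous_intros)
    also have "(\<lambda>\<zeta>. \<chi> i. a $ i + \<zeta> * w $ i) = (\<lambda>\<zeta>. a + \<zeta> *s w)" by (simp add: vec_eq_iff fun_eq_iff)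
    finally show "continuous_map (top_of_set B) euclidean (\<lambda>\<zeta>. a + \<zeta> *s w)" by simp
    show "(\<lambda>\<zeta>. a + \<zeta> *s w) \<in> topspace (top_of_set B) \<rightarrow> \<phi> ` U" using disc by simp
  qed
  from continuous_map_compose[OF this chart_properties(3)[OF chart]] show ?thesis by (simp add: comp_def)
qed

text \<open>
  For \<open>0 \<le> t \<le> 1\<close> consider the disc \<open>\<zeta> \<mapsto> (\<sigma> \<zeta>, t F(\<zeta>) x)\<close>. The set of those \<open>t\<close> for which it lies in \<open>X\<close>
  contains \<open>0\<close> and is open by compactness of the disc. It is also closed: by the maximum principle it is
  the set of those \<open>t\<close> for which the disc lies in the holomorphic hull of the compact set swept out by the
  boundaries of the discs, and this hull is compact because \<open>X\<close> is Stein.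
\<close>

lemma continuity_principle:
  fixes S :: "'s topology" and A :: "('s, 'm::finite) chart set" and X :: "('s \<times> (complex ^ 'n::finite)) set"
  assumes man: "complex_manifold S A" and fam: "pseudoconvex_family S A X" and chart: "(U, \<phi>) \<in> A"
    and disc: "\<And>\<zeta>. cmod \<zeta> \<le> 1 \<Longrightarrow> a + \<zeta> *s w \<in> \<phi> ` U"
    and bd: "\<And>\<zeta> x. cmod \<zeta> = 1 \<Longrightarrow> norm x \<le> 1 \<Longrightarrow> (inv_into U \<phi> (a + \<zeta> *s w), poly_matrix F \<zeta> *v x) \<in> X"
    and x: "norm x \<le> 1" and z: "cmod \<zeta> \<le> 1"
  shows "(inv_into U \<phi> (a + \<zeta> *s w), poly_matrix F \<zeta> *v x) \<in> X"
proof -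
  let ?XT = "prod_topology S (euclidean :: (complex ^ 'n) topology)"
  have ic: "is_chart S (U, \<phi>)" using man chart unfolding complex_manifold_def by blast
  note cp = chart_properties[OF ic]
  have openX: "openin ?XT X" and zeroX: "topspace S \<times> {0} \<subseteq> X"
    using fam by (auto simp: pseudoconvex_family_def family_of_pseudoconvex_sets_def)
  have stein: "stein_manifold (subtopology ?XT X) (restrict_atlas (times_vec_atlas A) X)"
    using fam by (simp add: pseudoconvex_family_def)
  have haus: "Hausdorff_space ?XT" using man by (simp add: complex_manifold_def Hausdorff_space_prod_topology)
  define \<sigma> where "\<sigma> \<zeta> = inv_into U \<phi> (a + \<zeta> *s w)" for \<zeta>
  define v where "v t \<zeta> = t *\<^sub>R (poly_matrix F \<zeta> *v x)" for t :: real and \<zeta>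
  define q where "q t j = (\<Sum>i\<in>UNIV. smult (of_real t * x $ i) (F j i))" for t :: real and j
  have v: "v t \<zeta> = (\<chi> j. poly (q t j) \<zeta>)" for t \<zeta>
    by (simp add: v_def vec_eq_iff q_def poly_sum poly_matrix_def matrix_vector_mult_def scaleR_conv_of_real[where 'a = complex] sum_distrib_left ac_simps)
  define p where "p = (\<lambda>(t, \<zeta>). (\<sigma> \<zeta>, v t \<zeta>))"
  let ?I = "{0..1::real}" and ?B = "cball (0::complex) 1"
  have \<sigma>S: "\<sigma> \<zeta> \<in> topspace S" if "\<zeta> \<in> ?B" for \<zeta>
    using cp(1) inv_into_into[OF disc[of \<zeta>]] that by (auto simp: \<sigma>_def)
  have c\<sigma>: "continuous_map (top_of_set ?B) S \<sigma>"
    unfolding \<sigma>_def by (rule continuous_disc[OF ic]) (use disc in auto)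
  have cpq: "continuous_map (prod_topology (top_of_set ?I) (top_of_set ?B)) ?XT p"
    unfolding p_def case_prod_beta
  proof (rule continuous_map_pairedI)
    show "continuous_map (prod_topology (top_of_set ?I) (top_of_set ?B)) S (\<lambda>x. \<sigma> (snd x))"
      using continuous_map_compose[OF continuous_map_snd c\<sigma>] by (simp only: comp_def)
    show "continuous_map (prod_topology (top_of_set ?I) (top_of_set ?B)) euclidean (\<lambda>x. v (fst x) (snd x))"
      unfolding v_def poly_matrix_def matrix_vector_mult_def
      by (simp, intro continuous_intros continuous_on_vec_lambda)
  qed
  have tp: "topspace (prod_topology (top_of_set ?I) (top_of_set ?B)) = ?I \<times> ?B" by simp
  define K where "K = p ` (?I \<times> sphere 0 1)"
  have "compactin (prod_topology (top_of_set ?I) (top_of_set ?B)) (?I \<times> sphere 0 1)"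
    by (auto simp: compactin_subtopology intro!: compact_Times)
  then have "compactin ?XT K" unfolding K_def by (rule image_compactin[OF _ cpq])
  moreover have KX: "K \<subseteq> X"
  proof
    fix y assume "y \<in> K"
    then obtain t \<zeta> where y: "y = (\<sigma> \<zeta>, v t \<zeta>)" "0 \<le> t" "t \<le> 1" "cmod \<zeta> = 1" by (auto simp: K_def p_def)
    have "v t \<zeta> = poly_matrix F \<zeta> *v (t *\<^sub>R x)"
      unfolding v_def by (rule linear_scale[OF linear_complex_matrix, symmetric])
    moreover have "norm (t *\<^sub>R x) \<le> 1" using x y(2,3) by (simp add: mult_le_one)
    ultimately show "y \<in> X" using bd[OF y(4), of "t *\<^sub>R x"] y(1) by (simp add: \<sigma>_def)
  qed
  ultimately have "compactin (subtopology ?XT X) K" by (simp add: compactin_subtopology)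
  define H where "H = holomorphic_hull (subtopology ?XT X) (restrict_atlas (times_vec_atlas A) X) K"
  have "compactin (subtopology ?XT X) H"
    using stein \<open>compactin (subtopology ?XT X) K\<close> unfolding stein_manifold_def H_def by blast
  then have HX: "H \<subseteq> X" and "compactin ?XT H" by (simp_all add: compactin_subtopology)
  then have Hcl: "closedin ?XT H" using haus by (simp add: compactin_imp_closedin)
  define G where "G = {t \<in> ?I. \<forall>\<zeta>\<in>?B. p (t, \<zeta>) \<in> X}"
  have GH: "p (t, \<zeta>) \<in> H" if t: "t \<in> G" and \<zeta>: "\<zeta> \<in> ?B" for t \<zeta>
  proof -
    have inX: "(\<sigma> \<zeta>, \<chi> j. poly (q t j) \<zeta>) \<in> X" if "cmod \<zeta> \<le> 1" for \<zeta>
      using t that unfolding G_def p_def v by auto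
    have "cmod (f (p (t, \<zeta>))) \<le> c" if f: "holomorphic_on_manifold (restrict_atlas (times_vec_atlas A) X) f"
      and c: "\<forall>y\<in>K. cmod (f y) \<le> c" for f c
    proof -
      have "cmod (f (\<sigma> \<zeta>, \<chi> j. poly (q t j) \<zeta>)) \<le> c"
        unfolding \<sigma>_def
      proof (rule maximum_modulus_on_disc[OF f chart cp(2) disc])
        show "(inv_into U \<phi> (a + \<zeta> *s w), \<chi> j. poly (q t j) \<zeta>) \<in> X" if "cmod \<zeta> \<le> 1" for \<zeta>
          using inX[OF that] by (simp add: \<sigma>_def)
        show "cmod (f (inv_into U \<phi> (a + \<zeta> *s w), \<chi> j. poly (q t j) \<zeta>)) \<le> c" if "cmod \<zeta> = 1" for \<zeta>
        proof -
          have "p (t, \<zeta>) \<in> K" unfolding K_def using t that by (auto simp: G_def)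
          then show ?thesis using c by (auto simp: p_def v \<sigma>_def)
        qed
      qed (use \<zeta> in auto)
      then show ?thesis by (simp add: p_def v)
    qed
    moreover have "p (t, \<zeta>) \<in> X" using t \<zeta> by (simp add: G_def)
    moreover have "p (t, \<zeta>) \<in> topspace ?XT" using \<sigma>S[OF \<zeta>] by (simp add: p_def)
    ultimately show ?thesis unfolding H_def holomorphic_hull_def by simp
  qed
  have "openin (top_of_set ?I) G"
  proof -
    have "openin (prod_topology (top_of_set ?I) (top_of_set ?B)) {y \<in> ?I \<times> ?B. p y \<in> X}"
      using openin_continuous_map_preimage[OF cpq openX] unfolding tp .
    from openin_tube[OF this] have "openin (top_of_set ?I) {t \<in> ?I. \<forall>\<zeta>\<in>?B. (t, \<zeta>) \<in> {y \<in> ?I \<times> ?B. p y \<in> X}}"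
      by (simp add: compact_space_subtopology)
    also have "{t \<in> ?I. \<forall>\<zeta>\<in>?B. (t, \<zeta>) \<in> {y \<in> ?I \<times> ?B. p y \<in> X}} = G" by (auto simp: G_def)
    finally show ?thesis .
  qed
  moreover have "closedin (top_of_set ?I) G"
  proof -
    have "G = \<Inter> ((\<lambda>\<zeta>. {t \<in> ?I. p (t, \<zeta>) \<in> H}) ` ?B)"
    proof (intro equalityI subsetI)
      fix t assume "t \<in> \<Inter> ((\<lambda>\<zeta>. {t \<in> ?I. p (t, \<zeta>) \<in> H}) ` ?B)"
      then have "t \<in> ?I" "\<And>\<zeta>. \<zeta> \<in> ?B \<Longrightarrow> p (t, \<zeta>) \<in> H" by (auto dest: bspec[of _ _ 0])
      then show "t \<in> G" using HX by (auto simp: G_def)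
    next
      fix t assume t: "t \<in> G"
      then have "t \<in> ?I" by (simp add: G_def)
      then show "t \<in> \<Inter> ((\<lambda>\<zeta>. {t \<in> ?I. p (t, \<zeta>) \<in> H}) ` ?B)" using GH[OF t] by blast
    qed
    moreover have "closedin (top_of_set ?I) (\<Inter> ((\<lambda>\<zeta>. {t \<in> ?I. p (t, \<zeta>) \<in> H}) ` ?B))"
    proof (rule closedin_Inter)
      fix Z assume "Z \<in> (\<lambda>\<zeta>. {t \<in> ?I. p (t, \<zeta>) \<in> H}) ` ?B"
      then obtain \<zeta> where \<zeta>: "\<zeta> \<in> ?B" and Z: "Z = {t \<in> ?I. p (t, \<zeta>) \<in> H}" by blast
      have "continuous_map (top_of_set ?I) (prod_topology (top_of_set ?I) (top_of_set ?B)) (\<lambda>t. (t, \<zeta>))"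
        using \<zeta> by (intro continuous_map_pairedI) auto
      from continuous_map_compose[OF this cpq] have "continuous_map (top_of_set ?I) ?XT (\<lambda>t. p (t, \<zeta>))"
        by (simp add: comp_def)
      from closedin_continuous_map_preimage[OF this Hcl] show "closedin (top_of_set ?I) Z" by (simp add: Z)
    qed auto
    ultimately show ?thesis by simp
  qed
  moreover have "0 \<in> G"
    using zeroX \<sigma>S by (auto simp: G_def p_def v_def)
  moreover have "connected ?I" by simp
  ultimately have "G = ?I" unfolding connected_clopen by blast
  then have "1 \<in> G" by simp
  then show ?thesis using z by (auto simp: G_def p_def v_def \<sigma>_def)
qed

section \<open>Ellipsoids in the fibers of a family\<close>

lemma hermitian_ellipsoid_iff:
  fixes E :: "(complex ^ 'n::finite) set"
  shows "E \<in> hermitian_ellipsoids \<longleftrightarrow> (\<exists>T. det T \<noteq> 0 \<and> E = (*v) T ` ball 0 1)"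
proof
  assume "E \<in> hermitian_ellipsoids"
  then obtain f :: "complex ^ 'n \<Rightarrow> complex ^ 'n" where f: "Vector_Spaces.linear (*s) (*s) f" "bij f" "E = f ` ball 0 1"
    unfolding hermitian_ellipsoids_def by blast
  have eq: "(*v) (matrix f) = f" using matrix_works[OF f(1)] by (rule ext)
  then have "det (matrix f) \<noteq> 0"
    using f(2) invertible_eq_bij[of "matrix f"] by (simp add: invertible_det_nz)
  then show "\<exists>T. det T \<noteq> 0 \<and> E = (*v) T ` ball 0 1" using eq f(3) by (intro exI[of _ "matrix f"]) simp
next
  assume "\<exists>T. det T \<noteq> 0 \<and> E = (*v) T ` ball 0 1"
  then obtain T where T: "det T \<noteq> 0" "E = (*v) T ` ball 0 1" by blast
  have "Vector_Spaces.linear (*s) (*s) ((*v) T)" by (rule matrix_vector_mul_linear_gen)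
  then show "E \<in> hermitian_ellipsoids" unfolding hermitian_ellipsoids_def using T bij_complex_matrix[OF T(1)] by blast
qed

lemma neg_log_antimono: "a \<le> b \<Longrightarrow> neg_log b \<le> neg_log a"
proof -
  assume ab: "a \<le> b"
  show "neg_log b \<le> neg_log a"
  proof (cases "a = 0 \<or> b = \<infinity>")
    case True
    then show ?thesis by (auto simp: neg_log_def)
  next
    case False
    then have "a \<noteq> \<infinity>" "b \<noteq> 0" using ab by (auto simp: top_unique)
    moreover have "0 < enn2real a" using False \<open>a \<noteq> \<infinity>\<close> by (simp add: enn2real_positive_iff zero_less_iff_neq_zero less_top)
    moreover have "enn2real a \<le> enn2real b" using ab False by (intro enn2real_mono) (auto simp: less_top)
    ultimately show ?thesis using False by (simp add: neg_log_def)
  qed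
qed

lemma neg_log_ennreal: "r > 0 \<Longrightarrow> neg_log (ennreal r) = ereal (- ln r)"
  by (simp add: neg_log_def)

text \<open>
  With the closed ball, in contrast to the open one, this is an open condition on \<open>s\<close> and \<open>T\<close>.
\<close>

definition fits :: "('s \<times> (complex ^ 'n::finite)) set \<Rightarrow> 's \<Rightarrow> complex ^ 'n ^ 'n \<Rightarrow> bool" where
  "fits X s T \<longleftrightarrow> (\<forall>x\<in>cball 0 1. (s, T *v x) \<in> X)"

definition unit_volume :: "'n::finite itself \<Rightarrow> real" where
  "unit_volume _ = measure lborel (ball (0 :: complex ^ 'n) 1)"

lemma unit_volume_pos: "unit_volume TYPE('n::finite) > 0"
  unfolding unit_volume_def by (rule measure_unit_ball_pos(1))

lemma neg_log_ellipsoid_volume: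
  fixes T :: "complex ^ 'n::finite ^ 'n"
  assumes T: "det T \<noteq> 0"
  shows "neg_log (emeasure lborel ((*v) T ` ball 0 1)) = ereal (- 2 * ln (cmod (det T)) - ln (unit_volume TYPE('n)))"
proof -
  have "emeasure lborel ((*v) T ` ball 0 1) = ennreal ((cmod (det T))\<^sup>2 * unit_volume TYPE('n))"
    unfolding unit_volume_def by (rule emeasure_ellipsoid[OF T])
  moreover have "(cmod (det T))\<^sup>2 * unit_volume TYPE('n) > 0" using T unit_volume_pos[where 'n = 'n] by simp
  moreover have "ln ((cmod (det T))\<^sup>2 * unit_volume TYPE('n)) = 2 * ln (cmod (det T)) + ln (unit_volume TYPE('n))"
    using T unit_volume_pos[where 'n = 'n] by (simp add: ln_mult ln_realpow)
  ultimately show ?thesis by (simp add: neg_log_ennreal)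
qed

lemma volume_le_max_ellipsoid_vol:
  fixes X :: "('s \<times> (complex ^ 'n::finite)) set"
  assumes "det T \<noteq> 0" "fits X s T"
  shows "emeasure lborel ((*v) T ` ball 0 1) \<le> max_ellipsoid_vol X s"
  unfolding max_ellipsoid_vol_def
proof (rule SUP_upper)
  have "(*v) T ` ball 0 1 \<subseteq> fiber X s" using assms(2) by (auto simp: fits_def fiber_def)
  then show "(*v) T ` ball 0 1 \<in> {E \<in> hermitian_ellipsoids. E \<subseteq> fiber X s}"
    using assms(1) by (auto simp: hermitian_ellipsoid_iff)
qed

lemma neg_log_max_ellipsoid_vol_le:
  fixes X :: "('s \<times> (complex ^ 'n::finite)) set"
  assumes "det T \<noteq> 0" "fits X s T"
  shows "neg_log (max_ellipsoid_vol X s) \<le> ereal (- 2 * ln (cmod (det T)) - ln (unit_volume TYPE('n)))"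
  using neg_log_antimono[OF volume_le_max_ellipsoid_vol[OF assms]] neg_log_ellipsoid_volume[OF assms(1)] by simp

text \<open>
  The open ellipsoids in the definition of the supremum are shrunk a little to obtain closed
  ones.
\<close>

lemma neg_log_max_ellipsoid_vol_less:
  fixes X :: "('s \<times> (complex ^ 'n::finite)) set"
  assumes less: "neg_log (max_ellipsoid_vol X s) < ereal a"
  obtains T where "det T \<noteq> 0" "fits X s T" "- 2 * ln (cmod (det T)) - ln (unit_volume TYPE('n)) < a"
proof -
  obtain d where d: "neg_log (max_ellipsoid_vol X s) < ereal d" "d < a"
    using ereal_dense2[OF less] by auto
  have "ennreal (exp (- d)) < max_ellipsoid_vol X s"
  proof (rule ccontr)
    assume "\<not> ?thesis"
    then have "neg_log (ennreal (exp (- d))) \<le> neg_log (max_ellipsoid_vol X s)" by (intro neg_log_antimono) simp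
    then show False using d(1) by (simp add: neg_log_ennreal)
  qed
  then obtain E where E: "E \<in> hermitian_ellipsoids" "E \<subseteq> fiber X s" "ennreal (exp (- d)) < emeasure lborel E"
    unfolding max_ellipsoid_vol_def less_SUP_iff by blast
  obtain T where T: "det T \<noteq> 0" "E = (*v) T ` ball 0 1" using E(1) by (auto simp: hermitian_ellipsoid_iff)
  let ?L = "- 2 * ln (cmod (det T)) - ln (unit_volume TYPE('n))"
  have "neg_log (emeasure lborel E) \<le> neg_log (ennreal (exp (- d)))"
    by (rule neg_log_antimono) (use E(3) in simp)
  then have L: "?L \<le> d" unfolding T(2) neg_log_ellipsoid_volume[OF T(1)] by (simp add: neg_log_ennreal)
  define n where "n = real CARD('n)"
  have n: "n > 0" by (simp add: n_def)
  \<comment> \<open>Scaling by \<open>\<rho>\<close> changes \<open>- 2 ln \<bar>det T\<bar>\<close> by \<open>- 2 n ln \<rho> = (a - d) / 2\<close>.\<close>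
  define \<rho> where "\<rho> = exp (- ((a - d) / (4 * n)))"
  have \<rho>: "0 < \<rho>" "\<rho> < 1" using n d(2) by (simp_all add: \<rho>_def)
  define T' where "T' = mat (complex_of_real \<rho>) ** T"
  have detT': "det T' = of_real \<rho> ^ CARD('n) * det T" by (simp add: T'_def det_mul det_mat)
  have T': "T' *v x = T *v (\<rho> *\<^sub>R x)" for x
    by (simp add: T'_def linear_scale[OF linear_complex_matrix] real_scalar_matrix_mult_vec flip: matrix_vector_mul_assoc)
  show ?thesis
  proof (rule that[of T'])
    show "det T' \<noteq> 0" using T(1) \<rho> by (simp add: detT')
    have "(s, T' *v x) \<in> X" if "norm x \<le> 1" for x
    proof -
      have "\<rho> * norm x \<le> \<rho> * 1" using that \<rho> by (intro mult_left_mono) auto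
      then have "\<rho> * norm x < 1" using \<rho>(2) by linarith
      then have "\<rho> *\<^sub>R x \<in> ball 0 1" using \<rho>(1) by simp
      then have "T' *v x \<in> E" unfolding T' T(2) by (rule imageI)
      then show ?thesis using E(2) by (auto simp: fiber_def)
    qed
    then show "fits X s T'" by (simp add: fits_def)
    have "ln (cmod (det T')) = n * ln \<rho> + ln (cmod (det T))"
      using T(1) \<rho> by (simp add: detT' norm_mult norm_power ln_mult ln_realpow n_def)
    also have "n * ln \<rho> = - ((a - d) / 4)" using n by (simp add: \<rho>_def)
    finally show "- 2 * ln (cmod (det T')) - ln (unit_volume TYPE('n)) < a"
      using L d(2) by (simp add: field_simps)
  qed
qed

lemma openin_fits:
  fixes X :: "('s \<times> (complex ^ 'n::finite)) set"
  assumes X: "openin (prod_topology S euclidean) X"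
  shows "openin S {s \<in> topspace S. fits X s T}"
proof -
  let ?B = "top_of_set (cball (0 :: complex ^ 'n) 1)"
  have "continuous_map (prod_topology S ?B) (prod_topology S euclidean) (\<lambda>p. (fst p, T *v snd p))"
  proof (rule continuous_map_pairedI[OF continuous_map_fst])
    have "continuous_on (cball 0 1) ((*v) T)"
      by (intro linear_continuous_on linear_conv_bounded_linear[THEN iffD1] linear_complex_matrix)
    then have "continuous_map ?B euclidean ((*v) T)" by simp
    from continuous_map_compose[OF continuous_map_snd this]
    show "continuous_map (prod_topology S ?B) euclidean (\<lambda>p. T *v snd p)" by (simp only: comp_def)
  qed
  from openin_tube[OF openin_continuous_map_preimage[OF this X]]
  have "openin S {s \<in> topspace S. \<forall>k\<in>topspace ?B. (s, k) \<in> {p \<in> topspace (prod_topology S ?B). (fst p, T *v snd p) \<in> X}}"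
    by (simp add: compact_space_subtopology)
  also have "{s \<in> topspace S. \<forall>k\<in>topspace ?B. (s, k) \<in> {p \<in> topspace (prod_topology S ?B). (fst p, T *v snd p) \<in> X}}
      = {s \<in> topspace S. fits X s T}"
    by (auto simp: fits_def)
  finally show ?thesis .
qed

lemma open_fits:
  fixes X :: "('s \<times> (complex ^ 'n::finite)) set"
  assumes X: "open (fiber X s)"
  shows "open {T. fits X s T}"
proof -
  let ?B = "top_of_set (cball (0 :: complex ^ 'n) 1)"
  let ?P = "prod_topology (euclidean :: (complex ^ 'n ^ 'n) topology) ?B"
  have "continuous_map ?P euclidean (\<lambda>p. fst p *v snd p)"
  proof -
    have "continuous_on (UNIV \<times> cball 0 1) (\<lambda>p :: (complex ^ 'n ^ 'n) \<times> (complex ^ 'n). fst p *v snd p)"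
      unfolding matrix_vector_mult_def by (intro continuous_on_vec_lambda continuous_intros)
    then show ?thesis using prod_topology_subtopology_eu[of "UNIV :: (complex ^ 'n ^ 'n) set" "cball (0 :: complex ^ 'n) 1"] by simp
  qed
  moreover have "openin euclidean (fiber X s)" using X by simp
  ultimately have "openin ?P {p \<in> topspace ?P. fst p *v snd p \<in> fiber X s}"
    by (rule openin_continuous_map_preimage)
  from openin_tube[OF this]
  have "openin euclidean {T \<in> topspace euclidean. \<forall>k\<in>topspace ?B. (T, k) \<in> {p \<in> topspace ?P. fst p *v snd p \<in> fiber X s}}"
    by (simp add: compact_space_subtopology)
  also have "{T \<in> topspace euclidean. \<forall>k\<in>topspace ?B. (T, k) \<in> {p \<in> topspace ?P. fst p *v snd p \<in> fiber X s}} = {T. fits X s T}"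
    by (auto simp: fits_def fiber_def)
  finally show ?thesis by simp
qed

text \<open>
  The tube lemma, now with the compact set \<open>K\<close> of base points and the zero section.
\<close>

lemma uniform_small_ball_fits:
  fixes X :: "('s \<times> (complex ^ 'n::finite)) set" and K :: "complex set"
  assumes X: "openin (prod_topology S euclidean) X" and zero: "topspace S \<times> {0} \<subseteq> X"
    and K: "compact K" and \<sigma>: "continuous_map (top_of_set K) S \<sigma>"
  obtains \<epsilon> where "\<epsilon> > 0" "\<And>z. z \<in> K \<Longrightarrow> fits X (\<sigma> z) (mat (complex_of_real \<epsilon>))"
proof -
  let ?P = "prod_topology (euclidean :: (complex ^ 'n) topology) (top_of_set K)"
  have "continuous_map ?P (prod_topology S euclidean) (\<lambda>p. (\<sigma> (snd p), fst p))"
    using continuous_map_compose[OF continuous_map_snd \<sigma>]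
    by (intro continuous_map_pairedI continuous_map_fst) (simp only: comp_def)
  from openin_tube[OF openin_continuous_map_preimage[OF this X]]
  have "openin euclidean {x \<in> topspace (euclidean :: (complex ^ 'n) topology). \<forall>k\<in>topspace (top_of_set K).
      (x, k) \<in> {p \<in> topspace ?P. (\<sigma> (snd p), fst p) \<in> X}}"
    using K by (simp only: compact_space_subtopology compactin_euclidean_iff)
  also have "{x \<in> topspace (euclidean :: (complex ^ 'n) topology). \<forall>k\<in>topspace (top_of_set K).
      (x, k) \<in> {p \<in> topspace ?P. (\<sigma> (snd p), fst p) \<in> X}} = {x. \<forall>k\<in>K. (\<sigma> k, x) \<in> X}"
    by auto
  finally have "open {x. \<forall>k\<in>K. (\<sigma> k, x) \<in> X}" by simp
  moreover have "\<sigma> k \<in> topspace S" if "k \<in> K" for k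
    using \<sigma> that by (auto simp: continuous_map_def)
  then have "0 \<in> {x. \<forall>k\<in>K. (\<sigma> k, x) \<in> X}" using zero by auto
  ultimately obtain \<epsilon> where \<epsilon>: "\<epsilon> > 0" "cball 0 \<epsilon> \<subseteq> {x. \<forall>k\<in>K. (\<sigma> k, x) \<in> X}"
    by (auto simp: open_contains_cball)
  show ?thesis
  proof (rule that[OF \<epsilon>(1)])
    fix z assume z: "z \<in> K"
    have "(\<sigma> z, mat (complex_of_real \<epsilon>) *v x) \<in> X" if "norm x \<le> 1" for x
    proof -
      have "\<epsilon> *\<^sub>R x \<in> cball 0 \<epsilon>" using \<epsilon>(1) that by (simp add: mult_left_le)
      then show ?thesis unfolding real_scalar_matrix_mult_vec using \<epsilon>(2) z by blast
    qed
    then show "fits X (\<sigma> z) (mat (complex_of_real \<epsilon>))" by (simp add: fits_def)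
  qed
qed

lemma max_ellipsoid_vol_pos:
  fixes X :: "('s \<times> (complex ^ 'n::finite)) set"
  assumes X: "openin (prod_topology S euclidean) X" and zero: "topspace S \<times> {0} \<subseteq> X" and s: "s \<in> topspace S"
  shows "0 < max_ellipsoid_vol X s"
proof -
  have "continuous_map (top_of_set {0}) S (\<lambda>_. s)" using s by simp
  then obtain \<epsilon> where \<epsilon>: "\<epsilon> > 0" "fits X s (mat (complex_of_real \<epsilon>))"
    using uniform_small_ball_fits[OF X zero, of "{0}" "\<lambda>_. s"] by auto
  have d: "det (mat (complex_of_real \<epsilon>) :: complex ^ 'n ^ 'n) \<noteq> 0" using \<epsilon>(1) by (simp add: det_mat)
  have "0 < emeasure lborel ((*v) (mat (complex_of_real \<epsilon>)) ` ball (0 :: complex ^ 'n) 1)"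
    unfolding emeasure_ellipsoid[OF d] using d measure_unit_ball_pos[where 'a = "complex ^ 'n"] by simp
  also have "\<dots> \<le> max_ellipsoid_vol X s" by (rule volume_le_max_ellipsoid_vol[OF d \<epsilon>(2)])
  finally show ?thesis .
qed

lemma openin_neg_log_max_ellipsoid_vol_less:
  fixes X :: "('s \<times> (complex ^ 'n::finite)) set"
  assumes X: "openin (prod_topology S euclidean) X"
  shows "openin S {s \<in> topspace S. neg_log (max_ellipsoid_vol X s) < c}"
proof (subst openin_subopen, intro ballI)
  fix s assume s: "s \<in> {s \<in> topspace S. neg_log (max_ellipsoid_vol X s) < c}"
  then obtain a where a: "neg_log (max_ellipsoid_vol X s) < ereal a" "ereal a < c" using ereal_dense2 by blast
  obtain T :: "complex ^ 'n ^ 'n" where T: "det T \<noteq> 0" "fits X s T" "- 2 * ln (cmod (det T)) - ln (unit_volume TYPE('n)) < a"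
    using neg_log_max_ellipsoid_vol_less[OF a(1)] by blast
  have "neg_log (max_ellipsoid_vol X s') < c" if "fits X s' T" for s'
  proof -
    have "neg_log (max_ellipsoid_vol X s') \<le> ereal (- 2 * ln (cmod (det T)) - ln (unit_volume TYPE('n)))"
      by (rule neg_log_max_ellipsoid_vol_le[OF T(1) that])
    also have "\<dots> < ereal a" using T(3) by simp
    also note a(2)
    finally show ?thesis .
  qed
  then show "\<exists>W. openin S W \<and> s \<in> W \<and> W \<subseteq> {s \<in> topspace S. neg_log (max_ellipsoid_vol X s) < c}"
    using openin_fits[OF X, of T] s T(2) by (intro exI[of _ "{s \<in> topspace S. fits X s T}"]) auto
qed

section \<open>Plurisubharmonicity\<close>

text \<open>
  Here \<open>fits X\<close> along the disc is the validity predicate of \<open>ellipsoid_circle_mean\<close>; the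
  continuity principle carries validity from the circle to the center.
\<close>

lemma disc_mean_inequality:
  fixes S :: "'s topology" and A :: "('s, 'm::finite) chart set" and X :: "('s \<times> (complex ^ 'n::finite)) set"
  assumes man: "complex_manifold S A" and fam: "pseudoconvex_family S A X" and chart: "(U, \<phi>) \<in> A"
    and disc: "\<And>\<zeta>. cmod \<zeta> \<le> 1 \<Longrightarrow> a + \<zeta> *s w \<in> \<phi> ` U"
  defines "u \<equiv> \<lambda>\<zeta>. neg_log (max_ellipsoid_vol X (inv_into U \<phi> (a + \<zeta> *s w)))"
  shows "u 0 \<le> circle_mean u 0 1"
proof -
  have ic: "is_chart S (U, \<phi>)" using man chart unfolding complex_manifold_def by blast
  have X: "openin (prod_topology S euclidean) X" "topspace S \<times> {0} \<subseteq> X"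
    and fib: "\<And>s. s \<in> topspace S \<Longrightarrow> open (fiber X s)"
    using fam by (auto simp: pseudoconvex_family_def family_of_pseudoconvex_sets_def pseudoconvex_def)
  define \<sigma> where "\<sigma> \<zeta> = inv_into U \<phi> (a + \<zeta> *s w)" for \<zeta>
  have c\<sigma>: "continuous_map (top_of_set (sphere 0 1)) S \<sigma>"
    unfolding \<sigma>_def by (rule continuous_disc[OF ic]) (use disc in auto)
  have \<sigma>S: "\<sigma> \<zeta> \<in> topspace S" if "cmod \<zeta> = 1" for \<zeta>
    using c\<sigma> that by (auto simp: continuous_map_def)
  obtain \<epsilon> where \<epsilon>: "\<epsilon> > 0" "\<And>z. z \<in> sphere 0 1 \<Longrightarrow> fits X (\<sigma> z) (mat (complex_of_real \<epsilon>))"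
    using uniform_small_ball_fits[OF X compact_sphere c\<sigma>] by blast
  show ?thesis
  proof (rule ellipsoid_circle_mean[of "\<lambda>\<zeta>. fits X (\<sigma> \<zeta>)" \<epsilon> u "ln (unit_volume TYPE('n))"])
    fix z and T T' :: "complex ^ 'n ^ 'n"
    assume "fits X (\<sigma> z) T" "(*v) T' ` cball 0 1 \<subseteq> (*v) T ` cball 0 1"
    then have "\<And>y. y \<in> (*v) T' ` cball 0 1 \<Longrightarrow> (\<sigma> z, y) \<in> X" by (auto simp: fits_def)
    then show "fits X (\<sigma> z) T'" by (auto simp: fits_def)
  next
    fix T :: "complex ^ 'n ^ 'n"
    have "openin (top_of_set (sphere 0 1)) {z \<in> topspace (top_of_set (sphere 0 1)). \<sigma> z \<in> {s \<in> topspace S. fits X s T}}"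
      by (rule openin_continuous_map_preimage[OF c\<sigma> openin_fits[OF X(1)]])
    also have "{z \<in> topspace (top_of_set (sphere 0 1)). \<sigma> z \<in> {s \<in> topspace S. fits X s T}} = {z \<in> sphere 0 1. fits X (\<sigma> z) T}"
      using \<sigma>S by auto
    finally show "openin (top_of_set (sphere 0 1)) {z \<in> sphere 0 1. fits X (\<sigma> z) T}" .
  next
    show "open {T. fits X (\<sigma> z) T}" if "cmod z = 1" for z by (rule open_fits[OF fib[OF \<sigma>S[OF that]]])
  next
    fix F :: "'n \<Rightarrow> 'n \<Rightarrow> complex poly"
    assume F: "\<And>z. cmod z = 1 \<Longrightarrow> fits X (\<sigma> z) (poly_matrix F z)"
    have "(inv_into U \<phi> (a + 0 *s w), poly_matrix F 0 *v x) \<in> X" if "norm x \<le> 1" for x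
      by (rule continuity_principle[OF man fam chart disc _ that]) (use F in \<open>auto simp: fits_def \<sigma>_def\<close>)
    then show "fits X (\<sigma> 0) (poly_matrix F 0)" by (simp add: fits_def \<sigma>_def)
  next
    show "u z \<le> ereal (- 2 * ln (cmod (det T)) - ln (unit_volume TYPE('n)))"
      if "det T \<noteq> 0" "fits X (\<sigma> z) T" for z T
      using neg_log_max_ellipsoid_vol_le[OF that] by (simp add: u_def \<sigma>_def)
  next
    fix z c assume "u z < ereal c"
    then obtain T :: "complex ^ 'n ^ 'n" where "det T \<noteq> 0" "fits X (\<sigma> z) T" "- 2 * ln (cmod (det T)) - ln (unit_volume TYPE('n)) < c"
      using neg_log_max_ellipsoid_vol_less[of X "\<sigma> z" c] unfolding u_def \<sigma>_def by blast
    then show "\<exists>T. det T \<noteq> 0 \<and> fits X (\<sigma> z) T \<and> - 2 * ln (cmod (det T)) - ln (unit_volume TYPE('n)) < c" by blast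
  qed (use \<epsilon> in auto)
qed

text \<open>
  Every closed disc in a complex line in the chart becomes the unit disc after an affine change of
  the parameter.
\<close>

lemma plurisubharmonic_in_chart:
  fixes S :: "'s topology" and A :: "('s, 'm::finite) chart set" and X :: "('s \<times> (complex ^ 'n::finite)) set"
  assumes man: "complex_manifold S A" and fam: "pseudoconvex_family S A X" and chart: "(U, \<phi>) \<in> A"
  shows "plurisubharmonic_on (\<phi> ` U) ((\<lambda>s. neg_log (max_ellipsoid_vol X s)) \<circ> inv_into U \<phi>)"
proof -
  let ?nl = "\<lambda>s. neg_log (max_ellipsoid_vol X s)" and ?D = "\<phi> ` U"
  have ic: "is_chart S (U, \<phi>)" using man chart unfolding complex_manifold_def by blast
  note cp = chart_properties[OF ic]
  have X: "openin (prod_topology S euclidean) X" "topspace S \<times> {0} \<subseteq> X"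
    using fam by (auto simp: pseudoconvex_family_def family_of_pseudoconvex_sets_def)
  have usc: "usc_on B (\<lambda>x. ?nl (\<sigma> x))" if \<sigma>: "continuous_map (top_of_set B) S \<sigma>"
    for B :: "'b::topological_space set" and \<sigma>
    unfolding usc_on_def
  proof
    fix c
    have "openin (top_of_set B) {x \<in> topspace (top_of_set B). \<sigma> x \<in> {s \<in> topspace S. ?nl s < c}}"
      by (rule openin_continuous_map_preimage[OF \<sigma> openin_neg_log_max_ellipsoid_vol_less[OF X(1)]])
    also have "{x \<in> topspace (top_of_set B). \<sigma> x \<in> {s \<in> topspace S. ?nl s < c}} = {x \<in> B. ?nl (\<sigma> x) < c}"
      using \<sigma> by (auto simp: continuous_map_def)
    finally show "openin (top_of_set B) {x \<in> B. ?nl (\<sigma> x) < c}" .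
  qed
  have fin: "?nl (inv_into U \<phi> x) < \<infinity>" if "x \<in> ?D" for x
  proof -
    have "inv_into U \<phi> x \<in> topspace S" using inv_into_into[OF that] cp(1) by blast
    then have "0 < max_ellipsoid_vol X (inv_into U \<phi> x)" by (rule max_ellipsoid_vol_pos[OF X])
    then show ?thesis by (auto simp: neg_log_def)
  qed
  have line: "subharmonic_on {\<tau>. z + \<tau> *s w \<in> ?D} (\<lambda>\<tau>. ?nl (inv_into U \<phi> (z + \<tau> *s w)))" for z w
    unfolding subharmonic_on_def
  proof (intro conjI ballI allI impI)
    show "usc_on {\<tau>. z + \<tau> *s w \<in> ?D} (\<lambda>\<tau>. ?nl (inv_into U \<phi> (z + \<tau> *s w)))"
      by (rule usc, rule continuous_disc[OF ic]) simp
    show "?nl (inv_into U \<phi> (z + \<tau> *s w)) < \<infinity>" if "\<tau> \<in> {\<tau>. z + \<tau> *s w \<in> ?D}" for \<tau>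
      by (rule fin) (use that in simp)
  next
    fix c r assume cr: "0 < r \<and> cball c r \<subseteq> {\<tau>. z + \<tau> *s w \<in> ?D}"
    have eq: "(z + c *s w) + \<zeta> *s (of_real r *s w) = z + (c + of_real r * \<zeta>) *s w" for \<zeta>
      by (simp add: vec_eq_iff algebra_simps)
    have "(z + c *s w) + \<zeta> *s (of_real r *s w) \<in> ?D" if "cmod \<zeta> \<le> 1" for \<zeta>
    proof -
      have "c + of_real r * \<zeta> \<in> cball c r" using cr that by (simp add: dist_norm norm_mult)
      then show ?thesis unfolding eq using cr by blast
    qed
    from disc_mean_inequality[OF man fam chart, of "z + c *s w" "of_real r *s w", OF this]
    show "?nl (inv_into U \<phi> (z + c *s w)) \<le> circle_mean (\<lambda>\<tau>. ?nl (inv_into U \<phi> (z + \<tau> *s w))) c r"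
      unfolding eq by (simp add: circle_mean_def)
  qed
  show ?thesis
    unfolding plurisubharmonic_on_def comp_def
    using usc[OF cp(3)] fin line by blast
qed

theorem theorem1p2:
  fixes S :: "'s topology"
    and A :: "('s, 'm::finite) chart set"
    and X :: "('s \<times> (complex ^ 'n::finite)) set"
  assumes "complex_manifold S A"
    and "pseudoconvex_family S A X"
  shows "(\<forall>s\<in>topspace S. 0 < max_ellipsoid_vol X s) \<and>
         (\<forall>s\<in>topspace S. \<forall>E\<in>hermitian_ellipsoids.
            E \<subseteq> fiber X s \<and>
            (\<forall>E'\<in>hermitian_ellipsoids. E' \<subseteq> fiber X s \<longrightarrow> emeasure lborel E' \<le> emeasure lborel E)
            \<longrightarrow> max_ellipsoid_vol X s = emeasure lborel E) \<and>
         plurisubharmonic_on_manifold A (\<lambda>s. neg_log (max_ellipsoid_vol X s))"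
proof (intro conjI)
  have X: "openin (prod_topology S euclidean) X" "topspace S \<times> {0} \<subseteq> X"
    using assms(2) by (auto simp: pseudoconvex_family_def family_of_pseudoconvex_sets_def)
  show "\<forall>s\<in>topspace S. 0 < max_ellipsoid_vol X s"
    using max_ellipsoid_vol_pos[OF X] by blast
  show "\<forall>s\<in>topspace S. \<forall>E\<in>hermitian_ellipsoids.
            E \<subseteq> fiber X s \<and>
            (\<forall>E'\<in>hermitian_ellipsoids. E' \<subseteq> fiber X s \<longrightarrow> emeasure lborel E' \<le> emeasure lborel E)
            \<longrightarrow> max_ellipsoid_vol X s = emeasure lborel E"
    unfolding max_ellipsoid_vol_def by (auto intro!: antisym SUP_least SUP_upper)
  show "plurisubharmonic_on_manifold A (\<lambda>s. neg_log (max_ellipsoid_vol X s))"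
    unfolding plurisubharmonic_on_manifold_def using plurisubharmonic_in_chart[OF assms] by blast
qed

end
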